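(* Let $D=(0,\infty)$, let $\eta$ be a finite Borel measure on $D$, and let $$\varphi(x,z)=\int_{\mathbb{R}^\circ}(e^{izu}-1-izu)\,m(x,du),\qquad x\in D,\ z\in\mathbb{R},$$ where $|u|\,m(x,du)$ is a bounded kernel from $D$ to $\mathbb{R}^\circ=\mathbb{R}\setminus\{0\}$. Let $N(ds,du,dx)$ be a Poisson random measure on $[0,\infty)\times\mathbb{R}^\circ\times D$ with intensity $ds\,m(x,du)\,\eta(dx)$ and let $\tilde N(ds,du,dx)=N(ds,du,dx)-ds\,m(x,du)\,\eta(dx)$. Then the process $\{Y_t:t\ge0\}$ defined by $$Y_t(f):=\int_0^t\int_{\mathbb{R}^\circ}\int_D u\,P_{t-s}f(x)\,\tilde N(ds,du,dx),\qquad t\ge0,\ f\in B(D),$$ is an a.s. right continuous $S(D)$-valued strong Markov process with transition semigroup $(R_t)_{t\ge0}$ defined by $$\int_{S(D)}e^{i\nu(f)}R_t(\mu,d\nu)=\exp\Big\{i\mu(P_tf)+\int_0^t\eta(\varphi(P_sf))\,ds\Big\},\qquad f\in B(D).$$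
   Context: $B(D)$ is the set of bounded Borel functions on $D$; $\mu(f)=\int f\,d\mu$; $\eta(\varphi(P_sf))=\int_D\varphi(x,P_sf(x))\,\eta(dx)$. "$|u|m(x,du)$ is a bounded kernel" means that $m(x,du)$ is a kernel with $\sup_{x\in D}\int_{\mathbb{R}^\circ}|u|\,m(x,du)<\infty$. With $g_t(x)=(2\pi t)^{-1/2}\exp\{-x^2/2t\}$ and $p_t(x,y)=g_t(x-y)-g_t(x+y)$, $(P_t)_{t\ge0}$ is the transition semigroup of the absorbing barrier Brownian motion in $D$: $P_0f=f$ and $P_tf(x)=\int_0^\infty p_t(x,y)f(y)\,dy$ for $t>0$. The integral with respect to $\tilde N$ is the integral with respect to $N$ minus the integral with respect to the intensity. For a locally compact metric space $E$ (metrized so that the space of bounded uniformly continuous functions on $E$ with the supremum norm is separable), $M(E)$ is the space of finite Borel measures on $E$ and $S(E)=\{\mu^+-\mu^-:\mu^+,\mu^-\in M(E)\}$ is the space of finite signed measures. Fix a countable dense subset $\{f_n\}_{n\ge1}$ of the space of bounded uniformly continuous functions on $E$ and put $r(\mu,\nu)=\sum_{n=1}^\infty2^{-n}(1\wedge|\mu(f_n)-\nu(f_n)|)$ for $\mu,\nu\in M(E)$, a metric compatible with weak convergence on $M(E)$. $S(E)$ is given the metric $$\rho(\mu,\nu)=\inf\{r(\mu^+,\nu^+)+r(\mu^-,\nu^-):\ \mu^\pm,\nu^\pm\in M(E),\ \mu^+-\mu^-=\mu,\ \nu^+-\nu^-=\nu\}.$$ Right continuity in $S(D)$ is with respect to $\rho$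 (with $E=D$). *)

theory Defs
  imports "HOL-Probability.Probability"
begin

section \<open>Finite signed measures on a measurable space\<close>

text \<open>Throughout this section \<open>E\<close> only matters through its sigma-algebra (the Borel sets of the
  underlying metric space).  A finite signed measure is encoded by its set function, extended by
  \<open>0\<close> to non-measurable sets, which is what \<^const>\<open>measure\<close> does; hence equality in
  \<open>fin_signed E\<close> is equality of signed measures.\<close>

definition fin_meas :: "'a measure \<Rightarrow> 'a measure set" where
  "fin_meas E = {p. sets p = sets E \<and> finite_measure p}"

definition sdiff :: "'a measure \<Rightarrow> 'a measure \<Rightarrow> 'a set \<Rightarrow> real" where
  "sdiff p n = (\<lambda>A. measure p A - measure n A)"

definition fin_signed :: "'a measure \<Rightarrow> ('a set \<Rightarrow> real) set" where
  "fin_signed E = {sdiff p n | p n. p \<in> fin_meas E \<and> n \<in> fin_meas E}"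

definition bdd_borel :: "'a measure \<Rightarrow> ('a \<Rightarrow> real) set" where
  "bdd_borel E = {f. f \<in> borel_measurable E \<and> bounded (f ` space E)}"

text \<open>\<open>sint E \<nu> f\<close> is \<open>\<nu>(f)\<close>; lemma \<open>sint_eq\<close> below shows that it does not depend on the
  decomposition.\<close>

definition sint :: "'a measure \<Rightarrow> ('a set \<Rightarrow> real) \<Rightarrow> ('a \<Rightarrow> real) \<Rightarrow> real" where
  "sint E \<nu> f = (SOME c. \<exists>p\<in>fin_meas E. \<exists>n\<in>fin_meas E.
     \<nu> = sdiff p n \<and> c = integral\<^sup>L p f - integral\<^sup>L n f)"

definition r_dist :: "(nat \<Rightarrow> 'a \<Rightarrow> real) \<Rightarrow> 'a measure \<Rightarrow> 'a measure \<Rightarrow> real" where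
  "r_dist fs p q = (\<Sum>k. (1/2) ^ Suc k * min 1 \<bar>integral\<^sup>L p (fs k) - integral\<^sup>L q (fs k)\<bar>)"

definition rho_dist ::
    "'a measure \<Rightarrow> (nat \<Rightarrow> 'a \<Rightarrow> real) \<Rightarrow> ('a set \<Rightarrow> real) \<Rightarrow> ('a set \<Rightarrow> real) \<Rightarrow> real" where
  "rho_dist E fs \<mu> \<nu> = Inf {r_dist fs p p' + r_dist fs n n' | p n p' n'.
     p \<in> fin_meas E \<and> n \<in> fin_meas E \<and> p' \<in> fin_meas E \<and> n' \<in> fin_meas E \<and>
     sdiff p n = \<mu> \<and> sdiff p' n' = \<nu>}"

text \<open>\<open>S(E)\<close> with the Borel sigma-algebra of \<open>\<rho>\<close>, i.e. the one generated by the \<open>\<rho>\<close>-open sets.\<close>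

definition signed_space :: "'a measure \<Rightarrow> (nat \<Rightarrow> 'a \<Rightarrow> real) \<Rightarrow> ('a set \<Rightarrow> real) measure" where
  "signed_space E fs = sigma (fin_signed E)
     {U. U \<subseteq> fin_signed E \<and>
         (\<forall>\<mu>\<in>U. \<exists>e>0. \<forall>\<nu>\<in>fin_signed E. rho_dist E fs \<mu> \<nu> < e \<longrightarrow> \<nu> \<in> U)}"

lemma integrable_bdd_borel:
  assumes "p \<in> fin_meas E" "f \<in> bdd_borel E"
  shows "integrable p f"
proof -
  interpret finite_measure p using assms(1) by (simp add: fin_meas_def)
  have s: "sets p = sets E" using assms(1) by (simp add: fin_meas_def)
  obtain B where "\<And>x. x \<in> space E \<Longrightarrow> norm (f x) \<le> B"
    using assms(2) by (auto simp: bdd_borel_def bounded_iff)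
  moreover have "f \<in> borel_measurable p"
    using assms(2) measurable_cong_sets[OF s refl] by (auto simp: bdd_borel_def)
  ultimately show ?thesis
    by (intro integrable_const_bound[where B = B] AE_I2) (auto simp: sets_eq_imp_space_eq[OF s])
qed

lemma sint_eq:
  assumes p: "p \<in> fin_meas E" and n: "n \<in> fin_meas E" and f: "f \<in> bdd_borel E"
  shows "sint E (sdiff p n) f = integral\<^sup>L p f - integral\<^sup>L n f"
proof -
  have add: "integral\<^sup>L a f + integral\<^sup>L b f = integral\<^sup>L a' f + integral\<^sup>L b' f"
    if a: "a \<in> fin_meas E" and b: "b \<in> fin_meas E" and a': "a' \<in> fin_meas E"
      and b': "b' \<in> fin_meas E" and eq: "\<And>A. measure a A + measure b A = measure a' A + measure b' A"
    for a b a' b'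
  proof -
    obtain B where B: "\<And>x. x \<in> space E \<Longrightarrow> \<bar>f x\<bar> \<le> B"
      using f by (auto simp: bdd_borel_def bounded_iff)
    have fm: "f \<in> borel_measurable E" using f by (simp add: bdd_borel_def)
    have fE: "g \<in> borel_measurable c" if "c \<in> fin_meas E" "g \<in> borel_measurable E"
      for c and g :: "'a \<Rightarrow> ennreal"
      using that measurable_cong_sets[of c E borel borel] by (auto simp: fin_meas_def)
    have em: "emeasure a A + emeasure b A = emeasure a' A + emeasure b' A" for A
    proof -
      have "emeasure c A = ennreal (measure c A)" if "c \<in> fin_meas E" for c
        using that by (simp add: fin_meas_def finite_measure.emeasure_eq_measure)
      then show ?thesis using a b a' b' eq[of A] by (simp flip: ennreal_plus)
    qed
    have nn: "integral\<^sup>N a g + integral\<^sup>N b g = integral\<^sup>N a' g + integral\<^sup>N b' g"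
      if "g \<in> borel_measurable E" for g
      using that
    proof (induction rule: borel_measurable_induct)
      case (cong f g)
      have "integral\<^sup>N c f = integral\<^sup>N c g" if "c \<in> fin_meas E" for c
        using that cong(3) sets_eq_imp_space_eq[of c E] 
        by (intro nn_integral_cong) (auto simp: fin_meas_def)
      then show ?case using cong a b a' b' by simp
    next
      case (set A)
      have "integral\<^sup>N c (indicator A) = emeasure c A" if "c \<in> fin_meas E" for c
        using that set by (simp add: fin_meas_def)
      then show ?case using em[of A] a b a' b' by simp
    next
      case (mult u c)
      have "integral\<^sup>N e (\<lambda>x. c * u x) = c * integral\<^sup>N e u" if "e \<in> fin_meas E" for e
        using fE[OF that mult(2)] by (rule nn_integral_cmult)
      then show ?case using mult a b a' b' by (simp flip: distrib_left)
    next
      case (add u v)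
      have S: "integral\<^sup>N e (\<lambda>x. v x + u x) = integral\<^sup>N e v + integral\<^sup>N e u"
        if "e \<in> fin_meas E" for e
        by (rule nn_integral_add) (rule fE[OF that add.hyps(3)] fE[OF that add.hyps(1)])+
      have ac: "(p + q) + (r + s) = (p + r) + (q + s)" for p q r s :: ennreal
        by (simp add: ac_simps)
      show ?case
        unfolding S[OF a] S[OF b] S[OF a'] S[OF b']
        by (subst (1 2) ac) (simp only: add.IH)
    next
      case (seq U)
      have S: "integral\<^sup>N e (Sup (range U)) = (SUP i. integral\<^sup>N e (U i))"
        if "e \<in> fin_meas E" for e
      proof -
        have "Sup (range U) = (\<lambda>x. SUP i. U i x)" by (simp add: fun_eq_iff image_comp)
        then show ?thesis
          using nn_integral_monotone_convergence_SUP[OF seq.hyps(3), of e] fE[OF that seq.hyps(1)]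
          by simp
      qed
      have I: "incseq (\<lambda>i. integral\<^sup>N e (U i))" for e
        using seq.hyps(3) by (auto simp: incseq_def le_fun_def intro!: nn_integral_mono)
      show ?case
        unfolding S[OF a] S[OF b] S[OF a'] S[OF b']
        by (simp only: ennreal_SUP_add[OF I I, symmetric] seq.IH)
    qed
    have L: "integral\<^sup>L c f = enn2real (\<integral>\<^sup>+x. ennreal (f x + B) \<partial>c) - B * measure c (space E)"
      "(\<integral>\<^sup>+x. ennreal (f x + B) \<partial>c) < \<top>" if c: "c \<in> fin_meas E" for c
    proof -
      interpret finite_measure c using c by (simp add: fin_meas_def)
      have s: "space c = space E" using c sets_eq_imp_space_eq[of c E] by (auto simp: fin_meas_def)
      have i: "integrable c f" by (rule integrable_bdd_borel[OF c f])
      then have i2: "integrable c (\<lambda>x. f x + B)" by simp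
      have pos: "AE x in c. 0 \<le> f x + B" using B s by (intro AE_I2) (force simp: abs_le_iff)
      have eq: "(\<integral>\<^sup>+x. ennreal (f x + B) \<partial>c) = ennreal (\<integral>x. f x + B \<partial>c)"
        by (rule nn_integral_eq_integral[OF i2 pos])
      have "(\<integral>x. f x + B \<partial>c) = integral\<^sup>L c f + B * measure c (space E)"
        using i s by (simp add: mult.commute)
      then show "integral\<^sup>L c f = enn2real (\<integral>\<^sup>+x. ennreal (f x + B) \<partial>c) - B * measure c (space E)"
        using integral_nonneg_AE[OF pos] eq by simp
      show "(\<integral>\<^sup>+x. ennreal (f x + B) \<partial>c) < \<top>" using eq by simp
    qed
    have g: "(\<lambda>x. ennreal (f x + B)) \<in> borel_measurable E" using fm by measurable
    have "enn2real (\<integral>\<^sup>+x. ennreal (f x + B) \<partial>a) + enn2real (\<integral>\<^sup>+x. ennreal (f x + B) \<partial>b)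
        = enn2real (\<integral>\<^sup>+x. ennreal (f x + B) \<partial>a') + enn2real (\<integral>\<^sup>+x. ennreal (f x + B) \<partial>b')"
      using nn[OF g] L(2)[OF a] L(2)[OF b] L(2)[OF a'] L(2)[OF b']
      by (simp flip: enn2real_plus)
    moreover have "B * measure a (space E) + B * measure b (space E)
        = B * measure a' (space E) + B * measure b' (space E)"
      using eq[of "space E"] by (simp flip: distrib_left)
    ultimately show ?thesis
      unfolding L(1)[OF a] L(1)[OF b] L(1)[OF a'] L(1)[OF b'] by linarith
  qed
  show ?thesis
    unfolding sint_def
  proof (rule some_equality)
    show "\<exists>p'\<in>fin_meas E. \<exists>n'\<in>fin_meas E. sdiff p n = sdiff p' n' \<and>
        integral\<^sup>L p f - integral\<^sup>L n f = integral\<^sup>L p' f - integral\<^sup>L n' f"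
      using p n by blast
  next
    fix c
    assume "\<exists>p'\<in>fin_meas E. \<exists>n'\<in>fin_meas E. sdiff p n = sdiff p' n' \<and>
        c = integral\<^sup>L p' f - integral\<^sup>L n' f"
    then obtain p' n' where p': "p' \<in> fin_meas E" and n': "n' \<in> fin_meas E"
      and e: "sdiff p n = sdiff p' n'" and c: "c = integral\<^sup>L p' f - integral\<^sup>L n' f"
      by blast
    have "measure p A + measure n' A = measure p' A + measure n A" for A
      using fun_cong[OF e, of A] by (simp add: sdiff_def)
    from add[OF p n' p' n this] show "c = integral\<^sup>L p f - integral\<^sup>L n f"
      using c by simp
  qed
qed

definition buc :: "'a metric \<Rightarrow> ('a \<Rightarrow> real) set" where
  "buc d = {g. uniformly_continuous_map d euclidean_metric g \<and> bounded (g ` mspace d)}"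

definition dense_in_buc :: "'a metric \<Rightarrow> (nat \<Rightarrow> 'a \<Rightarrow> real) \<Rightarrow> bool" where
  "dense_in_buc d fs \<longleftrightarrow> range fs \<subseteq> buc d \<and>
     (\<forall>g\<in>buc d. \<forall>e>0. \<exists>k. \<forall>x\<in>mspace d. \<bar>fs k x - g x\<bar> < e)"


section \<open>Transition semigroups and strong Markov processes\<close>

definition transition_semigroup :: "'s measure \<Rightarrow> (real \<Rightarrow> 's \<Rightarrow> 's measure) \<Rightarrow> bool" where
  "transition_semigroup S R \<longleftrightarrow>
     (\<forall>t\<ge>0. R t \<in> S \<rightarrow>\<^sub>M prob_algebra S) \<and>
     (\<forall>\<mu>\<in>space S. R 0 \<mu> = return S \<mu>) \<and>
     (\<forall>s\<ge>0. \<forall>t\<ge>0. \<forall>\<mu>\<in>space S. R (s + t) \<mu> = R s \<mu> \<bind> R t)"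

text \<open>Natural filtration of \<open>Y\<close> (the processes are indexed by \<open>t \<ge> 0\<close>), enlarged by the null sets
  and then made right continuous.  Filtrations are indexed by \<open>[0,\<infinity>]\<close> so that stopping times may
  take the value \<open>\<infinity>\<close>; the value of the right-continuous version at \<open>\<infinity>\<close> is that of the original
  filtration at \<open>\<infinity>\<close>.\<close>

definition natural_filt ::
    "'w measure \<Rightarrow> 's measure \<Rightarrow> (real \<Rightarrow> 'w \<Rightarrow> 's) \<Rightarrow> ennreal \<Rightarrow> 'w measure" where
  "natural_filt M S Y t = sigma (space M)
     ({Y r -` B \<inter> space M | r B. 0 \<le> r \<and> ennreal r \<le> t \<and> B \<in> sets S} \<union> null_sets M)"

definition augmented_filt ::
    "'w measure \<Rightarrow> 's measure \<Rightarrow> (real \<Rightarrow> 'w \<Rightarrow> 's) \<Rightarrow> ennreal \<Rightarrow> 'w measure" where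
  "augmented_filt M S Y t =
     sigma (space M) (\<Inter>s\<in>{s. t < s \<or> s = \<infinity>}. sets (natural_filt M S Y s))"

definition strong_markov_process ::
    "'w measure \<Rightarrow> 's measure \<Rightarrow> (real \<Rightarrow> 'w \<Rightarrow> 's) \<Rightarrow> (real \<Rightarrow> 's \<Rightarrow> 's measure) \<Rightarrow> bool" where
  "strong_markov_process M S Y R \<longleftrightarrow>
     (\<forall>t\<ge>0. Y t \<in> M \<rightarrow>\<^sub>M S) \<and>
     (\<forall>\<tau>. stopping_time (augmented_filt M S Y) \<tau> \<longrightarrow>
       (let F\<tau> = filtration.pre_sigma (space M) (augmented_filt M S Y) \<tau>;
            Y\<tau> = (\<lambda>h \<omega>. Y (enn2real (\<tau> \<omega>) + h) \<omega>)
        in Y\<tau> 0 \<in> restrict_space F\<tau> {\<omega>. \<tau> \<omega> < \<infinity>} \<rightarrow>\<^sub>M S \<and>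
           (\<forall>t\<ge>0. \<forall>B\<in>sets S. AE \<omega> in M. \<tau> \<omega> < \<infinity> \<longrightarrow>
              real_cond_exp M F\<tau> (indicator {\<omega>'\<in>space M. \<tau> \<omega>' < \<infinity> \<and> Y\<tau> t \<omega>' \<in> B}) \<omega>
                = measure (R t (Y\<tau> 0 \<omega>)) B)))"


section \<open>Poisson random measures\<close>

definition poisson_random_measure ::
    "'w measure \<Rightarrow> 'e measure \<Rightarrow> ('w \<Rightarrow> 'e measure) \<Rightarrow> bool" where
  "poisson_random_measure M \<Lambda> N \<longleftrightarrow>
     (\<forall>\<omega>\<in>space M. sets (N \<omega>) = sets \<Lambda>) \<and>
     (\<forall>A\<in>sets \<Lambda>. (\<lambda>\<omega>. emeasure (N \<omega>) A) \<in> borel_measurable M) \<and>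
     (\<forall>A\<in>sets \<Lambda>. emeasure \<Lambda> A < \<infinity> \<longrightarrow> (\<forall>k.
        measure M {\<omega>\<in>space M. emeasure (N \<omega>) A = of_nat k}
          = exp (- measure \<Lambda> A) * measure \<Lambda> A ^ k / fact k)) \<and>
     (\<forall>A\<in>sets \<Lambda>. emeasure \<Lambda> A = \<infinity> \<longrightarrow> (AE \<omega> in M. emeasure (N \<omega>) A = \<infinity>)) \<and>
     (\<forall>A :: nat \<Rightarrow> 'e set. range A \<subseteq> sets \<Lambda> \<longrightarrow> disjoint_family A \<longrightarrow>
        prob_space.indep_vars M (\<lambda>_. borel) (\<lambda>i \<omega>. emeasure (N \<omega>) (A i)) UNIV)"


section \<open>The state space, the semigroup and the process\<close>

definition D_space :: "real measure" where
  "D_space = restrict_space borel {0<..}"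

definition R0_space :: "real measure" where
  "R0_space = restrict_space borel (- {0})"

definition SUX_space :: "(real \<times> real \<times> real) measure" where
  "SUX_space = restrict_space borel {0..} \<Otimes>\<^sub>M (R0_space \<Otimes>\<^sub>M D_space)"

definition gauss_density :: "real \<Rightarrow> real \<Rightarrow> real" where
  "gauss_density t x = exp (- (x\<^sup>2 / (2 * t))) / sqrt (2 * pi * t)"

definition p_kernel :: "real \<Rightarrow> real \<Rightarrow> real \<Rightarrow> real" where
  "p_kernel t x y = gauss_density t (x - y) - gauss_density t (x + y)"

definition absP :: "real \<Rightarrow> (real \<Rightarrow> real) \<Rightarrow> real \<Rightarrow> real" where
  "absP t f x = (if t = 0 then f x else (LINT y:{0<..}|lborel. p_kernel t x y * f y))"

definition kernel_on :: "'a measure \<Rightarrow> 'b measure \<Rightarrow> ('a \<Rightarrow> 'b measure) \<Rightarrow> bool" where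
  "kernel_on A B m \<longleftrightarrow> (\<forall>x\<in>space A. sets (m x) = sets B) \<and>
     (\<forall>C\<in>sets B. (\<lambda>x. emeasure (m x) C) \<in> borel_measurable A)"

definition phi :: "(real \<Rightarrow> real measure) \<Rightarrow> real \<Rightarrow> real \<Rightarrow> complex" where
  "phi m x z = (LINT u|m x. exp (\<i> * complex_of_real (z * u)) - 1 - \<i> * complex_of_real (z * u))"

text \<open>The measure \<open>ds m(x,du) \<eta>(dx)\<close>.\<close>

definition intensity ::
    "(real \<Rightarrow> real measure) \<Rightarrow> real measure \<Rightarrow> (real \<times> real \<times> real) measure" where
  "intensity m \<eta> = measure_of (space SUX_space) (sets SUX_space)
     (\<lambda>C. \<integral>\<^sup>+x. (\<integral>\<^sup>+u. (\<integral>\<^sup>+s. indicator C (s, u, x) \<partial>restrict_space lborel {0..}) \<partial>m x) \<partial>\<eta>)"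

definition Y_integrand :: "real \<Rightarrow> (real \<Rightarrow> real) \<Rightarrow> real \<times> real \<times> real \<Rightarrow> real" where
  "Y_integrand t f = (\<lambda>(s, u, x). u * absP (t - s) f x)"

definition upto_time :: "real \<Rightarrow> (real \<times> real \<times> real) set" where
  "upto_time t = {(s, u, x). s \<le> t}"

definition Y_int :: "(real \<times> real \<times> real) measure \<Rightarrow> ('w \<Rightarrow> (real \<times> real \<times> real) measure) \<Rightarrow>
    real \<Rightarrow> (real \<Rightarrow> real) \<Rightarrow> 'w \<Rightarrow> real" where
  "Y_int \<Lambda> N t f \<omega> =
     (LINT z:upto_time t|N \<omega>. Y_integrand t f z) - (LINT z:upto_time t|\<Lambda>. Y_integrand t f z)"

text \<open>The functionals \<open>f \<mapsto> Y_t(f)\<close> collected into signed measures, via \<open>Y_t(A) = Y_t(1_A)\<close>.  The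
  integrals are defined only almost surely; off the event that \<open>u\<close> is \<open>N\<close>-integrable on every
  \<open>[0,T]\<close> the process is set to the zero measure.\<close>

definition Y_proc :: "(real \<times> real \<times> real) measure \<Rightarrow>
    ('w \<Rightarrow> (real \<times> real \<times> real) measure) \<Rightarrow> real \<Rightarrow> 'w \<Rightarrow> real set \<Rightarrow> real" where
  "Y_proc \<Lambda> N t \<omega> = (\<lambda>A.
     if (\<forall>T. set_integrable (N \<omega>) (upto_time T) (\<lambda>(s, u, x). u)) \<and> A \<in> sets D_space
     then Y_int \<Lambda> N t (indicator A) \<omega> else 0)"

definition has_R_functional :: "(nat \<Rightarrow> real \<Rightarrow> real) \<Rightarrow> (real \<Rightarrow> real measure) \<Rightarrow> real measure \<Rightarrow>
    real \<Rightarrow> (real set \<Rightarrow> real) \<Rightarrow> (real set \<Rightarrow> real) measure \<Rightarrow> bool" where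
  "has_R_functional fs m \<eta> t \<mu> Q \<longleftrightarrow>
     sets Q = sets (signed_space D_space fs) \<and> prob_space Q \<and>
     (\<forall>f\<in>bdd_borel D_space.
        (LINT \<nu>|Q. exp (\<i> * complex_of_real (sint D_space \<nu> f)))
          = exp (\<i> * complex_of_real (sint D_space \<mu> (absP t f))
                 + (LINT s:{0..t}|lborel. (LINT x|\<eta>. phi m x (absP s f x)))))"

definition R_semigroup :: "(nat \<Rightarrow> real \<Rightarrow> real) \<Rightarrow> (real \<Rightarrow> real measure) \<Rightarrow> real measure \<Rightarrow>
    real \<Rightarrow> (real set \<Rightarrow> real) \<Rightarrow> (real set \<Rightarrow> real) measure" where
  "R_semigroup fs m \<eta> t \<mu> = (THE Q. has_R_functional fs m \<eta> t \<mu> Q)"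

end

theory Submission
  imports Defs
begin

text \<open>The key observation is that \<open>\<rho>(\<mu>,\<nu>) = \<Sum>\<^sub>k 2\<^sup>-\<^sup>k (1 \<and> |\<mu>(f\<^sub>k) - \<nu>(f\<^sub>k)|)\<close>, so the Borel
  sets of \<open>S(D)\<close> are generated by the evaluations \<open>\<nu> \<mapsto> \<nu>(f\<^sub>k)\<close>, right continuity may be tested on
  each \<open>f\<^sub>k\<close>, and a law on \<open>S(D)\<close> is determined by its characteristic functional on bounded continuous
  functions.  Right continuity of \<open>t \<mapsto> Y\<^sub>t(f)\<close> is dominated convergence, since \<open>|u|\<close> is almost surely
  \<open>N\<close>-integrable on bounded time intervals and \<open>P\<^sub>r f(x)\<close> is continuous in \<open>r \<ge> 0\<close>.

  From \<open>P\<^sub>sP\<^sub>t = P\<^sub>s\<^sub>+\<^sub>t\<close> one gets \<open>Y\<^sub>s\<^sub>+\<^sub>t(f) = Y\<^sub>s(P\<^sub>t f) + W\<close>, where \<open>W\<close> only involves jumps after time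
  \<open>s\<close>; the Poisson characteristic functional factorises over disjoint time windows, which is the Markov
  property at fixed times.  The law \<open>R\<^sub>t(\<mu>,\<cdot>)\<close> is that of \<open>\<mu>P\<^sub>t + Y\<^sub>t\<close>.  At a stopping time \<open>\<tau>\<close> one applies
  the fixed-time property on grids decreasing to \<open>\<tau>\<close> and passes to the limit for continuous \<open>f\<close>, for
  which \<open>P\<^sub>t f\<close> is again continuous; the conditional law is then identified by its characteristic
  functional.\<close>

section \<open>Mixtures of kernels\<close>

text \<open>Neither \<open>N\<close> nor \<Lambda> need be finite, and m(x,du) may have infinite
  mass near u = 0. All averaging is therefore done by one construction, the mixture of a family of
  measures over an arbitrary measure: Campbell's formula, iterated integrals for the intensity and
  integrals against \<open>P \<bind> K\<close> become instances of one interchange of integrals.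

  Two regularity gaps shape the rest. For a merely bounded Borel f the map t -> P_t f(x) need not be
  continuous at t = 0, so limits in time are taken for bounded continuous f, while the laws R_t are
  prescribed on all bounded Borel f; hence uniqueness is formulated for any linear class of test
  functions containing the \<open>fs k\<close>. Moreover, stopping times refer to the
  right-continuous filtration, whereas the fixed-time Markov property is proved for the natural one
  with null sets adjoined. The grid points approximating \<tau> lie strictly to its right, and the
  event that a given grid point q is chosen already belongs to the natural filtration at q.

  Conditioning on the past is Fourier analysis: E[e^{iX} Z] = 0 for all compensated integrals X over
  past jumps, a linear space, forces E[1_A Z] = 0 on past events A.\<close>

definition mixture :: "'a measure \<Rightarrow> ('a \<Rightarrow> 'b measure) \<Rightarrow> 'b measure \<Rightarrow> 'b measure" where
  "mixture L k E = measure_of (space E) (sets E) (\<lambda>A. \<integral>\<^sup>+z. emeasure (k z) A \<partial>L)"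

lemma sets_mixture [simp, measurable_cong]: "sets (mixture L k E) = sets E"
  unfolding mixture_def by (simp add: sets.sigma_sets_eq)

lemma space_mixture [simp]: "space (mixture L k E) = space E"
  by (rule sets_eq_imp_space_eq) simp

lemma measurable_mixture_iff [simp]: "measurable (mixture L k E) F = measurable E F"
  by (rule measurable_cong_sets) simp_all

lemma emeasure_mixture:
  assumes k: "kernel_on L E k" and A: "A \<in> sets E"
  shows "emeasure (mixture L k E) A = (\<integral>\<^sup>+z. emeasure (k z) A \<partial>L)"
  unfolding mixture_def
proof (rule emeasure_measure_of_sigma[OF sets.sigma_algebra_axioms _ _ A])
  show "positive (sets E) (\<lambda>A. \<integral>\<^sup>+z. emeasure (k z) A \<partial>L)" by (simp add: positive_def)
  show "countably_additive (sets E) (\<lambda>A. \<integral>\<^sup>+z. emeasure (k z) A \<partial>L)"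
  proof (rule countably_additiveI)
    fix A :: "nat \<Rightarrow> 'b set" assume A: "range A \<subseteq> sets E" "disjoint_family A"
    have "(\<Sum>i. \<integral>\<^sup>+z. emeasure (k z) (A i) \<partial>L) = (\<integral>\<^sup>+z. (\<Sum>i. emeasure (k z) (A i)) \<partial>L)"
      using k A by (intro nn_integral_suminf[symmetric]) (auto simp: kernel_on_def)
    also have "\<dots> = (\<integral>\<^sup>+z. emeasure (k z) (\<Union>i. A i) \<partial>L)"
      using k A by (intro nn_integral_cong suminf_emeasure) (auto simp: kernel_on_def)
    finally show "(\<Sum>i. \<integral>\<^sup>+z. emeasure (k z) (A i) \<partial>L) = (\<integral>\<^sup>+z. emeasure (k z) (\<Union>i. A i) \<partial>L)" .
  qed
qed

lemma measurable_kernel_iff: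
  "kernel_on L E k \<Longrightarrow> z \<in> space L \<Longrightarrow> measurable (k z) F = measurable E F"
  by (intro measurable_cong_sets) (auto simp: kernel_on_def)

lemma space_kernel: "kernel_on L E k \<Longrightarrow> z \<in> space L \<Longrightarrow> space (k z) = space E"
  by (intro sets_eq_imp_space_eq) (auto simp: kernel_on_def)

text \<open>Measurability and the value go through one induction on f, because additivity and
  monotone convergence of the outer integral need the inner integrals to be measurable in z.\<close>

lemma
  assumes k: "kernel_on L E k" and f: "f \<in> borel_measurable E"
  shows nn_integral_kernel_measurable: "(\<lambda>z. \<integral>\<^sup>+y. f y \<partial>k z) \<in> borel_measurable L"
    and nn_integral_mixture: "(\<integral>\<^sup>+y. f y \<partial>mixture L k E) = (\<integral>\<^sup>+z. \<integral>\<^sup>+y. f y \<partial>k z \<partial>L)"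
proof -
  have km: "z \<in> space L \<Longrightarrow> g \<in> borel_measurable E \<Longrightarrow> g \<in> borel_measurable (k z)" for z and g :: "'b \<Rightarrow> ennreal"
    by (simp add: measurable_kernel_iff[OF k])
  have "(\<lambda>z. \<integral>\<^sup>+y. f y \<partial>k z) \<in> borel_measurable L \<and>
      (\<integral>\<^sup>+y. f y \<partial>mixture L k E) = (\<integral>\<^sup>+z. \<integral>\<^sup>+y. f y \<partial>k z \<partial>L)"
    using f
  proof (induction rule: borel_measurable_induct)
    case (cong f g)
    have 1: "z \<in> space L \<Longrightarrow> integral\<^sup>N (k z) f = integral\<^sup>N (k z) g" for z
      using cong(3) space_kernel[OF k] by (intro nn_integral_cong) auto
    have 2: "integral\<^sup>N (mixture L k E) f = integral\<^sup>N (mixture L k E) g"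
      using cong(3) by (intro nn_integral_cong) auto
    show ?case
      using cong(4) 2 by (simp add: 1 cong: measurable_cong nn_integral_cong)
  next
    case (set A)
    have 1: "z \<in> space L \<Longrightarrow> integral\<^sup>N (k z) (indicator A) = emeasure (k z) A" for z
      using k set by (intro nn_integral_indicator) (auto simp: kernel_on_def)
    have 2: "(\<lambda>z. emeasure (k z) A) \<in> borel_measurable L" using k set by (auto simp: kernel_on_def)
    show ?case using set 2 emeasure_mixture[OF k set]
      by (simp add: 1 cong: measurable_cong nn_integral_cong)
  next
    case (mult u c)
    have 1: "z \<in> space L \<Longrightarrow> (\<integral>\<^sup>+y. c * u y \<partial>k z) = c * (\<integral>\<^sup>+y. u y \<partial>k z)" for z
      by (rule nn_integral_cmult) (rule km[OF _ mult.hyps(2)])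
    have 2: "(\<integral>\<^sup>+y. c * u y \<partial>mixture L k E) = c * (\<integral>\<^sup>+y. u y \<partial>mixture L k E)"
      by (rule nn_integral_cmult) (simp add: mult.hyps(2))
    note mult.IH[THEN conjunct1, measurable]
    show ?case using mult.IH[THEN conjunct2]
      by (simp add: 1 2 nn_integral_cmult cong: measurable_cong nn_integral_cong) measurable
  next
    case (add u v)
    have 1: "z \<in> space L \<Longrightarrow> (\<integral>\<^sup>+y. v y + u y \<partial>k z) = (\<integral>\<^sup>+y. v y \<partial>k z) + (\<integral>\<^sup>+y. u y \<partial>k z)" for z
      by (rule nn_integral_add) (rule km[OF _ add.hyps(3)] km[OF _ add.hyps(1)], assumption)+
    have 2: "(\<integral>\<^sup>+y. v y + u y \<partial>mixture L k E) = (\<integral>\<^sup>+y. v y \<partial>mixture L k E) + (\<integral>\<^sup>+y. u y \<partial>mixture L k E)"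
      by (rule nn_integral_add) (simp_all add: add.hyps(1,3))
    note add.IH[THEN conjunct1, measurable]
    show ?case using add.IH[THEN conjunct2]
      by (simp add: 1 2 nn_integral_add cong: measurable_cong nn_integral_cong)
  next
    case (seq U)
    have eq: "Sup (range U) = (\<lambda>x. SUP i. U i x)" by (simp add: fun_eq_iff image_comp)
    have 1: "z \<in> space L \<Longrightarrow> (\<integral>\<^sup>+y. (SUP i. U i y) \<partial>k z) = (SUP i. \<integral>\<^sup>+y. U i y \<partial>k z)" for z
      by (rule nn_integral_monotone_convergence_SUP[OF seq.hyps(3)]) (rule km[OF _ seq.hyps(1)])
    have 2: "(\<integral>\<^sup>+y. (SUP i. U i y) \<partial>mixture L k E) = (SUP i. \<integral>\<^sup>+y. U i y \<partial>mixture L k E)"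
      by (rule nn_integral_monotone_convergence_SUP[OF seq.hyps(3)]) (simp add: seq.hyps(1))
    have inc: "incseq (\<lambda>i z. \<integral>\<^sup>+y. U i y \<partial>k z)"
      using seq.hyps(3) by (auto simp: incseq_def le_fun_def intro!: nn_integral_mono)
    have 3: "(\<integral>\<^sup>+z. (SUP i. \<integral>\<^sup>+y. U i y \<partial>k z) \<partial>L) = (SUP i. \<integral>\<^sup>+z. \<integral>\<^sup>+y. U i y \<partial>k z \<partial>L)"
      using seq.IH by (intro nn_integral_monotone_convergence_SUP inc) auto
    note seq.IH[THEN conjunct1, measurable]
    show ?case unfolding eq using seq.IH[THEN conjunct2]
      by (simp add: 1 2 3 cong: measurable_cong nn_integral_cong)
  qed
  then show "(\<lambda>z. \<integral>\<^sup>+y. f y \<partial>k z) \<in> borel_measurable L"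
    "(\<integral>\<^sup>+y. f y \<partial>mixture L k E) = (\<integral>\<^sup>+z. \<integral>\<^sup>+y. f y \<partial>k z \<partial>L)" by auto
qed

lemma integral_kernel_measurable:
  fixes f :: "'b \<Rightarrow> real"
  assumes k: "kernel_on L E k" and f: "f \<in> borel_measurable E"
  shows "(\<lambda>z. \<integral>y. f y \<partial>k z) \<in> borel_measurable L"
proof -
  have [measurable]: "g \<in> borel_measurable E \<Longrightarrow> (\<lambda>z. \<integral>\<^sup>+y. g y \<partial>k z) \<in> borel_measurable L" for g
    by (rule nn_integral_kernel_measurable[OF k])
  note f [measurable]
  \<comment> \<open>The Bochner integral is 0 where f is not integrable, so these z have to be cut
    out, by the finiteness of the integral of |f|.\<close>
  have "(\<lambda>z. if (\<integral>\<^sup>+y. ennreal \<bar>f y\<bar> \<partial>k z) < \<infinity> then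
      enn2real (\<integral>\<^sup>+y. ennreal (f y) \<partial>k z) - enn2real (\<integral>\<^sup>+y. ennreal (- f y) \<partial>k z) else 0)
      \<in> borel_measurable L" by measurable
  then show ?thesis
  proof (rule measurable_cong[THEN iffD1, rotated])
    fix z assume z: "z \<in> space L"
    have "integrable (k z) f \<longleftrightarrow> (\<integral>\<^sup>+y. ennreal \<bar>f y\<bar> \<partial>k z) < \<infinity>"
      using f by (auto simp: integrable_iff_bounded measurable_kernel_iff[OF k z])
    then show "(if (\<integral>\<^sup>+y. ennreal \<bar>f y\<bar> \<partial>k z) < \<infinity> then
      enn2real (\<integral>\<^sup>+y. ennreal (f y) \<partial>k z) - enn2real (\<integral>\<^sup>+y. ennreal (- f y) \<partial>k z) else 0) = (\<integral>y. f y \<partial>k z)"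
      using real_lebesgue_integral_def[of "k z" f] not_integrable_integral_eq[of "k z" f] by auto
  qed
qed

lemma
  fixes f :: "'b \<Rightarrow> real"
  assumes k: "kernel_on L E k" and f: "f \<in> borel_measurable E"
    and fin: "(\<integral>\<^sup>+z. \<integral>\<^sup>+y. ennreal \<bar>f y\<bar> \<partial>k z \<partial>L) < \<infinity>"
  shows integrable_kernel_real: "integrable L (\<lambda>z. \<integral>y. f y \<partial>k z)"
    and integral_mixture_real: "(\<integral>y. f y \<partial>mixture L k E) = (\<integral>z. \<integral>y. f y \<partial>k z \<partial>L)"
proof -
  note f [measurable]
  have nnm: "g \<in> borel_measurable E \<Longrightarrow> (\<lambda>z. \<integral>\<^sup>+y. g y \<partial>k z) \<in> borel_measurable L" for g
    by (rule nn_integral_kernel_measurable[OF k])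
  have i: "integrable (mixture L k E) f"
    using fin by (auto simp: integrable_iff_bounded nn_integral_mixture[OF k])
  have ae: "AE z in L. (\<integral>\<^sup>+y. ennreal \<bar>f y\<bar> \<partial>k z) \<noteq> \<infinity>"
    by (rule nn_integral_PInf_AE) (use fin in \<open>auto intro!: nnm\<close>)
  have le: "(\<integral>\<^sup>+y. ennreal (s * f y) \<partial>k z) \<le> (\<integral>\<^sup>+y. ennreal \<bar>f y\<bar> \<partial>k z)" if "\<bar>s\<bar> \<le> 1" for z s
    using that mult_right_mono[of "\<bar>s\<bar>" 1]
    by (intro nn_integral_mono ennreal_leI) (metis abs_ge_self abs_ge_zero abs_mult mult_1 order_trans)
  \<comment> \<open>The choices s = 1 and s = -1 treat the positive and the negative part of f by
    one argument. \<open>enn2real\<close> loses the value infinity, which occurs only on a null set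
    of z.\<close>
  have *: "integrable L (\<lambda>z. enn2real (\<integral>\<^sup>+y. ennreal (s * f y) \<partial>k z)) \<and>
      (\<integral>z. enn2real (\<integral>\<^sup>+y. ennreal (s * f y) \<partial>k z) \<partial>L) = enn2real (\<integral>\<^sup>+y. ennreal (s * f y) \<partial>mixture L k E)"
    if s: "\<bar>s\<bar> \<le> 1" for s
  proof -
    have e: "AE z in L. ennreal (enn2real (\<integral>\<^sup>+y. ennreal (s * f y) \<partial>k z)) = (\<integral>\<^sup>+y. ennreal (s * f y) \<partial>k z)"
      using ae
    proof eventually_elim
      case (elim z)
      then have "(\<integral>\<^sup>+y. ennreal (s * f y) \<partial>k z) < \<top>" using le[OF s, of z] by (simp add: less_top le_less_trans)
      then show ?case by simp
    qed
    have e2: "(\<integral>\<^sup>+z. ennreal (enn2real (\<integral>\<^sup>+y. ennreal (s * f y) \<partial>k z)) \<partial>L) = (\<integral>\<^sup>+y. ennreal (s * f y) \<partial>mixture L k E)"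
      by (subst nn_integral_cong_AE[OF e]) (auto intro!: nn_integral_mixture[OF k, symmetric])
    have m: "(\<lambda>z. enn2real (\<integral>\<^sup>+y. ennreal (s * f y) \<partial>k z)) \<in> borel_measurable L"
      by (intro measurable_compose[OF nnm]) auto
    have "(\<integral>\<^sup>+y. ennreal (s * f y) \<partial>mixture L k E) \<le> (\<integral>\<^sup>+z. (\<integral>\<^sup>+y. ennreal \<bar>f y\<bar> \<partial>k z) \<partial>L)"
      by (subst nn_integral_mixture[OF k]) (auto intro!: nn_integral_mono le s)
    then have "(\<integral>\<^sup>+y. ennreal (s * f y) \<partial>mixture L k E) < \<infinity>" using fin by (simp add: le_less_trans)
    then have "integrable L (\<lambda>z. enn2real (\<integral>\<^sup>+y. ennreal (s * f y) \<partial>k z))"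
      using m e2 by (auto simp: integrable_iff_bounded)
    moreover have "(\<integral>z. enn2real (\<integral>\<^sup>+y. ennreal (s * f y) \<partial>k z) \<partial>L) = enn2real (\<integral>\<^sup>+y. ennreal (s * f y) \<partial>mixture L k E)"
      using m e2 by (subst integral_eq_nn_integral) auto
    ultimately show ?thesis by simp
  qed
  have m: "(\<lambda>z. \<integral>y. f y \<partial>k z) \<in> borel_measurable L" by (rule integral_kernel_measurable[OF k f])
  have e: "AE z in L. (\<integral>y. f y \<partial>k z) = enn2real (\<integral>\<^sup>+y. ennreal (f y) \<partial>k z) - enn2real (\<integral>\<^sup>+y. ennreal (- f y) \<partial>k z)"
    using ae AE_space
  proof eventually_elim
    case (elim z)
    then have "integrable (k z) f"
      using f by (auto simp: integrable_iff_bounded measurable_kernel_iff[OF k] top.not_eq_extremum)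
    then show ?case by (rule real_lebesgue_integral_def)
  qed
  have "integrable L (\<lambda>z. enn2real (\<integral>\<^sup>+y. ennreal (f y) \<partial>k z) - enn2real (\<integral>\<^sup>+y. ennreal (- f y) \<partial>k z))"
    using *[of 1] *[of "-1"] by auto
  then show "integrable L (\<lambda>z. \<integral>y. f y \<partial>k z)"
    by (subst integrable_cong_AE[OF m _ e]) auto
  have "(\<integral>z. \<integral>y. f y \<partial>k z \<partial>L)
      = (\<integral>z. enn2real (\<integral>\<^sup>+y. ennreal (f y) \<partial>k z) - enn2real (\<integral>\<^sup>+y. ennreal (- f y) \<partial>k z) \<partial>L)"
    using *[of 1] *[of "-1"] by (intro integral_cong_AE m e) auto
  then show "(\<integral>y. f y \<partial>mixture L k E) = (\<integral>z. \<integral>y. f y \<partial>k z \<partial>L)"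
    using *[of 1] *[of "-1"] real_lebesgue_integral_def[OF i] by auto
qed

lemma integral_mixture:
  fixes f :: "'b \<Rightarrow> complex"
  assumes k: "kernel_on L E k" and f: "f \<in> borel_measurable E"
    and fin: "(\<integral>\<^sup>+z. \<integral>\<^sup>+y. ennreal (cmod (f y)) \<partial>k z \<partial>L) < \<infinity>"
  shows "(\<integral>y. f y \<partial>mixture L k E) = (\<integral>z. \<integral>y. f y \<partial>k z \<partial>L)"
proof -
  note f [measurable]
  have nnm: "g \<in> borel_measurable E \<Longrightarrow> (\<lambda>z. \<integral>\<^sup>+y. g y \<partial>k z) \<in> borel_measurable L" for g
    by (rule nn_integral_kernel_measurable[OF k])
  have i: "integrable (mixture L k E) f"
    using fin by (auto simp: integrable_iff_bounded nn_integral_mixture[OF k])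
  have ae: "AE z in L. (\<integral>\<^sup>+y. ennreal (cmod (f y)) \<partial>k z) \<noteq> \<infinity>"
    by (rule nn_integral_PInf_AE) (use fin in \<open>auto intro!: nnm\<close>)
  have ik: "AE z in L. integrable (k z) f"
    using ae AE_space
    by eventually_elim (use f in \<open>auto simp: integrable_iff_bounded measurable_kernel_iff[OF k] top.not_eq_extremum\<close>)
  have R: "(\<integral>\<^sup>+z. \<integral>\<^sup>+y. ennreal \<bar>Re (f y)\<bar> \<partial>k z \<partial>L) < \<infinity>"
    by (rule le_less_trans[OF _ fin]) (intro nn_integral_mono ennreal_leI abs_Re_le_cmod)
  have I: "(\<integral>\<^sup>+z. \<integral>\<^sup>+y. ennreal \<bar>Im (f y)\<bar> \<partial>k z \<partial>L) < \<infinity>"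
    by (rule le_less_trans[OF _ fin]) (intro nn_integral_mono ennreal_leI abs_Im_le_cmod)
  have Rm: "(\<lambda>y. Re (f y)) \<in> borel_measurable E" "(\<lambda>y. Im (f y)) \<in> borel_measurable E" by measurable
  let ?g = "\<lambda>z. complex_of_real (\<integral>y. Re (f y) \<partial>k z) + \<i> * complex_of_real (\<integral>y. Im (f y) \<partial>k z)"
  have zc: "integrable (k z) f \<Longrightarrow> (\<integral>y. f y \<partial>k z) = ?g z" for z
    by (simp add: complex_eq_iff)
  have ig: "integrable L ?g"
    using integrable_kernel_real[OF k Rm(1) R] integrable_kernel_real[OF k Rm(2) I]
    by (intro Bochner_Integration.integrable_add integrable_mult_right) auto
  \<comment> \<open>\<open>?g\<close> agrees with the inner integral only almost everywhere.
    Measurability needs a formula valid for every z, including the default value 0.\<close>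
  have nz: "(\<integral>y. f y \<partial>k z) = (if (\<integral>\<^sup>+y. ennreal (cmod (f y)) \<partial>k z) < \<infinity> then ?g z else 0)" if z: "z \<in> space L" for z
  proof -
    have "integrable (k z) f \<longleftrightarrow> (\<integral>\<^sup>+y. ennreal (cmod (f y)) \<partial>k z) < \<infinity>"
      using f z by (auto simp: integrable_iff_bounded measurable_kernel_iff[OF k])
    then show ?thesis using zc[of z] not_integrable_integral_eq[of "k z" f] by auto
  qed
  have [measurable]: "(\<lambda>z. \<integral>y. Re (f y) \<partial>k z) \<in> borel_measurable L" "(\<lambda>z. \<integral>y. Im (f y) \<partial>k z) \<in> borel_measurable L"
    "(\<lambda>z. (\<integral>\<^sup>+y. ennreal (cmod (f y)) \<partial>k z)) \<in> borel_measurable L"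
    using integral_kernel_measurable[OF k Rm(1)] integral_kernel_measurable[OF k Rm(2)] nnm by auto
  have m: "(\<lambda>z. \<integral>y. f y \<partial>k z) \<in> borel_measurable L"
    by (subst measurable_cong[OF nz]) measurable
  have e: "AE z in L. (\<integral>y. f y \<partial>k z) = ?g z" using ik by eventually_elim (rule zc)
  have "(\<integral>z. \<integral>y. f y \<partial>k z \<partial>L) = (\<integral>z. ?g z \<partial>L)"
    using ig by (intro integral_cong_AE m e) auto
  also have "\<dots> = (\<integral>z. complex_of_real (\<integral>y. Re (f y) \<partial>k z) \<partial>L) + \<i> * (\<integral>z. complex_of_real (\<integral>y. Im (f y) \<partial>k z) \<partial>L)"
    using integrable_kernel_real[OF k Rm(1) R] integrable_kernel_real[OF k Rm(2) I]
    by (subst Bochner_Integration.integral_add) auto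
  also have "\<dots> = (\<integral>y. f y \<partial>mixture L k E)"
    using i integral_mixture_real[OF k Rm(1) R] integral_mixture_real[OF k Rm(2) I]
    by (simp add: complex_eq_iff)
  finally show "(\<integral>y. f y \<partial>mixture L k E) = (\<integral>z. \<integral>y. f y \<partial>k z \<partial>L)" by simp
qed

text \<open>Encoded as a mixture over a two-point space, so that integrals against a sum of measures
  come from the general interchange theorem.\<close>

definition measure_add :: "'a measure \<Rightarrow> 'a measure \<Rightarrow> 'a measure" where
  "measure_add p q = mixture (count_space UNIV) (\<lambda>b. if b then p else q) p"

lemma sets_measure_add [simp, measurable_cong]: "sets (measure_add p q) = sets p" by (simp add: measure_add_def)

lemma kernel_measure_add: "sets p = sets q \<Longrightarrow> kernel_on (count_space UNIV) p (\<lambda>b. if b then p else q)"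
  by (simp add: kernel_on_def)

lemma emeasure_measure_add:
  assumes "sets p = sets q" shows "emeasure (measure_add p q) A = emeasure p A + emeasure q A"
proof (cases "A \<in> sets p")
  case True then show ?thesis
    unfolding measure_add_def emeasure_mixture[OF kernel_measure_add[OF assms] True]
    by (simp add: nn_integral_count_space_finite UNIV_bool add.commute)
next
  case False then show ?thesis using assms by (simp add: emeasure_notin_sets)
qed

lemma fin_meas_measure_add:
  assumes "p \<in> fin_meas E" "q \<in> fin_meas E"
  shows "measure_add p q \<in> fin_meas E"
  using assms by (auto simp: fin_meas_def emeasure_measure_add finite_measure.emeasure_finite intro!: finite_measureI)

lemma measure_measure_add:
  assumes "p \<in> fin_meas E" "q \<in> fin_meas E"
  shows "measure (measure_add p q) A = measure p A + measure q A"
  using assms finite_measure.emeasure_finite[of p A] finite_measure.emeasure_finite[of q A]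
  by (auto simp: fin_meas_def measure_def emeasure_measure_add enn2real_plus less_top)

lemma integral_measure_add:
  assumes p: "p \<in> fin_meas E" and q: "q \<in> fin_meas E" and f: "f \<in> bdd_borel E"
  shows "(\<integral>x. f x \<partial>measure_add p q) = (\<integral>x. f x \<partial>p) + (\<integral>x. f x \<partial>q)"
proof -
  have s: "sets p = sets q" "sets p = sets E" using p q by (auto simp: fin_meas_def)
  have m: "f \<in> borel_measurable p" using f s by (auto simp: bdd_borel_def cong: measurable_cong_sets)
  have "(\<integral>\<^sup>+y. ennreal \<bar>f y\<bar> \<partial>p) < \<infinity>" "(\<integral>\<^sup>+y. ennreal \<bar>f y\<bar> \<partial>q) < \<infinity>"
    using integrable_bdd_borel[OF p f] integrable_bdd_borel[OF q f] by (auto simp: integrable_iff_bounded)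
  then show ?thesis
    unfolding measure_add_def
    by (subst integral_mixture_real[OF kernel_measure_add[OF s(1)] m])
      (auto simp: nn_integral_count_space_finite lebesgue_integral_count_space_finite UNIV_bool add.commute)
qed

section \<open>Linear operations on finite signed measures\<close>

lemma null_fin_meas: "null_measure E \<in> fin_meas E"
  by (auto simp: fin_meas_def intro: finite_measureI)

lemma fin_signed_zero: "(\<lambda>_. 0) \<in> fin_signed E"
  unfolding fin_signed_def using null_fin_meas[of E]
  by (intro CollectI exI[of _ "null_measure E"]) (auto simp: sdiff_def)

lemma fin_signed_add:
  assumes "\<mu> \<in> fin_signed E" "\<nu> \<in> fin_signed E"
  shows "(\<lambda>A. \<mu> A + \<nu> A) \<in> fin_signed E"
proof -
  from assms obtain p n p' n' where h: "p \<in> fin_meas E" "n \<in> fin_meas E" "p' \<in> fin_meas E" "n' \<in> fin_meas E"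
    "\<mu> = sdiff p n" "\<nu> = sdiff p' n'" by (auto simp: fin_signed_def)
  then have "(\<lambda>A. \<mu> A + \<nu> A) = sdiff (measure_add p p') (measure_add n n')"
    by (auto simp: sdiff_def measure_measure_add)
  then show ?thesis using h by (auto simp: fin_signed_def intro: fin_meas_measure_add)
qed

lemma sint_add_measure:
  assumes "\<mu> \<in> fin_signed E" "\<nu> \<in> fin_signed E" and f: "f \<in> bdd_borel E"
  shows "sint E (\<lambda>A. \<mu> A + \<nu> A) f = sint E \<mu> f + sint E \<nu> f"
proof -
  from assms obtain p n p' n' where h: "p \<in> fin_meas E" "n \<in> fin_meas E" "p' \<in> fin_meas E" "n' \<in> fin_meas E"
    "\<mu> = sdiff p n" "\<nu> = sdiff p' n'" by (auto simp: fin_signed_def)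
  then have "(\<lambda>A. \<mu> A + \<nu> A) = sdiff (measure_add p p') (measure_add n n')"
    by (auto simp: sdiff_def measure_measure_add)
  then show ?thesis using h by (simp add: sint_eq fin_meas_measure_add f integral_measure_add)
qed

lemma bdd_borel_add: "f \<in> bdd_borel E \<Longrightarrow> g \<in> bdd_borel E \<Longrightarrow> (\<lambda>x. f x + c * g x) \<in> bdd_borel E"
proof -
  assume h: "f \<in> bdd_borel E" "g \<in> bdd_borel E"
  then obtain B C where "\<forall>x\<in>space E. \<bar>f x\<bar> \<le> B" "\<forall>x\<in>space E. \<bar>g x\<bar> \<le> C"
    by (auto simp: bdd_borel_def bounded_iff)
  then have "\<forall>x\<in>space E. \<bar>f x + c * g x\<bar> \<le> B + \<bar>c\<bar> * C"
    by (auto simp: abs_mult intro!: order_trans[OF abs_triangle_ineq] add_mono mult_left_mono)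
  then show ?thesis using h by (auto simp: bdd_borel_def bounded_iff)
qed

lemma sint_add:
  assumes "\<mu> \<in> fin_signed E" and f: "f \<in> bdd_borel E" and g: "g \<in> bdd_borel E"
  shows "sint E \<mu> (\<lambda>x. f x + c * g x) = sint E \<mu> f + c * sint E \<mu> g"
proof -
  from assms obtain p n where h: "p \<in> fin_meas E" "n \<in> fin_meas E" "\<mu> = sdiff p n"
    by (auto simp: fin_signed_def)
  then show ?thesis using integrable_bdd_borel[OF h(1)] integrable_bdd_borel[OF h(2)] f g
    by (simp add: sint_eq f g bdd_borel_add algebra_simps)
qed

section \<open>Uniqueness from characteristic functionals\<close>

text \<open>\<open>Levy_uniqueness\<close> compares probability laws, so a nonnegative weight is
  first normalised by its mass c; transforms and probabilities of the resulting law of X return to M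
  with a factor 1/c.\<close>

lemma
  fixes X W :: "'a \<Rightarrow> real"
  assumes X [measurable]: "X \<in> borel_measurable M" and W: "integrable M W" "\<And>\<omega>. 0 \<le> W \<omega>"
    and c: "(\<integral>\<omega>. W \<omega> \<partial>M) = c" "0 < c"
  defines "\<mu> \<equiv> distr (density M (\<lambda>\<omega>. ennreal (W \<omega> / c))) borel X"
  shows weighted_real_distribution: "real_distribution \<mu>"
    and char_weighted: "char \<mu> \<theta> = (CLINT \<omega>|M. iexp (\<theta> * X \<omega>) * complex_of_real (W \<omega>)) / complex_of_real c"
    and measure_weighted: "B \<in> sets borel \<Longrightarrow> measure \<mu> B = (\<integral>\<omega>. indicator B (X \<omega>) * W \<omega> \<partial>M) / c"
proof -
  have [measurable]: "W \<in> borel_measurable M" using W by auto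
  have nn: "(\<integral>\<^sup>+\<omega>. ennreal (W \<omega> / c) \<partial>M) = 1"
    using W c by (subst nn_integral_eq_integral) auto
  have "prob_space (density M (\<lambda>\<omega>. ennreal (W \<omega> / c)))"
    by (rule prob_spaceI) (use nn in \<open>simp add: emeasure_density nn_integral_set_ennreal cong: nn_integral_cong\<close>)
  then interpret D: prob_space "density M (\<lambda>\<omega>. ennreal (W \<omega> / c))" .
  have "prob_space \<mu>" unfolding \<mu>_def by (rule D.prob_space_distr) simp
  then show "real_distribution \<mu>"
    by (simp add: real_distribution_def real_distribution_axioms_def \<mu>_def)
  have "char \<mu> \<theta> = (CLINT \<omega>|M. (W \<omega> / c) *\<^sub>R iexp (\<theta> * X \<omega>))"
    unfolding char_def \<mu>_def using W c
    by (subst integral_distr) (auto simp: integral_density)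
  also have "\<dots> = (CLINT \<omega>|M. (iexp (\<theta> * X \<omega>) * complex_of_real (W \<omega>)) / complex_of_real c)"
    by (intro Bochner_Integration.integral_cong refl) (simp add: scaleR_conv_of_real)
  finally show "char \<mu> \<theta> = (CLINT \<omega>|M. iexp (\<theta> * X \<omega>) * complex_of_real (W \<omega>)) / complex_of_real c"
    by simp
  assume B [measurable]: "B \<in> sets borel"
  then have "measure \<mu> B = (\<integral>x. indicator B x \<partial>\<mu>)"
    by (simp add: \<mu>_def)
  also have "\<dots> = (\<integral>\<omega>. (W \<omega> / c) *\<^sub>R indicator B (X \<omega>) \<partial>M)"
    unfolding \<mu>_def using W c by (subst integral_distr) (auto simp: integral_density)
  also have "\<dots> = (\<integral>\<omega>. (indicator B (X \<omega>) * W \<omega>) / c \<partial>M)"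
    by (intro Bochner_Integration.integral_cong refl) simp
  finally show "measure \<mu> B = (\<integral>\<omega>. indicator B (X \<omega>) * W \<omega> \<partial>M) / c" by simp
qed

lemma integrable_iexp_times:
  fixes Z :: "'a \<Rightarrow> complex"
  assumes [measurable]: "X \<in> borel_measurable M" and Z: "integrable M Z"
  shows "integrable M (\<lambda>\<omega>. iexp (X \<omega>) * Z \<omega>)"
  by (rule Bochner_Integration.integrable_bound[OF Z]) (use Z in \<open>auto simp: norm_mult\<close>)

text \<open>Write Z = P - N with nonnegative parts. At \<theta> = 0 the hypothesis says that P and N
  have equal mass, so both normalise to laws of X, and these have the same characteristic function.
  If the common mass is 0, both parts vanish almost everywhere.\<close>

lemma fourier_zero_line:
  fixes X Z :: "'a \<Rightarrow> real"
  assumes X [measurable]: "X \<in> borel_measurable M" and Z: "integrable M Z" and B [measurable]: "B \<in> sets borel"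
    and zero: "\<And>\<theta>. (CLINT \<omega>|M. iexp (\<theta> * X \<omega>) * complex_of_real (Z \<omega>)) = 0"
  shows "(\<integral>\<omega>. indicator B (X \<omega>) * Z \<omega> \<partial>M) = 0"
proof -
  have [measurable]: "Z \<in> borel_measurable M" using Z by auto
  define P N where "P \<omega> = max 0 (Z \<omega>)" and "N \<omega> = max 0 (- Z \<omega>)" for \<omega>
  have P: "integrable M P" "\<And>\<omega>. 0 \<le> P \<omega>" and N: "integrable M N" "\<And>\<omega>. 0 \<le> N \<omega>"
    using Z by (auto simp: P_def[abs_def] N_def[abs_def])
  have ZPN: "Z \<omega> = P \<omega> - N \<omega>" for \<omega> by (simp add: P_def N_def max_def)
  have eq: "(CLINT \<omega>|M. iexp (\<theta> * X \<omega>) * complex_of_real (P \<omega>)) = (CLINT \<omega>|M. iexp (\<theta> * X \<omega>) * complex_of_real (N \<omega>))" for \<theta>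
  proof -
    have "0 = (CLINT \<omega>|M. iexp (\<theta> * X \<omega>) * complex_of_real (P \<omega>) - iexp (\<theta> * X \<omega>) * complex_of_real (N \<omega>))"
      using zero[of \<theta>] by (simp add: ZPN algebra_simps)
    also have "\<dots> = (CLINT \<omega>|M. iexp (\<theta> * X \<omega>) * complex_of_real (P \<omega>)) - (CLINT \<omega>|M. iexp (\<theta> * X \<omega>) * complex_of_real (N \<omega>))"
      using P N by (intro Bochner_Integration.integral_diff integrable_iexp_times) auto
    finally show ?thesis by simp
  qed
  have c: "(\<integral>\<omega>. P \<omega> \<partial>M) = (\<integral>\<omega>. N \<omega> \<partial>M)"
    using eq[of 0] by (simp add: of_real_eq_iff)
  have iP: "integrable M (\<lambda>\<omega>. indicator B (X \<omega>) * P \<omega>)" and iN: "integrable M (\<lambda>\<omega>. indicator B (X \<omega>) * N \<omega>)"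
    by (rule Bochner_Integration.integrable_bound[OF P(1)], use P in \<open>auto simp: indicator_def\<close>)
      (rule Bochner_Integration.integrable_bound[OF N(1)], use N in \<open>auto simp: indicator_def\<close>)
  have "(\<integral>\<omega>. indicator B (X \<omega>) * P \<omega> \<partial>M) = (\<integral>\<omega>. indicator B (X \<omega>) * N \<omega> \<partial>M)"
  proof (cases "(\<integral>\<omega>. P \<omega> \<partial>M) > 0")
    case True
    define c where "c = (\<integral>\<omega>. P \<omega> \<partial>M)"
    have p: "integral\<^sup>L M P = c" "integral\<^sup>L M N = c" "c > 0" using True c by (auto simp: c_def)
    let ?p = "distr (density M (\<lambda>\<omega>. ennreal (P \<omega> / c))) borel X"
    let ?n = "distr (density M (\<lambda>\<omega>. ennreal (N \<omega> / c))) borel X"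
    have "char ?p = char ?n"
      by (rule ext) (simp only: char_weighted[OF X P p(1,3)] char_weighted[OF X N p(2,3)] eq)
    then have "?p = ?n"
      by (intro Levy_uniqueness weighted_real_distribution[OF X P p(1,3)] weighted_real_distribution[OF X N p(2,3)])
    then have "measure ?p B = measure ?n B" by simp
    then show ?thesis
      using measure_weighted[OF X P p(1,3) B] measure_weighted[OF X N p(2,3) B] p by simp
  next
    case False
    then have z: "integral\<^sup>L M P = 0" "integral\<^sup>L M N = 0"
      using P N c by (auto simp: not_less intro!: antisym Bochner_Integration.integral_nonneg)
    then have "AE \<omega> in M. P \<omega> = 0" "AE \<omega> in M. N \<omega> = 0"
      using P N by (simp_all add: integral_nonneg_eq_0_iff_AE)
    then show ?thesis by (intro integral_cong_AE) (use P N in \<open>auto elim!: eventually_elim2\<close>)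
  qed
  then show ?thesis using iP iN by (simp add: ZPN right_diff_distrib)
qed

text \<open>Let \<open>C\<close> be the class of all \<open>Z\<close> with \<open>E[exp(iX) Z] = 0\<close> for every \<open>X\<close> in \<open>V\<close>.  The sets whose
  indicators map \<open>C\<close> into itself form a sigma-algebra; it contains the generators by the uniqueness
  theorem on the line, applied to \<open>cos(Y) Z\<close> and \<open>sin(Y) Z\<close> for \<open>Y\<close> in \<open>V\<close>.  No multidimensional
  uniqueness theorem is needed.\<close>

lemma fourier_zero_real:
  fixes V :: "('a \<Rightarrow> real) set" and Z :: "'a \<Rightarrow> real"
  assumes V: "\<And>X. X \<in> V \<Longrightarrow> X \<in> borel_measurable M" "V \<noteq> {}"
    and lin: "\<And>X Y a. X \<in> V \<Longrightarrow> Y \<in> V \<Longrightarrow> \<exists>W\<in>V. \<forall>\<omega>\<in>space M. W \<omega> = X \<omega> + a * Y \<omega>"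
    and Z: "integrable M Z"
    and zero: "\<And>X. X \<in> V \<Longrightarrow> (CLINT \<omega>|M. iexp (X \<omega>) * complex_of_real (Z \<omega>)) = 0"
    and A: "A \<in> sigma_sets (space M) ({X -` B \<inter> space M | X B. X \<in> V \<and> B \<in> sets borel} \<union> null_sets M)"
  shows "(\<integral>\<omega>. indicator A \<omega> * Z \<omega> \<partial>M) = 0"
proof -
  let ?G = "{X -` B \<inter> space M | X B. X \<in> V \<and> B \<in> sets (borel :: real measure)} \<union> null_sets M"
  define C where "C Z \<longleftrightarrow> integrable M Z \<and> (\<forall>X\<in>V. (CLINT \<omega>|M. iexp (X \<omega>) * complex_of_real (Z \<omega>)) = 0)"
    for Z :: "'a \<Rightarrow> real"
  have Gs: "?G \<subseteq> sets M" using V by (auto intro: measurable_sets)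
  have sub: "A \<in> sets M" if "A \<in> sigma_sets (space M) ?G" for A
    using that sets.sigma_sets_subset[OF Gs] by auto
  have ind: "integrable M (\<lambda>\<omega>. indicator A \<omega> * Z \<omega>)" if "A \<in> sets M" "integrable M Z" for A and Z :: "'a \<Rightarrow> real"
    using integrable_mult_indicator[OF that] by simp
  have combine: "C (\<lambda>\<omega>. Z \<omega> + a * Z' \<omega>)" if "C Z" "C Z'" for Z Z' a
    unfolding C_def
  proof (intro conjI ballI)
    show "integrable M (\<lambda>\<omega>. Z \<omega> + a * Z' \<omega>)" using that by (auto simp: C_def)
    fix X assume X: "X \<in> V"
    have "(CLINT \<omega>|M. iexp (X \<omega>) * complex_of_real (Z \<omega> + a * Z' \<omega>))
        = (CLINT \<omega>|M. iexp (X \<omega>) * complex_of_real (Z \<omega>) + complex_of_real a * (iexp (X \<omega>) * complex_of_real (Z' \<omega>)))"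
      by (simp add: algebra_simps)
    also have "\<dots> = 0" using that X V(1)[OF X]
      by (subst Bochner_Integration.integral_add) (auto simp: C_def intro!: integrable_iexp_times)
    finally show "(CLINT \<omega>|M. iexp (X \<omega>) * complex_of_real (Z \<omega> + a * Z' \<omega>)) = 0" .
  qed
  have cong: "C Z'" if "C Z" "\<And>\<omega>. \<omega> \<in> space M \<Longrightarrow> Z \<omega> = Z' \<omega>" for Z Z'
    using that unfolding C_def by (simp cong: Bochner_Integration.integrable_cong Bochner_Integration.integral_cong)
  have gen: "C (\<lambda>\<omega>. indicator (X -` B \<inter> space M) \<omega> * Z \<omega>)"
    if Z: "C Z" and X: "X \<in> V" and B [measurable]: "B \<in> sets borel" for Z X and B :: "real set"
    unfolding C_def
  proof (intro conjI ballI)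
    have Xm [measurable]: "X \<in> borel_measurable M" by (rule V(1)[OF X])
    have Zi: "integrable M Z" using Z by (simp add: C_def)
    then have [measurable]: "Z \<in> borel_measurable M" by auto
    have BX [measurable]: "X -` B \<inter> space M \<in> sets M" by measurable
    show "integrable M (\<lambda>\<omega>. indicator (X -` B \<inter> space M) \<omega> * Z \<omega>)" by (rule ind[OF BX Zi])
    fix Y assume Y: "Y \<in> V"
    note V(1)[OF Y, measurable]
    have ci: "integrable M (\<lambda>\<omega>. cos (Y \<omega>) * Z \<omega>)" "integrable M (\<lambda>\<omega>. sin (Y \<omega>) * Z \<omega>)"
      by (rule Bochner_Integration.integrable_bound[OF Zi];
          auto simp: abs_mult intro!: mult_left_le_one_le abs_cos_le_one abs_sin_le_one)+
    have pm: "(CLINT \<omega>|M. iexp (\<theta> * X \<omega> + s * Y \<omega>) * complex_of_real (Z \<omega>)) = 0" for \<theta> s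
    proof -
      \<comment> \<open>Closure of V is given only in the form X + aY, so the multiple sY is
        obtained as Y + (s - 1)Y.\<close>
      obtain O' where O': "O' \<in> V" "\<forall>\<omega>\<in>space M. O' \<omega> = Y \<omega> + (s - 1) * Y \<omega>" using lin[OF Y Y] by blast
      obtain W where W: "W \<in> V" "\<forall>\<omega>\<in>space M. W \<omega> = O' \<omega> + \<theta> * X \<omega>" using lin[OF O'(1) X] by blast
      have eq: "W \<omega> = \<theta> * X \<omega> + s * Y \<omega>" if "\<omega> \<in> space M" for \<omega>
        using that O' W by (simp add: algebra_simps)
      have "(CLINT \<omega>|M. iexp (W \<omega>) * complex_of_real (Z \<omega>)) = 0" using Z W by (simp add: C_def)
      then show ?thesis using eq by (simp cong: Bochner_Integration.integral_cong)
    qed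
    have I: "integrable M (\<lambda>\<omega>. iexp (\<theta> * X \<omega> + s * Y \<omega>) * complex_of_real (Z \<omega>))" for \<theta> s
      using Zi by (intro integrable_iexp_times) auto
    have c1: "(CLINT \<omega>|M. iexp (\<theta> * X \<omega>) * complex_of_real (cos (Y \<omega>) * Z \<omega>)) = 0" for \<theta>
    proof -
      have "(CLINT \<omega>|M. iexp (\<theta> * X \<omega>) * complex_of_real (cos (Y \<omega>) * Z \<omega>))
        = (CLINT \<omega>|M. (iexp (\<theta> * X \<omega> + 1 * Y \<omega>) * complex_of_real (Z \<omega>) + iexp (\<theta> * X \<omega> + (-1) * Y \<omega>) * complex_of_real (Z \<omega>)) / 2)"
        by (intro Bochner_Integration.integral_cong refl)
          (simp add: cos_of_real[symmetric] cos_exp_eq exp_add exp_diff exp_minus field_simps)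
      also have "\<dots> = 0" using I pm
        by (simp only: integral_divide_zero Bochner_Integration.integral_add[OF I I] pm) simp
      finally show ?thesis .
    qed
    have s1: "(CLINT \<omega>|M. iexp (\<theta> * X \<omega>) * complex_of_real (sin (Y \<omega>) * Z \<omega>)) = 0" for \<theta>
    proof -
      have "(CLINT \<omega>|M. iexp (\<theta> * X \<omega>) * complex_of_real (sin (Y \<omega>) * Z \<omega>))
        = (CLINT \<omega>|M. (iexp (\<theta> * X \<omega> + 1 * Y \<omega>) * complex_of_real (Z \<omega>) - iexp (\<theta> * X \<omega> + (-1) * Y \<omega>) * complex_of_real (Z \<omega>)) / (2 * \<i>))"
        by (intro Bochner_Integration.integral_cong refl)
          (simp add: sin_of_real[symmetric] sin_exp_eq exp_add exp_diff exp_minus field_simps)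
      also have "\<dots> = 0" using I pm
        by (simp only: integral_divide_zero Bochner_Integration.integral_diff[OF I I] pm) simp
      finally show ?thesis .
    qed
    have r: "(\<integral>\<omega>. indicator B (X \<omega>) * (cos (Y \<omega>) * Z \<omega>) \<partial>M) = 0"
      "(\<integral>\<omega>. indicator B (X \<omega>) * (sin (Y \<omega>) * Z \<omega>) \<partial>M) = 0"
      by (rule fourier_zero_line[OF Xm ci(1) B c1], rule fourier_zero_line[OF Xm ci(2) B s1])
    have iI: "integrable M (\<lambda>\<omega>. indicator (X -` B \<inter> space M) \<omega> * (cos (Y \<omega>) * Z \<omega>))"
       "integrable M (\<lambda>\<omega>. indicator (X -` B \<inter> space M) \<omega> * (sin (Y \<omega>) * Z \<omega>))"
      using ind[OF BX ci(1)] ind[OF BX ci(2)] .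
    have r': "(\<integral>\<omega>. indicator (X -` B \<inter> space M) \<omega> * f \<omega> \<partial>M) = (\<integral>\<omega>. indicator B (X \<omega>) * f \<omega> \<partial>M)" for f :: "'a \<Rightarrow> real"
      by (intro Bochner_Integration.integral_cong refl) (auto simp: indicator_def)
    have "(CLINT \<omega>|M. iexp (Y \<omega>) * complex_of_real (indicator (X -` B \<inter> space M) \<omega> * Z \<omega>))
      = (CLINT \<omega>|M. complex_of_real (indicator (X -` B \<inter> space M) \<omega> * (cos (Y \<omega>) * Z \<omega>))
           + \<i> * complex_of_real (indicator (X -` B \<inter> space M) \<omega> * (sin (Y \<omega>) * Z \<omega>)))"
      by (intro Bochner_Integration.integral_cong refl) (simp add: exp_Euler cos_of_real sin_of_real algebra_simps)
    also have "\<dots> = 0"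
      using iI r
      by (subst Bochner_Integration.integral_add)
        (simp_all only: integrable_mult_right integrable_of_real integral_mult_right_zero integral_complex_of_real r' of_real_0 mult_zero_right add_0)
    finally show "(CLINT \<omega>|M. iexp (Y \<omega>) * complex_of_real (indicator (X -` B \<inter> space M) \<omega> * Z \<omega>)) = 0" .
  qed
  have "C (\<lambda>\<omega>. indicator A \<omega> * Z \<omega>)" if "A \<in> sigma_sets (space M) ?G" "C Z" for A Z
    using that
  proof (induction arbitrary: Z rule: sigma_sets.induct)
    case (Basic a)
    show ?case
    proof (cases "a \<in> null_sets M")
      case True
      then have ae: "AE \<omega> in M. indicator a \<omega> * Z \<omega> = 0"
        using AE_not_in[OF True] by (auto elim!: eventually_mono)
      have i: "integrable M (\<lambda>\<omega>. indicator a \<omega> * Z \<omega>)" using True Basic ind by (auto simp: C_def)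
      have "(CLINT \<omega>|M. iexp (X \<omega>) * complex_of_real (indicator a \<omega> * Z \<omega>)) = 0" if "X \<in> V" for X
        by (rule integral_eq_zero_AE) (use ae in eventually_elim, simp)
      then show ?thesis using i by (simp add: C_def)
    next
      case False
      then show ?thesis using Basic gen by auto
    qed
  next
    case Empty
    then show ?case by (simp add: C_def)
  next
    case (Compl a)
    show ?case
      by (rule cong[OF combine[OF Compl.prems Compl.IH[OF Compl.prems], of "-1"]]) (auto simp: indicator_def)
  next
    case (Union a)
    have fin: "C (\<lambda>\<omega>. indicator (\<Union>i<n. a i) \<omega> * Z \<omega>)" for n :: nat
    proof (induction n)
      case 0 show ?case by (simp add: C_def)
    next
      case (Suc n)
      \<comment> \<open>Inclusion-exclusion, as the union need not be disjoint. The product of two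
        indicators is reached by applying the induction hypothesis to a member of C that already
        carries one of them.\<close>
      have "C (\<lambda>\<omega>. (indicator (\<Union>i<n. a i) \<omega> * Z \<omega> + 1 * (indicator (a n) \<omega> * Z \<omega>)) + (-1) * (indicator (a n) \<omega> * (indicator (\<Union>i<n. a i) \<omega> * Z \<omega>)))"
        by (intro combine Suc Union.IH Union.prems)
      then show ?case
        by (rule cong) (auto simp: indicator_def lessThan_Suc)
    qed
    have am: "a i \<in> sets M" for i using sub Union.hyps by blast
    have [measurable]: "Z \<in> borel_measurable M" using Union.prems by (auto simp: C_def)
    have "(\<Union>i. a i) \<in> sets M" using am by auto
    show ?case unfolding C_def
    proof (intro conjI ballI)
      show "integrable M (\<lambda>\<omega>. indicator (\<Union>i. a i) \<omega> * Z \<omega>)"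
        using Union.prems am by (intro ind) (auto simp: C_def)
      fix X assume X: "X \<in> V"
      note V(1)[OF X, measurable]
      note am [measurable]
      have "(\<lambda>n. CLINT \<omega>|M. iexp (X \<omega>) * complex_of_real (indicator (\<Union>i<n. a i) \<omega> * Z \<omega>))
          \<longlonglongrightarrow> (CLINT \<omega>|M. iexp (X \<omega>) * complex_of_real (indicator (\<Union>i. a i) \<omega> * Z \<omega>))"
      proof (rule integral_dominated_convergence[where w = "\<lambda>\<omega>. \<bar>Z \<omega>\<bar>"])
        show "integrable M (\<lambda>\<omega>. \<bar>Z \<omega>\<bar>)" using Union.prems by (auto simp: C_def)
        show "AE \<omega> in M. (\<lambda>n. iexp (X \<omega>) * complex_of_real (indicator (\<Union>i<n. a i) \<omega> * Z \<omega>))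
          \<longlonglongrightarrow> iexp (X \<omega>) * complex_of_real (indicator (\<Union>i. a i) \<omega> * Z \<omega>)"
        proof (intro AE_I2 tendsto_intros)
          fix \<omega>
          have inc: "incseq (\<lambda>n. \<Union>i<n. a i)" by (auto simp: incseq_def intro: less_le_trans)
          have "(\<Union>n. \<Union>i<n. a i) = (\<Union>i. a i)" by auto
          then show "(\<lambda>n. indicator (\<Union>i<n. a i) \<omega> :: real) \<longlonglongrightarrow> indicator (\<Union>i. a i) \<omega>"
            using LIMSEQ_indicator_incseq[OF inc, of \<omega>] by simp
        qed
        show "AE \<omega> in M. norm (iexp (X \<omega>) * complex_of_real (indicator (\<Union>i<n. a i) \<omega> * Z \<omega>)) \<le> \<bar>Z \<omega>\<bar>" for n
          by (auto simp: norm_mult indicator_def)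
      qed measurable
      moreover have "(CLINT \<omega>|M. iexp (X \<omega>) * complex_of_real (indicator (\<Union>i<n. a i) \<omega> * Z \<omega>)) = 0" for n
        using fin[of n] X unfolding C_def by blast
      ultimately show "(CLINT \<omega>|M. iexp (X \<omega>) * complex_of_real (indicator (\<Union>i. a i) \<omega> * Z \<omega>)) = 0"
        by (simp only: LIMSEQ_const_iff) 
    qed
  qed
  moreover have "C Z" using Z zero by (simp add: C_def)
  ultimately have CA: "C (\<lambda>\<omega>. indicator A \<omega> * Z \<omega>)" using A by blast
  obtain X where X: "X \<in> V" using V by auto
  \<comment> \<open>X + (-1)X is the zero function, and its transform is the plain integral of 1_A
    Z.\<close>
  obtain O' where O': "O' \<in> V" "\<forall>\<omega>\<in>space M. O' \<omega> = X \<omega> + (-1) * X \<omega>" using lin[OF X X] by blast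
  have "(CLINT \<omega>|M. iexp (O' \<omega>) * complex_of_real (indicator A \<omega> * Z \<omega>)) = 0" using CA O' by (simp add: C_def)
  then have "(CLINT \<omega>|M. complex_of_real (indicator A \<omega> * Z \<omega>)) = 0"
    using O'(2) by (simp cong: Bochner_Integration.integral_cong del: of_real_mult)
  then show ?thesis by (simp only: integral_complex_of_real of_real_eq_0_iff)
qed

text \<open>Since V contains -X, conjugating the hypothesis at -X gives it for the conjugate of Z.
  Half the sum of the two, and the difference divided by 2i, are the transforms of the real and the
  imaginary part, to which the real case applies.\<close>

lemma fourier_zero:
  fixes V :: "('a \<Rightarrow> real) set" and Z :: "'a \<Rightarrow> complex"
  assumes V: "\<And>X. X \<in> V \<Longrightarrow> X \<in> borel_measurable M" "V \<noteq> {}"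
    and lin: "\<And>X Y a. X \<in> V \<Longrightarrow> Y \<in> V \<Longrightarrow> \<exists>W\<in>V. \<forall>\<omega>\<in>space M. W \<omega> = X \<omega> + a * Y \<omega>"
    and Z: "integrable M Z"
    and zero: "\<And>X. X \<in> V \<Longrightarrow> (CLINT \<omega>|M. iexp (X \<omega>) * Z \<omega>) = 0"
    and A: "A \<in> sigma_sets (space M) ({X -` B \<inter> space M | X B. X \<in> V \<and> B \<in> sets borel} \<union> null_sets M)"
  shows "(CLINT \<omega>|M. indicator A \<omega> * Z \<omega>) = 0"
proof -
  have cz: "(CLINT \<omega>|M. iexp (X \<omega>) * cnj (Z \<omega>)) = 0" if X: "X \<in> V" for X
  proof -
    obtain W where W: "W \<in> V" "\<forall>\<omega>\<in>space M. W \<omega> = X \<omega> + (-2) * X \<omega>" using lin[OF X X] by blast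
    then have "(CLINT \<omega>|M. iexp (- X \<omega>) * Z \<omega>) = (CLINT \<omega>|M. iexp (W \<omega>) * Z \<omega>)"
      by (intro Bochner_Integration.integral_cong refl) simp
    also have "\<dots> = 0" by (rule zero[OF W(1)])
    finally have "(CLINT \<omega>|M. cnj (iexp (- X \<omega>) * Z \<omega>)) = 0"
      by (subst Bochner_Integration.integral_cnj) simp
    then show ?thesis by (simp add: exp_cnj)
  qed
  have i: "integrable M (\<lambda>\<omega>. iexp (X \<omega>) * Z \<omega>)" "integrable M (\<lambda>\<omega>. iexp (X \<omega>) * cnj (Z \<omega>))" if X: "X \<in> V" for X
    using V(1)[OF X] Z by (auto intro!: integrable_iexp_times)
  have R: "(CLINT \<omega>|M. iexp (X \<omega>) * complex_of_real (Re (Z \<omega>))) = 0" if X: "X \<in> V" for X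
  proof -
    have "(CLINT \<omega>|M. iexp (X \<omega>) * complex_of_real (Re (Z \<omega>)))
      = (CLINT \<omega>|M. (iexp (X \<omega>) * Z \<omega> + iexp (X \<omega>) * cnj (Z \<omega>)) / 2)"
      by (intro Bochner_Integration.integral_cong refl) (simp add: distrib_left[symmetric] complex_add_cnj)
    also have "\<dots> = 0"
      by (simp only: integral_divide_zero Bochner_Integration.integral_add[OF i[OF X]] zero[OF X] cz[OF X]) simp
    finally show ?thesis .
  qed
  have I: "(CLINT \<omega>|M. iexp (X \<omega>) * complex_of_real (Im (Z \<omega>))) = 0" if X: "X \<in> V" for X
  proof -
    have "(CLINT \<omega>|M. iexp (X \<omega>) * complex_of_real (Im (Z \<omega>)))
      = (CLINT \<omega>|M. (iexp (X \<omega>) * Z \<omega> - iexp (X \<omega>) * cnj (Z \<omega>)) / (2 * \<i>))"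
    proof (intro Bochner_Integration.integral_cong refl)
      fix \<omega>
      have "complex_of_real (Im (Z \<omega>)) = (Z \<omega> - cnj (Z \<omega>)) / (2 * \<i>)" by (simp add: complex_eq_iff)
      then show "iexp (X \<omega>) * complex_of_real (Im (Z \<omega>)) = (iexp (X \<omega>) * Z \<omega> - iexp (X \<omega>) * cnj (Z \<omega>)) / (2 * \<i>)"
        by (simp only: right_diff_distrib times_divide_eq_right)
    qed
    also have "\<dots> = 0"
      by (simp only: integral_divide_zero Bochner_Integration.integral_diff[OF i[OF X]] zero[OF X] cz[OF X]) simp
    finally show ?thesis .
  qed
  have "(\<integral>\<omega>. indicator A \<omega> * Re (Z \<omega>) \<partial>M) = 0"
    by (rule fourier_zero_real[OF V lin _ R A]) (use Z in auto)
  moreover have "(\<integral>\<omega>. indicator A \<omega> * Im (Z \<omega>) \<partial>M) = 0"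
    by (rule fourier_zero_real[OF V lin _ I A]) (use Z in auto)
  moreover have "A \<in> sets M"
  proof -
    have "{X -` B \<inter> space M | X B. X \<in> V \<and> B \<in> sets (borel :: real measure)} \<union> null_sets M \<subseteq> sets M"
      using V by (auto intro: measurable_sets)
    then show ?thesis using A sets.sigma_sets_subset by blast
  qed
  then have "integrable M (\<lambda>\<omega>. indicator A \<omega> * Z \<omega>)"
    by (intro Bochner_Integration.integrable_bound[OF Z]) (use Z in \<open>auto simp: norm_mult indicator_def\<close>)
  moreover have "Re (indicator A \<omega> * Z \<omega>) = indicator A \<omega> * Re (Z \<omega>)" "Im (indicator A \<omega> * Z \<omega>) = indicator A \<omega> * Im (Z \<omega>)" for \<omega>
    by (auto simp: indicator_def)
  ultimately show ?thesis
    by (simp add: complex_eq_iff integral_Re[symmetric] integral_Im[symmetric] del: integral_Re integral_Im)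
qed

text \<open>P and Q have densities D and D' with respect to their sum. The transforms of D - D'
  vanish, so it integrates to 0 over every set of the sigma-algebra generated by V.\<close>

lemma fourier_unique:
  fixes V :: "('a \<Rightarrow> real) set"
  assumes V: "\<And>X. X \<in> V \<Longrightarrow> X \<in> borel_measurable S" "V \<noteq> {}"
    and lin: "\<And>X Y a. X \<in> V \<Longrightarrow> Y \<in> V \<Longrightarrow> \<exists>W\<in>V. \<forall>\<omega>\<in>space S. W \<omega> = X \<omega> + a * Y \<omega>"
    and gen: "sets S \<subseteq> sigma_sets (space S) {X -` B \<inter> space S | X B. X \<in> V \<and> B \<in> sets borel}"
    and P: "P \<in> fin_meas S" and Q: "Q \<in> fin_meas S"
    and eq: "\<And>X. X \<in> V \<Longrightarrow> (CLINT \<omega>|P. iexp (X \<omega>)) = (CLINT \<omega>|Q. iexp (X \<omega>))"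
  shows "P = Q"
proof -
  define T where "T = measure_add P Q"
  have T: "T \<in> fin_meas S" unfolding T_def using P Q by (rule fin_meas_measure_add)
  have s: "sets P = sets S" "sets Q = sets S" "sets T = sets S" using P Q T by (auto simp: fin_meas_def)
  interpret T: finite_measure T using T by (simp add: fin_meas_def)
  note cs = measurable_cong_sets[OF s(3) refl]
  have sp: "space T = space S" using s(3) by (rule sets_eq_imp_space_eq)
  have em: "emeasure T A = emeasure P A + emeasure Q A" for A
    unfolding T_def using s by (intro emeasure_measure_add) simp
  have ex: "\<exists>D. D \<in> borel_measurable T \<and> (\<forall>x. 0 \<le> D x) \<and> density T (\<lambda>x. ennreal (D x)) = R \<and> integrable T D"
    if R: "R \<in> fin_meas S" "\<And>A. emeasure R A \<le> emeasure T A" for R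
  proof -
    interpret R: finite_measure R using R by (simp add: fin_meas_def)
    have sR: "sets R = sets T" using R s by (simp add: fin_meas_def)
    have ac: "absolutely_continuous T R"
      unfolding absolutely_continuous_def null_sets_def using sR
      by auto (metis R(2) le_zero_eq)
    obtain D where D: "D \<in> borel_measurable T" "AE x in T. RN_deriv T R x = ennreal (D x)" "\<And>x. 0 \<le> D x"
      using T.real_RN_deriv[OF R.finite_measure_axioms ac sR] by blast
    have "density T (\<lambda>x. ennreal (D x)) = density T (RN_deriv T R)"
      using D by (intro density_cong) (auto elim!: eventually_mono)
    also have "\<dots> = R" by (rule T.density_RN_deriv[OF ac sR])
    finally have d: "density T (\<lambda>x. ennreal (D x)) = R" .
    have "(\<integral>\<^sup>+x. ennreal (D x) \<partial>T) = emeasure (density T (\<lambda>x. ennreal (D x))) (space T)"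
      using D(1) by (simp add: emeasure_density cong: nn_integral_cong)
    also have "\<dots> = emeasure R (space R)" using sets_eq_imp_space_eq[OF sR] by (simp add: d)
    finally have "(\<integral>\<^sup>+x. ennreal (D x) \<partial>T) = emeasure R (space R)" .
    then have "integrable T D"
      using D(1,3) by (simp add: integrable_iff_bounded R.emeasure_eq_measure)
    with D d show ?thesis by blast
  qed
  obtain D where D: "D \<in> borel_measurable T" "\<And>x. 0 \<le> D x" "density T (\<lambda>x. ennreal (D x)) = P" "integrable T D"
    using ex[OF P] by (auto simp: em)
  obtain D' where D': "D' \<in> borel_measurable T" "\<And>x. 0 \<le> D' x" "density T (\<lambda>x. ennreal (D' x)) = Q" "integrable T D'"
    using ex[OF Q] by (auto simp: em)
  define Z where "Z x = D x - D' x" for x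
  show ?thesis
  proof (rule measure_eqI)
    show "sets P = sets Q" using s by simp
    fix A assume "A \<in> sets P"
    then have A: "A \<in> sets S" "A \<in> sets T" using s by auto
    have zz: "(CLINT x|T. iexp (X x) * complex_of_real (Z x)) = 0" if X: "X \<in> V" for X
    proof -
      have [measurable]: "X \<in> borel_measurable T" using V(1)[OF X] by (simp add: cs)
      note D(1)[measurable] D'(1)[measurable]
      have "(CLINT x|T. iexp (X x) * complex_of_real (Z x)) = (CLINT x|T. iexp (X x) * complex_of_real (D x) - iexp (X x) * complex_of_real (D' x))"
        by (simp add: Z_def algebra_simps)
      also have "\<dots> = (CLINT x|T. iexp (X x) * complex_of_real (D x)) - (CLINT x|T. iexp (X x) * complex_of_real (D' x))"
        using D(4) D'(4) by (intro Bochner_Integration.integral_diff integrable_iexp_times) auto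
      also have "(CLINT x|T. iexp (X x) * complex_of_real (D x)) = (CLINT x|P. iexp (X x))"
        unfolding D(3)[symmetric] using D by (subst integral_density) (auto simp: scaleR_conv_of_real mult.commute)
      also have "(CLINT x|T. iexp (X x) * complex_of_real (D' x)) = (CLINT x|Q. iexp (X x))"
        unfolding D'(3)[symmetric] using D' by (subst integral_density) (auto simp: scaleR_conv_of_real mult.commute)
      finally show ?thesis using eq[OF X] by simp
    qed
    have "A \<in> sigma_sets (space T) ({X -` B \<inter> space T | X B. X \<in> V \<and> B \<in> sets borel} \<union> null_sets T)"
      using A(1) gen unfolding sp by (auto intro: sigma_sets_mono'[THEN subsetD, rotated])
    then have "(\<integral>x. indicator A x * Z x \<partial>T) = 0"
      by (intro fourier_zero_real[of V T]) (use V lin zz D(4) D'(4) in \<open>auto simp: cs sp Z_def\<close>)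
    moreover have "integrable T (\<lambda>x. indicator A x * D x)" "integrable T (\<lambda>x. indicator A x * D' x)"
      using integrable_mult_indicator[OF A(2) D(4)] integrable_mult_indicator[OF A(2) D'(4)] by auto
    ultimately have e: "(\<integral>x. indicator A x * D x \<partial>T) = (\<integral>x. indicator A x * D' x \<partial>T)"
      by (simp add: Z_def right_diff_distrib)
    have em: "emeasure (density T (\<lambda>x. ennreal (F x))) A = ennreal (\<integral>x. indicator A x * F x \<partial>T)"
      if "F \<in> borel_measurable T" "\<And>x. 0 \<le> F x" "integrable T F" for F
    proof -
      have "emeasure (density T (\<lambda>x. ennreal (F x))) A = (\<integral>\<^sup>+x. ennreal (indicator A x * F x) \<partial>T)"
        using that A by (subst emeasure_density) (auto intro!: nn_integral_cong simp: indicator_def)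
      also have "\<dots> = ennreal (\<integral>x. indicator A x * F x \<partial>T)"
        using that integrable_mult_indicator[OF A(2) that(3)] by (intro nn_integral_eq_integral) auto
      finally show ?thesis .
    qed
    show "emeasure P A = emeasure Q A"
      using em[OF D(1,2,4)] em[OF D'(1,2,4)] e D(3) D'(3) by simp
  qed
qed

section \<open>The space of finite signed measures\<close>

text \<open>The second argument is a sequence of values instead of a signed measure: on sequences
  with the product topology this function is continuous, and both measurability and convergence in
  S(E) are read off from that.\<close>

definition rho_sum :: "'a measure \<Rightarrow> (nat \<Rightarrow> 'a \<Rightarrow> real) \<Rightarrow> ('a set \<Rightarrow> real) \<Rightarrow> (nat \<Rightarrow> real) \<Rightarrow> real" where
  "rho_sum E fs \<mu> y = (\<Sum>k. (1/2) ^ Suc k * min 1 \<bar>sint E \<mu> (fs k) - y k\<bar>)"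

lemma summable_min_geometric: "summable (\<lambda>k. (1/2 :: real) ^ Suc k * min 1 \<bar>a k\<bar>)"
proof (rule summable_comparison_test'[of "\<lambda>k. (1/2 :: real) * (1/2) ^ k" 0])
  show "summable (\<lambda>k. (1/2 :: real) * (1/2) ^ k)" by (intro summable_mult summable_geometric) simp
  show "norm ((1/2) ^ Suc k * min 1 \<bar>a k\<bar>) \<le> (1/2) * (1/2) ^ k" for k
    by (simp add: abs_mult)
qed

text \<open>The distance \<open>r\<close> is invariant under adding the same measure to both arguments, so the infimum
  is attained by decompositions of \<open>\<mu>\<close> and \<open>\<nu>\<close> with a common negative part.\<close>

lemma rho_dist_eq:
  assumes fs: "\<And>k. fs k \<in> bdd_borel E" and mu: "\<mu> \<in> fin_signed E" and nu: "\<nu> \<in> fin_signed E"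
  shows "rho_dist E fs \<mu> \<nu> = rho_sum E fs \<mu> (\<lambda>k. sint E \<nu> (fs k))"
  unfolding rho_dist_def
proof (rule cInf_eq_minimum)
  from mu nu obtain p n p' n' where h: "p \<in> fin_meas E" "n \<in> fin_meas E" "p' \<in> fin_meas E" "n' \<in> fin_meas E"
    and e: "\<mu> = sdiff p n" "\<nu> = sdiff p' n'"
    by (auto simp: fin_signed_def)
  have mm: "sdiff (measure_add p n') (measure_add n n') = sdiff p n" "sdiff (measure_add p' n) (measure_add n' n) = sdiff p' n'"
    using h by (auto simp: sdiff_def measure_measure_add[of _ E])
  have "rho_sum E fs \<mu> (\<lambda>k. sint E \<nu> (fs k)) = r_dist fs (measure_add p n') (measure_add p' n)"
    unfolding rho_sum_def r_dist_def e using h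
    by (simp add: integral_measure_add[of _ E] sint_eq fs algebra_simps)
  moreover have "r_dist fs (measure_add n n') (measure_add n' n) = 0"
    unfolding r_dist_def using h by (simp add: integral_measure_add[of _ E] fs algebra_simps)
  ultimately have vv: "rho_sum E fs \<mu> (\<lambda>k. sint E \<nu> (fs k)) = r_dist fs (measure_add p n') (measure_add p' n) + r_dist fs (measure_add n n') (measure_add n' n)"
    by simp
  show "rho_sum E fs \<mu> (\<lambda>k. sint E \<nu> (fs k)) \<in> {r_dist fs p p' + r_dist fs n n' | p n p' n'.
     p \<in> fin_meas E \<and> n \<in> fin_meas E \<and> p' \<in> fin_meas E \<and> n' \<in> fin_meas E \<and>
     sdiff p n = \<mu> \<and> sdiff p' n' = \<nu>}"
    by (rule CollectI, rule exI[of _ "measure_add p n'"], rule exI[of _ "measure_add n n'"],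
        rule exI[of _ "measure_add p' n"], rule exI[of _ "measure_add n' n"])
      (use mm vv in \<open>auto simp: h e fin_meas_measure_add\<close>)
next
  fix x assume "x \<in> {r_dist fs p p' + r_dist fs n n' | p n p' n'.
     p \<in> fin_meas E \<and> n \<in> fin_meas E \<and> p' \<in> fin_meas E \<and> n' \<in> fin_meas E \<and>
     sdiff p n = \<mu> \<and> sdiff p' n' = \<nu>}"
  then obtain p n p' n' where h: "p \<in> fin_meas E" "n \<in> fin_meas E" "p' \<in> fin_meas E" "n' \<in> fin_meas E"
    and e: "\<mu> = sdiff p n" "\<nu> = sdiff p' n'" and x: "x = r_dist fs p p' + r_dist fs n n'"
    by auto
  have "rho_sum E fs \<mu> (\<lambda>k. sint E \<nu> (fs k)) \<le> (\<Sum>k. (1/2) ^ Suc k * min 1 \<bar>integral\<^sup>L p (fs k) - integral\<^sup>L p' (fs k)\<bar>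
      + (1/2) ^ Suc k * min 1 \<bar>integral\<^sup>L n (fs k) - integral\<^sup>L n' (fs k)\<bar>)"
    unfolding rho_sum_def
  proof (rule suminf_le[OF _ summable_min_geometric summable_add[OF summable_min_geometric summable_min_geometric]])
    fix k
    show "(1/2) ^ Suc k * min 1 \<bar>sint E \<mu> (fs k) - sint E \<nu> (fs k)\<bar>
      \<le> (1/2) ^ Suc k * min 1 \<bar>integral\<^sup>L p (fs k) - integral\<^sup>L p' (fs k)\<bar>
      + (1/2) ^ Suc k * min 1 \<bar>integral\<^sup>L n (fs k) - integral\<^sup>L n' (fs k)\<bar>"
      unfolding distrib_left[symmetric]
      by (rule mult_left_mono) (auto simp: e sint_eq h fs)
  qed
  also have "\<dots> = x"
    unfolding x r_dist_def by (rule suminf_add[symmetric] summable_min_geometric)+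
  finally show "rho_sum E fs \<mu> (\<lambda>k. sint E \<nu> (fs k)) \<le> x" .
qed

lemma rho_sum_ge:
  "(1/2) ^ Suc k * min 1 \<bar>sint E \<mu> (fs k) - y k\<bar> \<le> rho_sum E fs \<mu> y"
  unfolding rho_sum_def using sum_le_suminf[OF summable_min_geometric, of "{k}" "\<lambda>k. sint E \<mu> (fs k) - y k"]
  by simp

lemma uniform_limit_rho_sum:
  "uniform_limit UNIV (\<lambda>n y. \<Sum>k<n. (1/2) ^ Suc k * min 1 \<bar>sint E \<mu> (fs k) - y k\<bar>) (rho_sum E fs \<mu>) sequentially"
  unfolding rho_sum_def
proof (rule Weierstrass_m_test[of _ _ "\<lambda>k. (1/2) * (1/2) ^ k"])
  show "summable (\<lambda>k. (1/2 :: real) * (1/2) ^ k)" by (intro summable_mult summable_geometric) simp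
  show "norm ((1/2) ^ Suc k * min 1 \<bar>sint E \<mu> (fs k) - y k\<bar>) \<le> (1/2) * (1/2) ^ k" for k y
    by (simp add: abs_mult)
qed

lemma continuous_on_rho_sum: "continuous_on UNIV (rho_sum E fs \<mu>)"
proof (rule uniform_limit_theorem[OF _ uniform_limit_rho_sum])
  have "continuous_on UNIV (\<lambda>y. \<Sum>k<n. (1/2) ^ Suc k * min 1 \<bar>sint E \<mu> (fs k) - y k\<bar>)" for n
    by (intro continuous_on_sum continuous_on_mult continuous_on_const continuous_on_min continuous_on_rabs
        continuous_on_diff continuous_on_product_coordinates)
  then show "\<forall>\<^sub>F n in sequentially. continuous_on UNIV (\<lambda>y. \<Sum>k<n. (1/2) ^ Suc k * min 1 \<bar>sint E \<mu> (fs k) - y k\<bar>)"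
    by simp
qed simp

lemma tendsto_rho_sum:
  assumes "\<And>k. ((\<lambda>s. y s k) \<longlongrightarrow> sint E \<mu> (fs k)) F"
  shows "((\<lambda>s. rho_sum E fs \<mu> (y s)) \<longlongrightarrow> 0) F"
proof -
  have "rho_sum E fs \<mu> (\<lambda>k. sint E \<mu> (fs k)) = 0" by (simp add: rho_sum_def)
  moreover have "(y \<longlongrightarrow> (\<lambda>k. sint E \<mu> (fs k))) F"
    using assms limitin_componentwise[of "\<lambda>_. euclidean" UNIV y "\<lambda>k. sint E \<mu> (fs k)" F]
    by (simp add: euclidean_product_topology)
  then have "((\<lambda>s. rho_sum E fs \<mu> (y s)) \<longlongrightarrow> rho_sum E fs \<mu> (\<lambda>k. sint E \<mu> (fs k))) F"
    using continuous_on_rho_sum[of E fs \<mu>] by (auto simp: continuous_on_eq_continuous_at isCont_tendsto_compose)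
  ultimately show ?thesis by simp
qed

lemma space_signed_space: "space (signed_space E fs) = fin_signed E"
  unfolding signed_space_def by (rule space_measure_of) auto

lemma signed_space_open:
  assumes "U \<subseteq> fin_signed E"
     "\<And>\<mu>. \<mu> \<in> U \<Longrightarrow> \<exists>e>0. \<forall>\<nu>\<in>fin_signed E. rho_dist E fs \<mu> \<nu> < e \<longrightarrow> \<nu> \<in> U"
  shows "U \<in> sets (signed_space E fs)"
  unfolding signed_space_def using assms by (subst sets_measure_of) auto

lemma sint_fs_measurable:
  assumes fs: "\<And>k. fs k \<in> bdd_borel E"
  shows "(\<lambda>\<nu>. sint E \<nu> (fs k)) \<in> borel_measurable (signed_space E fs)"
proof (rule borel_measurableI)
  fix O' :: "real set" assume O': "open O'"
  show "(\<lambda>\<nu>. sint E \<nu> (fs k)) -` O' \<inter> space (signed_space E fs) \<in> sets (signed_space E fs)"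
    unfolding space_signed_space
  proof (rule signed_space_open)
    fix \<mu> assume \<mu>: "\<mu> \<in> (\<lambda>\<nu>. sint E \<nu> (fs k)) -` O' \<inter> fin_signed E"
    then obtain e where e: "e > 0" "\<And>y. dist y (sint E \<mu> (fs k)) < e \<Longrightarrow> y \<in> O'"
      using O' unfolding open_dist by fastforce
    show "\<exists>e>0. \<forall>\<nu>\<in>fin_signed E. rho_dist E fs \<mu> \<nu> < e \<longrightarrow> \<nu> \<in> (\<lambda>\<nu>. sint E \<nu> (fs k)) -` O' \<inter> fin_signed E"
    \<comment> \<open>The radius is the weight of the k-th summand times min 1 e. Capping e at 1
      undoes the truncation in the metric: min 1 a < min 1 e forces a < e.\<close>
    proof (intro exI[of _ "(1/2) ^ Suc k * min 1 e"] conjI ballI impI)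
      show "(1/2) ^ Suc k * min 1 e > 0" using e by simp
      fix \<nu> assume \<nu>: "\<nu> \<in> fin_signed E" "rho_dist E fs \<mu> \<nu> < (1/2) ^ Suc k * min 1 e"
      then have "rho_sum E fs \<mu> (\<lambda>k. sint E \<nu> (fs k)) < (1/2) ^ Suc k * min 1 e"
        using \<mu> by (simp add: rho_dist_eq fs)
      with rho_sum_ge have "(1/2) ^ Suc k * min 1 \<bar>sint E \<mu> (fs k) - sint E \<nu> (fs k)\<bar> < (1/2) ^ Suc k * min 1 e"
        by (rule le_less_trans)
      then have "min 1 \<bar>sint E \<mu> (fs k) - sint E \<nu> (fs k)\<bar> < min 1 e"
        by (rule mult_left_less_imp_less) (rule zero_le_power, simp)
      then show "\<nu> \<in> (\<lambda>\<nu>. sint E \<nu> (fs k)) -` O' \<inter> fin_signed E"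
        using \<nu> by (auto intro!: e(2) simp: dist_real_def abs_minus_commute)
    qed
  qed auto
qed

text \<open>An open set may be an uncountable union of balls. Each ball is the preimage of an open
  set of sequences, and the union is formed among sequences, so that only the single open set
  \<open>W\<close> has to be pulled back along F.\<close>

lemma measurable_signed_space:
  assumes fs: "\<And>k. fs k \<in> bdd_borel E"
    and F: "\<And>\<omega>. \<omega> \<in> space L \<Longrightarrow> F \<omega> \<in> fin_signed E" "\<And>k. (\<lambda>\<omega>. sint E (F \<omega>) (fs k)) \<in> borel_measurable L"
  shows "F \<in> L \<rightarrow>\<^sub>M signed_space E fs"
  unfolding signed_space_def
proof (rule measurable_measure_of)
  show "F \<in> space L \<rightarrow> fin_signed E" using F by auto
  fix U assume "U \<in> {U. U \<subseteq> fin_signed E \<and>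
         (\<forall>\<mu>\<in>U. \<exists>e>0. \<forall>\<nu>\<in>fin_signed E. rho_dist E fs \<mu> \<nu> < e \<longrightarrow> \<nu> \<in> U)}"
  then have U: "U \<subseteq> fin_signed E" "\<forall>\<mu>\<in>U. \<exists>e>0. \<forall>\<nu>\<in>fin_signed E. rho_dist E fs \<mu> \<nu> < e \<longrightarrow> \<nu> \<in> U" by auto
  then obtain e where e: "\<And>\<mu>. \<mu> \<in> U \<Longrightarrow> e \<mu> > 0"
    "\<And>\<mu> \<nu>. \<mu> \<in> U \<Longrightarrow> \<nu> \<in> fin_signed E \<Longrightarrow> rho_dist E fs \<mu> \<nu> < e \<mu> \<Longrightarrow> \<nu> \<in> U"
    by metis
  define W where "W = (\<Union>\<mu>\<in>U. {y. rho_sum E fs \<mu> y < e \<mu>})"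
  have W: "open W" unfolding W_def
    using continuous_on_rho_sum by (auto intro!: open_Collect_less continuous_intros)
  have m: "(\<lambda>\<omega> k. sint E (F \<omega>) (fs k)) \<in> borel_measurable L"
    using F by (rule_tac measurable_coordinatewise_then_product)
  have "F -` U \<inter> space L = (\<lambda>\<omega> k. sint E (F \<omega>) (fs k)) -` W \<inter> space L"
  proof (intro equalityI subsetI)
    fix \<omega> assume "\<omega> \<in> F -` U \<inter> space L"
    then show "\<omega> \<in> (\<lambda>\<omega> k. sint E (F \<omega>) (fs k)) -` W \<inter> space L"
      using e(1) by (auto simp: W_def rho_sum_def intro!: bexI[of _ "F \<omega>"])
  next
    fix \<omega> assume "\<omega> \<in> (\<lambda>\<omega> k. sint E (F \<omega>) (fs k)) -` W \<inter> space L"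
    then obtain \<mu> where *: "\<omega> \<in> space L" "\<mu> \<in> U" "rho_sum E fs \<mu> (\<lambda>k. sint E (F \<omega>) (fs k)) < e \<mu>"
      by (auto simp: W_def)
    then have "rho_dist E fs \<mu> (F \<omega>) < e \<mu>"
      using F(1) U(1) by (subst rho_dist_eq) (auto simp: fs)
    then show "\<omega> \<in> F -` U \<inter> space L" using * F(1) e(2) by auto
  qed
  then show "F -` U \<inter> space L \<in> sets L"
    using measurable_sets[OF m, of W] W by simp
qed auto

text \<open>By \<open>measurable_signed_space\<close> the identity is measurable from the
  sigma-algebra generated by the evaluations to that of the metric.\<close>

lemma sets_signed_space_subset:
  assumes fs: "\<And>k. fs k \<in> bdd_borel E"
  shows "sets (signed_space E fs) \<subseteq> sigma_sets (fin_signed E)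
    {(\<lambda>\<nu>. sint E \<nu> (fs k)) -` B \<inter> fin_signed E | k B. B \<in> sets borel}" (is "_ \<subseteq> sigma_sets _ ?G")
proof
  fix A assume A: "A \<in> sets (signed_space E fs)"
  let ?L = "sigma (fin_signed E) ?G"
  have G: "?G \<subseteq> Pow (fin_signed E)" by auto
  have "(\<lambda>\<nu>. \<nu>) \<in> ?L \<rightarrow>\<^sub>M signed_space E fs"
  proof (rule measurable_signed_space[OF fs])
    show "\<omega> \<in> space ?L \<Longrightarrow> \<omega> \<in> fin_signed E" for \<omega> using space_measure_of[OF G] by auto
    show "(\<lambda>\<omega>. sint E \<omega> (fs k)) \<in> borel_measurable ?L" for k
    proof (rule measurableI)
      fix B :: "real set" assume "B \<in> sets borel"
      then show "(\<lambda>\<omega>. sint E \<omega> (fs k)) -` B \<inter> space ?L \<in> sets ?L"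
        unfolding space_measure_of[OF G] sets_measure_of[OF G] by (intro sigma_sets.Basic) auto
    qed auto
  qed
  from measurable_sets[OF this A] have "A \<inter> space ?L \<in> sets ?L" by (simp add: vimage_def Int_def)
  moreover have "A \<subseteq> fin_signed E" using sets.sets_into_space[OF A] by (simp add: space_signed_space)
  ultimately show "A \<in> sigma_sets (fin_signed E) ?G"
    unfolding space_measure_of[OF G] sets_measure_of[OF G] by (simp add: Int_absorb2)
qed

lemma tendsto_sint:
  assumes \<nu>: "\<nu> \<in> fin_signed E" and g: "\<And>i::nat. g i \<in> bdd_borel E" and f: "f \<in> bdd_borel E"
    and bd: "\<And>i x. x \<in> space E \<Longrightarrow> \<bar>g i x\<bar> \<le> B" and lim: "\<And>x. x \<in> space E \<Longrightarrow> (\<lambda>i. g i x) \<longlonglongrightarrow> f x"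
  shows "(\<lambda>i. sint E \<nu> (g i)) \<longlonglongrightarrow> sint E \<nu> f"
proof -
  from \<nu> obtain p n where h: "p \<in> fin_meas E" "n \<in> fin_meas E" "\<nu> = sdiff p n" by (auto simp: fin_signed_def)
  have *: "(\<lambda>i. integral\<^sup>L q (g i)) \<longlonglongrightarrow> integral\<^sup>L q f" if q: "q \<in> fin_meas E" for q
  proof -
    interpret finite_measure q using q by (simp add: fin_meas_def)
    have s: "space q = space E" using q sets_eq_imp_space_eq[of q E] by (simp add: fin_meas_def)
    show ?thesis
      using integrable_bdd_borel[OF q f] integrable_bdd_borel[OF q g] bd lim
      by (intro integral_dominated_convergence[where w = "\<lambda>_. B"]) (auto simp: s)
  qed
  show ?thesis unfolding h(3) using h(1,2) by (simp add: sint_eq f g tendsto_diff *)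
qed

lemma bdd_borel_tendsto:
  assumes g: "\<And>i::nat. g i \<in> bdd_borel E"
    and bd: "\<And>i x. x \<in> space E \<Longrightarrow> \<bar>g i x\<bar> \<le> B" and lim: "\<And>x. x \<in> space E \<Longrightarrow> (\<lambda>i. g i x) \<longlonglongrightarrow> f x"
  shows "f \<in> bdd_borel E"
proof -
  have "f \<in> borel_measurable E"
    by (rule borel_measurable_LIMSEQ_real[OF lim]) (use g in \<open>auto simp: bdd_borel_def\<close>)
  moreover have "\<bar>f x\<bar> \<le> B" if "x \<in> space E" for x
    using tendsto_rabs[OF lim[OF that]] bd[OF that] by (intro LIMSEQ_le_const2) auto
  ultimately show ?thesis by (auto simp: bdd_borel_def bounded_iff)
qed

lemma space_D [simp]: "space D_space = {0<..}" by (simp add: D_space_def space_restrict_space)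

lemma bdd_borel_D_continuous:
  assumes "continuous_on {0<..} f" "\<And>x. 0 < x \<Longrightarrow> \<bar>f x\<bar> \<le> B"
  shows "f \<in> bdd_borel D_space"
  using assms by (auto simp: bdd_borel_def bounded_iff D_space_def intro!: borel_measurable_continuous_on_restrict)

locale signed_state =
  fixes d :: "real metric" and fs :: "nat \<Rightarrow> real \<Rightarrow> real"
  assumes msp: "mspace d = {0<..}" and mtop: "mtopology_of d = top_of_set {0<..}"
    and dense: "dense_in_buc d fs"
begin

abbreviation "S \<equiv> signed_space D_space fs"

lemma buc_continuous: "g \<in> buc d \<Longrightarrow> continuous_on {0<..} g"
  using uniformly_continuous_imp_continuous_map[of d euclidean_metric g]
  by (auto simp: buc_def mtop)

lemma buc_bdd: assumes "g \<in> buc d" shows "g \<in> bdd_borel D_space"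
proof -
  obtain B where "\<And>x. 0 < x \<Longrightarrow> \<bar>g x\<bar> \<le> B" using assms by (auto simp: buc_def msp bounded_iff)
  then show ?thesis by (rule bdd_borel_D_continuous[OF buc_continuous[OF assms]])
qed

lemma fs_buc: "fs k \<in> buc d" using dense by (auto simp: dense_in_buc_def)

lemma fs_bdd: "fs k \<in> bdd_borel D_space" by (rule buc_bdd[OF fs_buc])

lemma fs_continuous: "continuous_on {0<..} (fs k)" by (rule buc_continuous[OF fs_buc])

section \<open>From the dense sequence to all bounded Borel functions\<close>

definition measurable_tests where "measurable_tests = {f \<in> bdd_borel D_space. (\<lambda>\<nu>. sint D_space \<nu> f) \<in> borel_measurable S}"

text \<open>Every extension step ends in a bounded pointwise limit: uniform approximation by the
  \<open>fs k\<close>, approximation of closed sets, countable disjoint unions and simple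
  functions.\<close>

lemma tests_lim:
  assumes g: "\<And>i::nat. g i \<in> measurable_tests"
    and bd: "\<And>i x. 0 < x \<Longrightarrow> \<bar>g i x\<bar> \<le> B" and lim: "\<And>x. 0 < x \<Longrightarrow> (\<lambda>i. g i x) \<longlonglongrightarrow> f x"
  shows "f \<in> measurable_tests"
proof -
  have f: "f \<in> bdd_borel D_space" by (rule bdd_borel_tendsto[of g _ B]) (use g bd lim in \<open>auto simp: measurable_tests_def\<close>)
  have "(\<lambda>\<nu>. sint D_space \<nu> f) \<in> borel_measurable S"
    by (rule borel_measurable_LIMSEQ_real[where u = "\<lambda>i \<nu>. sint D_space \<nu> (g i)"])
      (use g bd lim f in \<open>auto simp: measurable_tests_def space_signed_space intro!: tendsto_sint[of _ _ _ _ B]\<close>)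
  with f show ?thesis by (simp add: measurable_tests_def)
qed

lemma tests_add: assumes "f \<in> measurable_tests" "g \<in> measurable_tests" shows "(\<lambda>x. f x + c * g x) \<in> measurable_tests"
proof -
  have "(\<lambda>\<nu>. sint D_space \<nu> (\<lambda>x. f x + c * g x)) \<in> borel_measurable S"
  proof (rule measurable_cong[THEN iffD2])
    show "sint D_space \<nu> (\<lambda>x. f x + c * g x) = sint D_space \<nu> f + c * sint D_space \<nu> g" if "\<nu> \<in> space S" for \<nu>
      using that assms by (intro sint_add) (auto simp: space_signed_space measurable_tests_def)
    show "(\<lambda>\<nu>. sint D_space \<nu> f + c * sint D_space \<nu> g) \<in> borel_measurable S"
      using assms by (auto simp: measurable_tests_def)
  qed
  then show ?thesis using assms by (auto simp: measurable_tests_def bdd_borel_add)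
qed

lemma tests_cong: assumes "f \<in> measurable_tests" "\<And>x. 0 < x \<Longrightarrow> f x = g x" shows "g \<in> measurable_tests"
proof -
  obtain B where "\<And>x. 0 < x \<Longrightarrow> \<bar>f x\<bar> \<le> B" using assms(1) by (auto simp: measurable_tests_def bdd_borel_def bounded_iff)
  with assms(1) show ?thesis by (rule_tac tests_lim[of "\<lambda>_. f" B]) (simp_all add: assms(2)[symmetric])
qed

lemma tests_fs: "fs k \<in> measurable_tests"
  using fs_bdd sint_fs_measurable[of fs D_space] by (simp add: measurable_tests_def)

lemma tests_zero: "(\<lambda>_. 0) \<in> measurable_tests"
  by (rule tests_cong[OF tests_add[OF tests_fs[of 0] tests_fs[of 0], of "-1"]]) simp

lemma tests_buc: assumes g: "g \<in> buc d" shows "g \<in> measurable_tests"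
proof -
  obtain B where B: "\<And>x. 0 < x \<Longrightarrow> \<bar>g x\<bar> \<le> B" using g by (auto simp: buc_def msp bounded_iff)
  have "\<exists>k. \<forall>x>0. \<bar>fs k x - g x\<bar> < 1 / real (Suc i)" for i
    using dense g unfolding dense_in_buc_def msp by (metis greaterThan_iff of_nat_0_less_iff zero_less_Suc zero_less_divide_1_iff)
  then obtain k where k: "\<And>i x. 0 < x \<Longrightarrow> \<bar>fs (k i) x - g x\<bar> < 1 / real (Suc i)" by metis
  show ?thesis
  proof (rule tests_lim[of "\<lambda>i. fs (k i)" "B + 1"])
    show "fs (k i) \<in> measurable_tests" for i by (rule tests_fs)
    fix x :: real assume x: "0 < x"
    show "\<bar>fs (k i) x\<bar> \<le> B + 1" for i
    proof -
      have "1 / real (Suc i) \<le> 1" by simp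
      then show ?thesis using k[OF x, of i] B[OF x] by linarith
    qed
    have "(\<lambda>i. fs (k i) x - g x) \<longlonglongrightarrow> 0"
      by (rule Lim_null_comparison[OF _ LIMSEQ_inverse_real_of_nat])
        (use k[OF x] in \<open>auto simp: inverse_eq_divide intro!: always_eventually less_imp_le\<close>)
    then show "(\<lambda>i. fs (k i) x) \<longlonglongrightarrow> g x" by (simp add: LIM_zero_iff)
  qed
qed

text \<open>The indicator is the limit of max 0 (1 - n h), where h is the distance to C measured in
  d. These functions are Lipschitz for d and hence lie in \<open>buc d\<close>, although d need not
  be the Euclidean metric; h is positive off C because d induces the usual topology.\<close>

lemma tests_closed_indicator:
  assumes C: "closedin (top_of_set {0<..}) C" shows "indicator C \<in> measurable_tests"
proof (cases "C = {}")
  \<comment> \<open>For the empty set the infimum defining h would range over no points.\<close>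
  case True
  have "(\<lambda>x. fs 0 x + (-1) * fs 0 x) \<in> measurable_tests" by (intro tests_add tests_fs)
  then show ?thesis by (rule tests_cong) (simp add: True)
next
  case False
  then obtain c0 where c0: "c0 \<in> C" by auto
  have CD: "C \<subseteq> {0<..}" using closedin_subset[OF C] by simp
  interpret Metric_space "mspace d" "mdist d" by (rule Metric_space_mspace_mdist)
  define h where "h x = (INF c\<in>C. mdist d x c)" for x
  have bb: "bdd_below ((\<lambda>c. mdist d x c) ` C)" for x by (rule bdd_belowI[of _ 0]) auto
  have h0: "0 \<le> h x" for x unfolding h_def using c0 by (intro cINF_greatest) auto
  have tri: "h x \<le> mdist d x y + h y" if "x > 0" "y > 0" for x y
  proof -
    have "h x - mdist d x y \<le> h y"
      unfolding h_def[of y]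
    proof (rule cINF_greatest)
      fix c assume c: "c \<in> C"
      have "h x \<le> mdist d x c" unfolding h_def by (rule cINF_lower[OF bb c])
      also have "\<dots> \<le> mdist d x y + mdist d y c" using that c CD by (intro triangle) (auto simp: msp)
      finally show "h x - mdist d x y \<le> mdist d y c" by simp
    qed (use c0 in auto)
    then show ?thesis by simp
  qed
  define g where "g n x = max 0 (1 - real n * h x)" for n :: nat and x
  have lip: "\<bar>g n x - g n y\<bar> \<le> real n * mdist d x y" if "x > 0" "y > 0" for n x y
  proof -
    have "\<bar>h x - h y\<bar> \<le> mdist d x y" using tri[OF that] tri[OF that(2,1)] commute[of x y] by simp
    then have "\<bar>real n * h x - real n * h y\<bar> \<le> real n * mdist d x y"
      by (simp add: abs_mult mult_left_mono flip: right_diff_distrib)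
    then show ?thesis by (simp add: g_def)
  qed
  have "g n \<in> buc d" for n
    unfolding buc_def
  proof (intro CollectI conjI Lipschitz_imp_uniformly_continuous_map)
    show "Lipschitz_continuous_map d euclidean_metric (g n)"
      unfolding Lipschitz_continuous_map_def using lip by (auto simp: msp dist_real_def intro!: exI[of _ "real n"])
    show "bounded (g n ` mspace d)"
      using h0 by (auto simp: bounded_iff g_def intro!: exI[of _ 1])
  qed
  then have gH: "g n \<in> measurable_tests" for n by (rule tests_buc)
  show ?thesis
  proof (rule tests_lim[of g 1, OF gH])
    fix x :: real assume x: "0 < x"
    show "\<bar>g i x\<bar> \<le> 1" for i using h0 by (auto simp: g_def)
    show "(\<lambda>i. g i x) \<longlonglongrightarrow> indicator C x"
    proof (cases "x \<in> C")
      case True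
      have "h x \<le> mdist d x x" unfolding h_def by (rule cINF_lower[OF bb True])
      then have "h x = 0" using h0[of x] x by (simp add: msp)
      then show ?thesis using True by (simp add: g_def)
    next
      case False
      have "openin (top_of_set {0<..}) ({0<..} - C)" using C by (simp add: closedin_def)
      then have "openin mtopology ({0<..} - C)" using mtop by (simp add: mtopology_of_def)
      then obtain r where r: "r > 0" "mball x r \<subseteq> {0<..} - C" using False x by (auto simp: openin_mtopology)
      have "r \<le> h x" unfolding h_def
      proof (rule cINF_greatest)
        fix c assume c: "c \<in> C"
        then have "c \<notin> mball x r" using r by auto
        moreover have "x \<in> mspace d" "c \<in> mspace d" using c CD x by (auto simp: msp)
        ultimately show "r \<le> mdist d x c" by (simp add: not_less)
      qed (use c0 in auto)
      then have hp: "h x > 0" using r by simp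
      obtain m where m: "1 / h x < real m" using reals_Archimedean2 by blast
      have "g i x = 0" if "i \<ge> m" for i
      proof -
        have "1 < real m * h x" using m hp by (simp add: field_simps)
        also have "\<dots> \<le> real i * h x" using that hp by simp
        finally show ?thesis by (simp add: g_def)
      qed
      then have "eventually (\<lambda>i. g i x = 0) sequentially" by (auto simp: eventually_sequentially)
      then show ?thesis using False by (simp add: tendsto_eventually)
    qed
  qed
qed

lemma sets_D_closed: "sets D_space = sigma_sets {0<..} {C. closedin (top_of_set {0<..}) C}"
proof -
  have "sets D_space = (\<inter>) {0<..} ` sigma_sets UNIV {C::real set. closed C}"
    unfolding D_space_def sets_restrict_space borel_eq_closed by (subst sets_measure_of) auto
  also have "\<dots> = sigma_sets {0<..} ((\<inter>) {0<..} ` {C::real set. closed C})"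
  proof (rule sigma_sets_Int)
    have "{0::real<..} \<in> sets (sigma UNIV {C::real set. closed C})"
      unfolding borel_eq_closed[symmetric] by simp
    then show "{0::real<..} \<in> sigma_sets UNIV {C::real set. closed C}" by (subst (asm) sets_measure_of) auto
  qed simp
  also have "(\<inter>) {0<..} ` {C::real set. closed C} = {C. closedin (top_of_set {0<..}) C}"
    by (auto simp: closedin_closed)
  finally show ?thesis .
qed

text \<open>Pi-lambda argument: the relatively closed sets are stable under intersection and
  generate the Borel sets of D, while sums and limits handle complements and disjoint
  unions.\<close>

lemma tests_indicator:
  assumes A: "A \<in> sets D_space" shows "indicator A \<in> measurable_tests"
proof -
  have 1: "indicator {0<..} \<in> measurable_tests" by (rule tests_closed_indicator) auto
  have "Int_stable {C. closedin (top_of_set {0::real<..}) C}" by (auto simp: Int_stable_def)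
  moreover have "{C. closedin (top_of_set {0::real<..}) C} \<subseteq> Pow {0<..}" using closedin_subset by fastforce
  ultimately show ?thesis using A[unfolded sets_D_closed]
  proof (induction rule: sigma_sets_induct_disjoint)
    case (basic A) then show ?case by (auto intro: tests_closed_indicator)
  next
    case empty then show ?case by (simp add: tests_zero)
  next
    case (compl A)
    show ?case by (rule tests_cong[OF tests_add[OF 1 compl(2), of "-1"]]) (auto simp: indicator_def)
  next
    case (union A)
    have fin: "indicator (\<Union>i<n. A i) \<in> measurable_tests" for n
    proof (induction n)
      case 0 then show ?case by (simp add: tests_zero)
    next
      case (Suc n)
      have "A n \<inter> A i = {}" if "i < n" for i using union(1) that by (auto simp: disjoint_family_on_def)
      then have "disjnt (A n) (\<Union>i<n. A i)" by (auto simp: disjnt_def)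
      then show ?case
        by (intro tests_cong[OF tests_add[OF Suc union(3)[of n], of 1]]) (auto simp: indicator_def disjnt_def lessThan_Suc)
    qed
    show ?case
    proof (rule tests_lim[where B = 1, OF fin])
      show "\<bar>indicator (\<Union>j<i. A j) x\<bar> \<le> (1::real)" for i x by (auto simp: indicator_def)
      fix x :: real
      have inc: "incseq (\<lambda>n. \<Union>i<n. A i)" by (auto simp: incseq_def intro: less_le_trans)
      have "(\<Union>n. \<Union>i<n. A i) = (\<Union>i. A i)" by auto
      then show "(\<lambda>n. indicator (\<Union>i<n. A i) x :: real) \<longlonglongrightarrow> indicator (\<Union>i. A i) x"
        using LIMSEQ_indicator_incseq[OF inc, of x] by simp
    qed
  qed
qed

lemma bdd_borel_tests: assumes f: "f \<in> bdd_borel D_space" shows "f \<in> measurable_tests"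
proof -
  obtain B where B: "\<And>x. 0 < x \<Longrightarrow> \<bar>f x\<bar> \<le> B" using f by (auto simp: bdd_borel_def bounded_iff)
  from f have "f \<in> borel_measurable D_space" by (simp add: bdd_borel_def)
  from borel_measurable_implies_sequence_metric[OF this, of 0] obtain F where
    F0: "\<forall>i. simple_function D_space (F i)" "\<forall>x\<in>space D_space. (\<lambda>i. F i x) \<longlonglongrightarrow> f x"
      "\<forall>i. \<forall>x\<in>space D_space. dist (F i x) 0 \<le> 2 * dist (f x) 0" by blast
  then have F: "\<And>i. simple_function D_space (F i)" "\<And>x. 0 < x \<Longrightarrow> (\<lambda>i. F i x) \<longlonglongrightarrow> f x"
      "\<And>i x. 0 < x \<Longrightarrow> \<bar>F i x\<bar> \<le> 2 * \<bar>f x\<bar>" by auto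
  have "F i \<in> measurable_tests" for i
  proof -
    have fin: "finite (F i ` {0<..})" using F(1)[of i] by (simp add: simple_function_def)
    have sum: "finite Y \<Longrightarrow> Y \<subseteq> F i ` {0<..} \<Longrightarrow> (\<lambda>x. \<Sum>y\<in>Y. y * indicator (F i -` {y} \<inter> {0<..}) x) \<in> measurable_tests" for Y
    proof (induction Y rule: finite_induct)
      case empty
      show ?case by (simp add: tests_zero)
    next
      case (insert y Y)
      then have "F i -` {y} \<inter> {0<..} \<in> sets D_space" using F(1)[of i] by (auto simp: simple_function_def)
      then have "(\<lambda>x. (\<Sum>y\<in>Y. y * indicator (F i -` {y} \<inter> {0<..}) x) + y * indicator (F i -` {y} \<inter> {0<..}) x) \<in> measurable_tests"
        using insert by (intro tests_add tests_indicator) auto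
      then show ?case
        by (rule tests_cong) (simp only: sum.insert[OF insert.hyps(1,2)] add.commute)
    qed
    show ?thesis
    proof (rule tests_cong[OF sum[OF fin order_refl]])
      fix x :: real assume x: "0 < x"
      have "(\<Sum>y\<in>F i ` {0<..}. y * indicator (F i -` {y} \<inter> {0<..}) x) = (\<Sum>y\<in>{F i x}. y * indicator (F i -` {y} \<inter> {0<..}) x)"
        by (rule sum.mono_neutral_right) (use x fin in \<open>auto simp: indicator_def\<close>)
      then show "(\<Sum>y\<in>F i ` {0<..}. y * indicator (F i -` {y} \<inter> {0<..}) x) = F i x" using x by simp
    qed
  qed
  then show ?thesis
  proof (rule tests_lim[of F "2 * B"])
    fix i and x :: real assume "0 < x"
    then show "\<bar>F i x\<bar> \<le> 2 * B" using F(3)[of x i] B[of x] by linarith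
  qed (use F in auto)
qed

lemma sint_measurable: "f \<in> bdd_borel D_space \<Longrightarrow> (\<lambda>\<nu>. sint D_space \<nu> f) \<in> borel_measurable S"
  using bdd_borel_tests by (auto simp: measurable_tests_def)

text \<open>The class K is left open for two uses: all bounded Borel functions to identify R_t, and
  the bounded continuous ones at stopping times, where limits in time are taken.\<close>

lemma char_functional_unique:
  assumes K: "K \<subseteq> bdd_borel D_space" "\<And>k. fs k \<in> K" "\<And>f g c. f \<in> K \<Longrightarrow> g \<in> K \<Longrightarrow> (\<lambda>x. f x + c * g x) \<in> K"
    and P: "P \<in> fin_meas S" and Q: "Q \<in> fin_meas S"
    and eq: "\<And>f. f \<in> K \<Longrightarrow> (CLINT \<nu>|P. iexp (sint D_space \<nu> f)) = (CLINT \<nu>|Q. iexp (sint D_space \<nu> f))"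
  shows "P = Q"
proof (rule fourier_unique[of "(\<lambda>f \<nu>. sint D_space \<nu> f) ` K"])
  show "sets S \<subseteq> sigma_sets (space S) {X -` B \<inter> space S |X B. X \<in> (\<lambda>f \<nu>. sint D_space \<nu> f) ` K \<and> B \<in> sets borel}"
    unfolding space_signed_space
    by (rule order_trans[OF sets_signed_space_subset[OF fs_bdd]], rule sigma_sets_mono') (use K(2) in auto)
next
  fix X Y a assume "X \<in> (\<lambda>f \<nu>. sint D_space \<nu> f) ` K" "Y \<in> (\<lambda>f \<nu>. sint D_space \<nu> f) ` K"
  then obtain f g where h: "f \<in> K" "g \<in> K" "X = (\<lambda>\<nu>. sint D_space \<nu> f)" "Y = (\<lambda>\<nu>. sint D_space \<nu> g)" by auto
  show "\<exists>W\<in>(\<lambda>f \<nu>. sint D_space \<nu> f) ` K. \<forall>\<omega>\<in>space S. W \<omega> = X \<omega> + a * Y \<omega>"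
    using h K by (intro bexI[of _ "\<lambda>\<nu>. sint D_space \<nu> (\<lambda>x. f x + a * g x)"] ballI imageI)
      (auto simp: space_signed_space intro!: sint_add)
qed (use K P Q eq sint_measurable in auto)

end

section \<open>The absorbing heat semigroup\<close>

text \<open>The value 0 at the origin makes the extension odd at every point.\<close>

definition odd_ext :: "(real \<Rightarrow> real) \<Rightarrow> real \<Rightarrow> real" where
  "odd_ext f y = (if 0 < y then f y else if y < 0 then - f (- y) else 0)"

text \<open>With Z standard normal this is E F(x + \<open>sqrt r\<close> Z). Fixing the Gaussian and
  moving r into the argument covers r = 0 without a separate clause and yields one integrable bound
  for all r.\<close>

definition gauss_smooth :: "real \<Rightarrow> (real \<Rightarrow> real) \<Rightarrow> real \<Rightarrow> real" where
  "gauss_smooth r F x = (\<integral>z. std_normal_density z * F (x + sqrt r * z) \<partial>lborel)"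

lemma integrable_std_normal_times:
  assumes [measurable]: "F \<in> borel_measurable borel" and B: "\<And>x. \<bar>F x\<bar> \<le> B"
  shows "integrable lborel (\<lambda>z. std_normal_density z * F (x + c * z))"
proof (rule Bochner_Integration.integrable_bound[where f = "\<lambda>z. std_normal_density z * B"])
  have "0 \<le> B" using B[of 0] by linarith
  then show "AE z in lborel. norm (std_normal_density z * F (x + c * z)) \<le> norm (std_normal_density z * B)"
    using B by (auto simp: abs_mult intro!: mult_left_mono)
qed auto

lemma gauss_smooth_bound:
  assumes F: "F \<in> borel_measurable borel" and B: "\<And>x. \<bar>F x\<bar> \<le> B"
  shows "\<bar>gauss_smooth r F x\<bar> \<le> B"
proof -
  have "\<bar>gauss_smooth r F x\<bar> \<le> (\<integral>z. \<bar>std_normal_density z * F (x + sqrt r * z)\<bar> \<partial>lborel)"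
    unfolding gauss_smooth_def by (rule integral_abs_bound)
  also have "\<dots> \<le> (\<integral>z. std_normal_density z * B \<partial>lborel)"
  proof (rule integral_mono)
    show "integrable lborel (\<lambda>z. \<bar>std_normal_density z * F (x + sqrt r * z)\<bar>)"
      by (rule integrable_abs[OF integrable_std_normal_times[OF F B]])
  qed (use B in \<open>auto simp: abs_mult intro!: mult_left_mono\<close>)
  finally show ?thesis by simp
qed

lemma gauss_smooth_measurable:
  assumes [measurable]: "F \<in> borel_measurable borel" "r \<in> borel_measurable L" "x \<in> borel_measurable L"
  shows "(\<lambda>w. gauss_smooth (r w) F (x w)) \<in> borel_measurable L"
  unfolding gauss_smooth_def by measurable

text \<open>F may jump at 0. The limiting argument of F meets 0 for one z if r0 > 0, and for no z if
  r0 = 0, because x0 > 0.\<close>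

lemma gauss_smooth_tendsto:
  assumes [measurable]: "F \<in> borel_measurable borel" and B: "\<And>x. \<bar>F x\<bar> \<le> B"
    and c: "continuous_on (- {0}) F" and r: "r \<longlonglongrightarrow> r0" "0 \<le> r0" and x: "x \<longlonglongrightarrow> x0" "0 < x0"
  shows "(\<lambda>n. gauss_smooth (r n) F (x n)) \<longlonglongrightarrow> gauss_smooth r0 F x0"
  unfolding gauss_smooth_def
proof (rule integral_dominated_convergence[where w = "\<lambda>z. std_normal_density z * B"])
  \<comment> \<open>For r0 = 0 the quotient is 0 by convention, and excluding this single z does no
    harm.\<close>
  have "AE z in lborel. z \<noteq> - x0 / sqrt r0" by (rule AE_lborel_singleton)
  then show "AE z in lborel. (\<lambda>n. std_normal_density z * F (x n + sqrt (r n) * z)) \<longlonglongrightarrow> std_normal_density z * F (x0 + sqrt r0 * z)"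
  proof eventually_elim
    case (elim z)
    have "x0 + sqrt r0 * z \<noteq> 0"
    proof
      assume a: "x0 + sqrt r0 * z = 0"
      then have "sqrt r0 \<noteq> 0" using x by auto
      then show False using a elim by (auto simp: field_simps)
    qed
    then have "isCont F (x0 + sqrt r0 * z)"
      using c continuous_on_eq_continuous_at[of "- {0}" F] by auto
    moreover have "(\<lambda>n. x n + sqrt (r n) * z) \<longlonglongrightarrow> x0 + sqrt r0 * z"
      by (intro tendsto_intros r x)
    ultimately have "(\<lambda>n. F (x n + sqrt (r n) * z)) \<longlonglongrightarrow> F (x0 + sqrt r0 * z)"
      by (rule isCont_tendsto_compose)
    then show ?case by (intro tendsto_intros)
  qed
  show "AE z in lborel. norm (std_normal_density z * F (x n + sqrt (r n) * z)) \<le> std_normal_density z * B" for n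
    using B by (auto simp: abs_mult intro!: mult_left_mono)
qed auto

lemma gauss_smooth_odd:
  assumes "\<And>x. F (- x) = - F x" shows "gauss_smooth r F (- x) = - gauss_smooth r F x"
proof -
  have "gauss_smooth r F (- x) = (\<integral>z. std_normal_density (- z) * F (- x + sqrt r * (- z)) \<partial>lborel)"
    unfolding gauss_smooth_def by (subst lborel_integral_real_affine[of "-1" _ 0]) auto
  also have "\<dots> = (\<integral>z. - (std_normal_density z * F (x + sqrt r * z)) \<partial>lborel)"
    using assms[of "x + sqrt r * _"] by (intro Bochner_Integration.integral_cong) (auto simp: normal_density_def algebra_simps)
  finally show ?thesis by (simp add: gauss_smooth_def)
qed

lemma gauss_smooth_normal:
  assumes [measurable]: "F \<in> borel_measurable borel" and r: "0 < r"
  shows "gauss_smooth r F x = (\<integral>y. F (x + y) \<partial>density lborel (normal_density 0 (sqrt r)))"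
proof -
  have "(\<integral>y. F (x + y) \<partial>density lborel (normal_density 0 (sqrt r))) = (\<integral>y. normal_density 0 (sqrt r) y * F (x + y) \<partial>lborel)"
    by (subst integral_density) auto
  also have "\<dots> = sqrt r * (\<integral>z. normal_density 0 (sqrt r) (sqrt r * z) * F (x + sqrt r * z) \<partial>lborel)"
    using r by (subst lborel_integral_real_affine[of "sqrt r" _ 0]) auto
  also have "\<dots> = (\<integral>z. sqrt r * (normal_density 0 (sqrt r) (sqrt r * z) * F (x + sqrt r * z)) \<partial>lborel)"
    by simp
  also have "\<dots> = gauss_smooth r F x"
    unfolding gauss_smooth_def using r
    by (intro Bochner_Integration.integral_cong refl)
      (simp add: normal_density_def real_sqrt_mult power_mult_distrib)
  finally show ?thesis ..
qed

text \<open>Variances add under convolution of centred normal laws. The cases s = 0 and t = 0 are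
  separate, as a normal density with standard deviation 0 is not a probability density.\<close>

lemma gauss_smooth_semigroup:
  assumes F [measurable]: "F \<in> borel_measurable borel" and B: "\<And>x. \<bar>F x\<bar> \<le> B" and st: "0 \<le> s" "0 \<le> t"
  shows "gauss_smooth s (gauss_smooth t F) x = gauss_smooth (s + t) F x"
proof -
  have z: "gauss_smooth 0 G x = G x" for G x by (simp add: gauss_smooth_def)
  show ?thesis
  proof (cases "s = 0 \<or> t = 0")
    case True
    then show ?thesis
    proof
      assume "t = 0"
      moreover have "gauss_smooth 0 F = F" using z by auto
      ultimately show ?thesis by simp
    qed (simp add: z)
  next
    case False
    then have p: "0 < s" "0 < t" "0 < s + t" using st by auto
    let ?N = "\<lambda>r. density lborel (\<lambda>y. ennreal (normal_density 0 (sqrt r) y))"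
    interpret S: prob_space "?N s" using p by (intro prob_space_normal_density) simp
    interpret T: prob_space "?N t" using p by (intro prob_space_normal_density) simp
    interpret pair_prob_space "?N s" "?N t" ..
    have conv: "?N s \<star> ?N t = ?N (s + t)"
    proof -
      have "?N s \<star> ?N t = density lborel (\<lambda>x. \<integral>\<^sup>+y. ennreal (normal_density 0 (sqrt s) (x - y)) * ennreal (normal_density 0 (sqrt t) y) \<partial>lborel)"
        by (rule convolution_density) (auto intro: S.finite_measure_axioms T.finite_measure_axioms)
      also have "\<dots> = density lborel (\<lambda>x. \<integral>\<^sup>+y. ennreal (normal_density 0 (sqrt s) (x - y) * normal_density 0 (sqrt t) y) \<partial>lborel)"
        by (simp add: ennreal_mult)
      also have "\<dots> = ?N (s + t)"
        using p by (subst conv_normal_density_zero_mean) auto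
      finally show ?thesis .
    qed
    have Gm: "gauss_smooth t F \<in> borel_measurable borel"
      by (rule gauss_smooth_measurable) auto
    have "gauss_smooth s (gauss_smooth t F) x = (\<integral>y. \<integral>w. F (x + y + w) \<partial>?N t \<partial>?N s)"
      by (subst gauss_smooth_normal[OF Gm p(1)]) (simp add: gauss_smooth_normal[OF F p(2)])
    also have "\<dots> = (\<integral>z. F (x + (fst z + snd z)) \<partial>(?N s \<Otimes>\<^sub>M ?N t))"
    proof (subst integral_fst'[symmetric])
      show "integrable (?N s \<Otimes>\<^sub>M ?N t) (\<lambda>z. F (x + (fst z + snd z)))"
        by (rule P.integrable_const_bound[of _ B]) (use B in auto)
    qed (simp add: add.assoc)
    also have "\<dots> = (\<integral>v. F (x + v) \<partial>(?N s \<star> ?N t))"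
      unfolding convolution_def by (subst integral_distr) (auto simp: case_prod_beta)
    also have "\<dots> = gauss_smooth (s + t) F x"
      unfolding conv by (simp add: gauss_smooth_normal[OF F p(3)])
    finally show ?thesis .
  qed
qed

section \<open>The absorbed semigroup by reflection\<close>

lemma bdd_borel_D_bound: "f \<in> bdd_borel D_space \<Longrightarrow> \<exists>B. \<forall>x>0. \<bar>f x\<bar> \<le> B"
  by (auto simp: bdd_borel_def bounded_iff)

lemma bdd_borel_D_iff:
  fixes f :: "real \<Rightarrow> real"
  shows
    "f \<in> borel_measurable D_space \<longleftrightarrow> (\<lambda>x. indicator {0<..} x * f x) \<in> borel_measurable borel"
  unfolding D_space_def by (subst borel_measurable_restrict_space_iff) auto

lemma odd_ext_measurable:
  assumes "f \<in> bdd_borel D_space" shows "odd_ext f \<in> borel_measurable borel"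
proof -
  have [measurable]: "(\<lambda>x. indicator {0<..} x * f x) \<in> borel_measurable borel" (is "?g \<in> _")
    using assms by (simp add: bdd_borel_def bdd_borel_D_iff)
  have "odd_ext f = (\<lambda>x. ?g x - ?g (- x))" by (auto simp: odd_ext_def indicator_def)
  also have "\<dots> \<in> borel_measurable borel" by measurable
  finally show ?thesis .
qed

lemma odd_ext_odd: "odd_ext f (- x) = - odd_ext f x" by (simp add: odd_ext_def)

lemma odd_ext_bound: assumes "\<And>x. 0 < x \<Longrightarrow> \<bar>f x\<bar> \<le> B" shows "\<bar>odd_ext f x\<bar> \<le> B"
  using assms[of x] assms[of "-x"] assms[of 1] by (auto simp: odd_ext_def)

lemma odd_ext_continuous:
  assumes "continuous_on {0<..} f" shows "continuous_on (- {0}) (odd_ext f)"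
proof -
  have 1: "continuous_on {0<..} (odd_ext f)"
    by (rule continuous_on_eq[OF assms]) (simp add: odd_ext_def)
  have 2: "continuous_on {..<0} (odd_ext f)"
    by (rule continuous_on_eq[where f = "\<lambda>x. - f (- x)"])
      (auto simp: odd_ext_def intro!: continuous_intros continuous_on_compose2[OF assms])
  have "- {0::real} = {..<0} \<union> {0<..}" by auto
  then show ?thesis using 1 2 by (simp add: continuous_on_open_Un)
qed

lemma gauss_density_normal: "0 < t \<Longrightarrow> gauss_density t x = normal_density 0 (sqrt t) x"
  by (simp add: gauss_density_def normal_density_def)

text \<open>Reflection: the absorbed semigroup is the free one acting on odd extensions.  This formula is
  uniform in \<open>r \<ge> 0\<close>, which gives joint continuity up to time \<open>0\<close>.\<close>

lemma absP_gauss_smooth: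
  assumes f: "f \<in> bdd_borel D_space" and r: "0 \<le> r" and x: "0 < x"
  shows "absP r f x = gauss_smooth r (odd_ext f) x"
proof (cases "r = 0")
  case True
  then show ?thesis using x by (simp add: absP_def gauss_smooth_def odd_ext_def)
next
  case False
  then have r: "0 < r" using r by simp
  obtain B where B: "\<And>x. 0 < x \<Longrightarrow> \<bar>f x\<bar> \<le> B" using bdd_borel_D_bound[OF f] by auto
  have [measurable]: "odd_ext f \<in> borel_measurable borel" by (rule odd_ext_measurable[OF f])
  have [measurable]: "(\<lambda>x. indicator {0<..} x * f x) \<in> borel_measurable borel" (is "?g \<in> _")
    using f by (simp add: bdd_borel_def bdd_borel_D_iff)
  let ?n = "normal_density 0 (sqrt r)"
  have B0: "0 \<le> B" using B[of 1] by simp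
  have gb: "\<bar>?g y\<bar> \<le> B" for y using B[of y] B0 by (auto simp: indicator_def)
  \<comment> \<open>The signs e and h let one integrability statement serve the direct term, the
    image term, and the image term after y -> -y.\<close>
  have i1: "integrable lborel (\<lambda>y. ?n (c * x + e * y) * ?g (h * y))" if "e \<noteq> 0" "\<bar>e\<bar> = 1" for c e h
  proof (rule Bochner_Integration.integrable_bound[where f = "\<lambda>y. ?n (c * x + e * y) * B"])
    have "integrable lborel ?n" using r by auto
    from lborel_integrable_real_affine[OF this that(1), of "c * x"]
    show "integrable lborel (\<lambda>y. ?n (c * x + e * y) * B)" by (rule integrable_mult_left)
    show "AE y in lborel. norm (?n (c * x + e * y) * ?g (h * y)) \<le> norm (?n (c * x + e * y) * B)"
      using gb B0 by (intro AE_I2) (auto simp: abs_mult intro!: mult_left_mono simp del: mult_indicator_subset)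
  qed auto
  have "absP r f x = (\<integral>y. ?n (1 * x + (-1) * y) * ?g (1 * y) - ?n (1 * x + 1 * y) * ?g (1 * y) \<partial>lborel)"
    using r by (auto simp: absP_def set_lebesgue_integral_def p_kernel_def gauss_density_normal algebra_simps
        intro!: Bochner_Integration.integral_cong)
  also have "\<dots> = (\<integral>y. ?n (1 * x + (-1) * y) * ?g (1 * y) \<partial>lborel) - (\<integral>y. ?n (1 * x + 1 * y) * ?g (1 * y) \<partial>lborel)"
    by (intro Bochner_Integration.integral_diff i1) auto
  \<comment> \<open>Substituting y -> -y moves the image term to the negative half line, where it
    becomes the odd continuation of f.\<close>
  also have "(\<integral>y. ?n (1 * x + 1 * y) * ?g (1 * y) \<partial>lborel) = (\<integral>y. ?n (1 * x + (-1) * y) * ?g ((-1) * y) \<partial>lborel)"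
    by (subst lborel_integral_real_affine[of "-1" _ 0]) auto
  also have "(\<integral>y. ?n (1 * x + (-1) * y) * ?g (1 * y) \<partial>lborel) - (\<integral>y. ?n (1 * x + (-1) * y) * ?g ((-1) * y) \<partial>lborel)
      = (\<integral>y. ?n (1 * x + (-1) * y) * ?g (1 * y) - ?n (1 * x + (-1) * y) * ?g ((-1) * y) \<partial>lborel)"
    by (intro Bochner_Integration.integral_diff[symmetric] i1) auto
  also have "\<dots> = (\<integral>y. ?n (x - y) * odd_ext f y \<partial>lborel)"
    by (intro Bochner_Integration.integral_cong) (auto simp: odd_ext_def indicator_def)
  also have "\<dots> = (\<integral>y. ?n y * odd_ext f (x + y) \<partial>lborel)"
    by (subst lborel_integral_real_affine[of 1 _ x]) (auto simp: normal_density_def)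
  also have "\<dots> = gauss_smooth r (odd_ext f) x"
    by (subst gauss_smooth_normal) (use r in \<open>auto simp: integral_density\<close>)
  finally show ?thesis .
qed

lemma absP_bound:
  assumes f: "f \<in> bdd_borel D_space" and r: "0 \<le> r" and x: "0 < x" and B: "\<And>x. 0 < x \<Longrightarrow> \<bar>f x\<bar> \<le> B"
  shows "\<bar>absP r f x\<bar> \<le> B"
  unfolding absP_gauss_smooth[OF f r x]
  by (rule gauss_smooth_bound[OF odd_ext_measurable[OF f] odd_ext_bound]) (rule B)

lemma absP_measurable:
  assumes f: "f \<in> bdd_borel D_space" and [measurable]: "r \<in> borel_measurable L" "x \<in> borel_measurable L"
    and "\<And>w. w \<in> space L \<Longrightarrow> 0 \<le> r w" "\<And>w. w \<in> space L \<Longrightarrow> 0 < x w"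
  shows "(\<lambda>w. absP (r w) f (x w)) \<in> borel_measurable L"
proof (rule measurable_cong[THEN iffD2])
  show "absP (r w) f (x w) = gauss_smooth (r w) (odd_ext f) (x w)" if "w \<in> space L" for w
    using assms that by (intro absP_gauss_smooth) auto
  show "(\<lambda>w. gauss_smooth (r w) (odd_ext f) (x w)) \<in> borel_measurable L"
    by (rule gauss_smooth_measurable[OF odd_ext_measurable[OF f]]) auto
qed

lemma absP_bdd:
  assumes f: "f \<in> bdd_borel D_space" and r: "0 \<le> r"
  shows "absP r f \<in> bdd_borel D_space"
proof -
  obtain B where B: "\<And>x. 0 < x \<Longrightarrow> \<bar>f x\<bar> \<le> B" using bdd_borel_D_bound[OF f] by auto
  have "(\<lambda>x. absP r f x) \<in> borel_measurable D_space"
    by (rule absP_measurable[OF f]) (auto simp: r D_space_def intro: measurable_restrict_space1)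
  moreover have "bounded (absP r f ` {0<..})"
    unfolding bounded_iff using absP_bound[OF f r _ B] by (auto intro!: exI[of _ B])
  ultimately show ?thesis by (simp add: bdd_borel_def)
qed

lemma absP_tendsto:
  assumes f: "f \<in> bdd_borel D_space" and c: "continuous_on {0<..} f"
    and r: "r \<longlonglongrightarrow> r0" "\<And>n. 0 \<le> r n" and x: "x \<longlonglongrightarrow> x0" "0 < x0" "\<And>n. 0 < x n"
  shows "(\<lambda>n. absP (r n) f (x n)) \<longlonglongrightarrow> absP r0 f x0"
proof -
  obtain B where B: "\<And>x. 0 < x \<Longrightarrow> \<bar>f x\<bar> \<le> B" using bdd_borel_D_bound[OF f] by auto
  have r0: "0 \<le> r0" using r by (intro LIMSEQ_le_const) auto
  show ?thesis
    unfolding absP_gauss_smooth[OF f r(2) x(3)] absP_gauss_smooth[OF f r0 x(2)]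
    by (rule gauss_smooth_tendsto[OF odd_ext_measurable[OF f] odd_ext_bound odd_ext_continuous[OF c] r(1) r0 x(1,2)])
      (rule B)
qed

lemma absP_continuous_on:
  assumes f: "f \<in> bdd_borel D_space" and c: "continuous_on {0<..} f" and r: "0 \<le> r"
  shows "continuous_on {0<..} (absP r f)"
  unfolding continuous_on_sequentially
proof (intro allI ballI impI)
  fix x and a :: real assume a: "a \<in> {0<..}" and x: "(\<forall>n. x n \<in> {0<..}) \<and> x \<longlonglongrightarrow> a"
  then show "(absP r f \<circ> x) \<longlonglongrightarrow> absP r f a"
    using absP_tendsto[OF f c tendsto_const, of r x a] r by (auto simp: comp_def)
qed

text \<open>Gaussian smoothing preserves oddness, so extending P_r f amounts to smoothing the
  extension on the whole line. The semigroup law of P is thereby inherited from the free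
  one.\<close>

lemma odd_ext_absP:
  assumes f: "f \<in> bdd_borel D_space" and r: "0 \<le> r"
  shows "odd_ext (absP r f) x = gauss_smooth r (odd_ext f) x"
proof -
  have o: "gauss_smooth r (odd_ext f) (- x) = - gauss_smooth r (odd_ext f) x" for x
    by (rule gauss_smooth_odd) (rule odd_ext_odd)
  consider "0 < x" | "x = 0" | "x < 0" by linarith
  then show ?thesis
  proof cases
    case 1 then show ?thesis by (simp add: odd_ext_def absP_gauss_smooth[OF f r])
  next
    case 2 then show ?thesis using o[of 0] by (simp add: odd_ext_def)
  next
    case 3 then show ?thesis using o[of "x"] by (simp add: odd_ext_def absP_gauss_smooth[OF f r])
  qed
qed

lemma absP_semigroup:
  assumes f: "f \<in> bdd_borel D_space" and s: "0 \<le> s" and t: "0 \<le> t" and x: "0 < x"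
  shows "absP s (absP t f) x = absP (s + t) f x"
proof -
  obtain B where B: "\<And>x. 0 < x \<Longrightarrow> \<bar>f x\<bar> \<le> B" using bdd_borel_D_bound[OF f] by auto
  have e: "odd_ext (absP t f) = gauss_smooth t (odd_ext f)" using odd_ext_absP[OF f t] by auto
  have "absP s (absP t f) x = gauss_smooth s (gauss_smooth t (odd_ext f)) x"
    by (simp add: absP_gauss_smooth[OF absP_bdd[OF f t] s x] e)
  also have "\<dots> = gauss_smooth (s + t) (odd_ext f) x"
    by (rule gauss_smooth_semigroup[OF odd_ext_measurable[OF f] odd_ext_bound s t]) (rule B)
  also have "\<dots> = absP (s + t) f x" using s t by (simp add: absP_gauss_smooth[OF f _ x])
  finally show ?thesis .
qed

section \<open>Transition measures and the transport of weighted points\<close>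

definition heat_kernel :: "real \<Rightarrow> real \<Rightarrow> real measure" where
  "heat_kernel r x = (if r = 0 then return D_space x else density (restrict_space lborel {0<..}) (\<lambda>y. ennreal (p_kernel r x y)))"

lemma sets_heat_kernel: "sets (heat_kernel r x) = sets D_space"
  by (auto simp: heat_kernel_def D_space_def sets_restrict_space)

lemma p_kernel_nonneg: assumes "0 < r" "0 < x" "0 < y" shows "0 \<le> p_kernel r x y"
proof -
  have "(x - y)\<^sup>2 \<le> (x + y)\<^sup>2" using assms by (simp add: power2_eq_square algebra_simps)
  then have "(x - y)\<^sup>2 / (2 * r) \<le> (x + y)\<^sup>2 / (2 * r)" using assms by (intro divide_right_mono) auto
  then show ?thesis using assms by (simp add: p_kernel_def gauss_density_def divide_right_mono)
qed

text \<open>A measure behind \<open>absP\<close> supplies the countable additivity in f that makes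
  Y_t and \<mu>P_t signed measures. For r > 0 finiteness follows by dropping the image term, which
  leaves a Gaussian density.\<close>

lemma
  assumes r: "0 \<le> r" and x: "0 < x"
  shows heat_kernel_fin_meas: "heat_kernel r x \<in> fin_meas D_space"
    and integral_heat_kernel: "f \<in> bdd_borel D_space \<Longrightarrow> (\<integral>y. f y \<partial>heat_kernel r x) = absP r f x"
proof -
  have "heat_kernel r x \<in> fin_meas D_space \<and> (f \<in> bdd_borel D_space \<longrightarrow> (\<integral>y. f y \<partial>heat_kernel r x) = absP r f x)"
  proof (cases "r = 0")
    case True
    have "prob_space (return D_space x)" using x by (intro prob_space_return) simp
    then have "heat_kernel r x \<in> fin_meas D_space" using True by (simp add: heat_kernel_def fin_meas_def prob_space.finite_measure)
    moreover have "(\<integral>y. f y \<partial>heat_kernel r x) = absP r f x" if "f \<in> bdd_borel D_space"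
      using True x that by (simp add: heat_kernel_def absP_def integral_return bdd_borel_def)
    ultimately show ?thesis by simp
  next
    case False
    then have r: "0 < r" using r by simp
    let ?R = "restrict_space lborel {0::real<..}"
    have sp: "space ?R = {0<..}" by (simp add: space_restrict_space)
    have sR: "sets ?R = sets D_space" by (auto simp: D_space_def sets_restrict_space)
    have pm0: "(\<lambda>y. p_kernel r x y) \<in> borel_measurable borel" unfolding p_kernel_def gauss_density_def by measurable
    have pm [measurable]: "(\<lambda>y. p_kernel r x y) \<in> borel_measurable ?R"
      by (intro measurable_restrict_space1) (use pm0 in simp)
    have "emeasure (heat_kernel r x) (space (heat_kernel r x)) = emeasure (density ?R (\<lambda>y. ennreal (p_kernel r x y))) (space ?R)"
      using False by (simp add: heat_kernel_def)
    also have "\<dots> = (\<integral>\<^sup>+y. ennreal (p_kernel r x y) * indicator (space ?R) y \<partial>?R)"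
      using sets.top[of ?R] by (intro emeasure_density) measurable
    also have "\<dots> = (\<integral>\<^sup>+y. ennreal (p_kernel r x y) \<partial>?R)"
      by (intro nn_integral_cong) simp
    also have "\<dots> = (\<integral>\<^sup>+y. ennreal (p_kernel r x y) * indicator {0<..} y \<partial>lborel)"
      by (subst nn_integral_restrict_space) auto
    also have "\<dots> \<le> (\<integral>\<^sup>+y. ennreal (normal_density 0 (sqrt r) (x + (-1) * y)) \<partial>lborel)"
      by (intro nn_integral_mono) (use r in \<open>auto simp: p_kernel_def gauss_density_normal indicator_def intro!: ennreal_leI\<close>)
    also have "\<dots> < \<infinity>"
    proof -
      have "integrable lborel (normal_density 0 (sqrt r))" using r by auto
      from lborel_integrable_real_affine[OF this, of "-1" x] show ?thesis
        by (simp add: integrable_iff_bounded)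
    qed
    finally have "emeasure (heat_kernel r x) (space (heat_kernel r x)) < \<infinity>" .
    then have "heat_kernel r x \<in> fin_meas D_space" by (auto simp: fin_meas_def sets_heat_kernel intro!: finite_measureI)
    moreover have "(\<integral>y. f y \<partial>heat_kernel r x) = absP r f x" if f: "f \<in> bdd_borel D_space"
    proof -
      have fm: "f \<in> borel_measurable ?R" using f sR by (simp add: bdd_borel_def cong: measurable_cong_sets)
      have "(\<integral>y. f y \<partial>heat_kernel r x) = (\<integral>y. p_kernel r x y *\<^sub>R f y \<partial>?R)"
        using False fm p_kernel_nonneg[OF r x] by (simp add: heat_kernel_def) (subst integral_density, auto simp: sp intro!: AE_I2)
      also have "\<dots> = absP r f x"
        using r by (subst integral_restrict_space) (auto simp: absP_def set_lebesgue_integral_def)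
      finally show ?thesis .
    qed
    ultimately show ?thesis by simp
  qed
  then show "heat_kernel r x \<in> fin_meas D_space" "f \<in> bdd_borel D_space \<Longrightarrow> (\<integral>y. f y \<partial>heat_kernel r x) = absP r f x" by auto
qed

lemma indicator_bdd_borel: "A \<in> sets E \<Longrightarrow> indicator A \<in> bdd_borel E"
  by (auto simp: bdd_borel_def bounded_iff indicator_def intro!: exI[of _ 1] borel_measurable_indicator)

lemma emeasure_heat_kernel:
  assumes "0 \<le> r" "0 < x" and A: "A \<in> sets D_space"
  shows "emeasure (heat_kernel r x) A = ennreal (absP r (indicator A) x)"
proof -
  interpret finite_measure "heat_kernel r x" using heat_kernel_fin_meas[OF assms(1,2)] by (simp add: fin_meas_def)
  have "A \<subseteq> space (heat_kernel r x)" using sets.sets_into_space[OF A] sets_eq_imp_space_eq[OF sets_heat_kernel] by simp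
  then show ?thesis
    using integral_heat_kernel[OF assms(1,2) indicator_bdd_borel[OF A]] A
    by (simp add: emeasure_eq_measure sets_heat_kernel Int_absorb2)
qed

lemma kernel_heat_kernel:
  assumes "r \<in> borel_measurable L" "x \<in> borel_measurable L"
    and "\<And>w. w \<in> space L \<Longrightarrow> 0 \<le> r w" "\<And>w. w \<in> space L \<Longrightarrow> 0 < x w"
  shows "kernel_on L D_space (\<lambda>w. heat_kernel (r w) (x w))"
  unfolding kernel_on_def
proof (intro conjI ballI)
  fix C assume C: "C \<in> sets D_space"
  show "(\<lambda>w. emeasure (heat_kernel (r w) (x w)) C) \<in> borel_measurable L"
  proof (rule measurable_cong[THEN iffD2])
    show "emeasure (heat_kernel (r w) (x w)) C = ennreal (absP (r w) (indicator C) (x w))" if "w \<in> space L" for w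
      using that assms C by (intro emeasure_heat_kernel) auto
    have "(\<lambda>w. absP (r w) (indicator C) (x w)) \<in> borel_measurable L"
      by (rule absP_measurable[OF indicator_bdd_borel[OF C] assms])
    then show "(\<lambda>w. ennreal (absP (r w) (indicator C) (x w))) \<in> borel_measurable L" by measurable
  qed
qed (simp add: sets_heat_kernel)

text \<open>Points x(z) of weight w(z) diffuse for times r(z): p is the mixture of their heat
  kernels over the weighted L. It is applied to positive jumps, to negative jumps and to the parts
  of an initial measure.\<close>

lemma transport_measure:
  assumes r: "r \<in> borel_measurable L" and x: "x \<in> borel_measurable L"
    and rx: "\<And>z. z \<in> space L \<Longrightarrow> 0 \<le> r z" "\<And>z. z \<in> space L \<Longrightarrow> 0 < x z"
    and w [measurable]: "w \<in> borel_measurable L" and w0: "\<And>z. z \<in> space L \<Longrightarrow> 0 \<le> w z"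
    and wi: "integrable L w"
  obtains p where "p \<in> fin_meas D_space"
    "\<And>f. f \<in> bdd_borel D_space \<Longrightarrow> integrable L (\<lambda>z. w z * absP (r z) f (x z))"
    "\<And>f. f \<in> bdd_borel D_space \<Longrightarrow> (\<integral>y. f y \<partial>p) = (\<integral>z. w z * absP (r z) f (x z) \<partial>L)"
proof -
  define L' where "L' = density L (\<lambda>z. ennreal (w z))"
  have sL: "space L' = space L" "\<And>F. measurable L' F = measurable L F" unfolding L'_def by auto
  have k: "kernel_on L' D_space (\<lambda>z. heat_kernel (r z) (x z))"
    by (rule kernel_heat_kernel) (use assms in \<open>auto simp: sL\<close>)
  define p where "p = mixture L' (\<lambda>z. heat_kernel (r z) (x z)) D_space"
  have wnn: "(\<integral>\<^sup>+z. ennreal (w z) \<partial>L) < \<infinity>"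
    using wi w0 by (subst nn_integral_eq_integral) auto
  have e1: "(\<integral>\<^sup>+y. ennreal \<bar>f y\<bar> \<partial>heat_kernel (r z) (x z)) \<le> ennreal B"
    if "f \<in> bdd_borel D_space" "\<And>x. 0 < x \<Longrightarrow> \<bar>f x\<bar> \<le> B" "z \<in> space L" for f B z
  proof -
    have "(\<lambda>y. \<bar>f y\<bar>) \<in> bdd_borel D_space"
      using that(1) by (auto simp: bdd_borel_def bounded_iff)
    moreover have "heat_kernel (r z) (x z) \<in> fin_meas D_space" using rx that by (intro heat_kernel_fin_meas) auto
    ultimately have "(\<integral>\<^sup>+y. ennreal \<bar>f y\<bar> \<partial>heat_kernel (r z) (x z)) = ennreal (\<integral>y. \<bar>f y\<bar> \<partial>heat_kernel (r z) (x z))"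
      by (intro nn_integral_eq_integral integrable_bdd_borel) auto
    also have "\<dots> = ennreal (absP (r z) (\<lambda>y. \<bar>f y\<bar>) (x z))"
      using rx that \<open>(\<lambda>y. \<bar>f y\<bar>) \<in> bdd_borel D_space\<close> by (subst integral_heat_kernel) auto
    also have "\<dots> \<le> ennreal B"
      using absP_bound[OF \<open>(\<lambda>y. \<bar>f y\<bar>) \<in> bdd_borel D_space\<close>, of "r z" "x z" B] rx that by (intro ennreal_leI) auto
    finally show ?thesis .
  qed
  have e2: "(\<integral>\<^sup>+z. \<integral>\<^sup>+y. ennreal \<bar>f y\<bar> \<partial>heat_kernel (r z) (x z) \<partial>L') < \<infinity>"
    if f: "f \<in> bdd_borel D_space" for f
  proof -
    obtain B where B: "\<And>x. 0 < x \<Longrightarrow> \<bar>f x\<bar> \<le> B" using bdd_borel_D_bound[OF f] by auto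
    have "(\<integral>\<^sup>+z. \<integral>\<^sup>+y. ennreal \<bar>f y\<bar> \<partial>heat_kernel (r z) (x z) \<partial>L') \<le> (\<integral>\<^sup>+z. ennreal B \<partial>L')"
      by (intro nn_integral_mono e1[OF f B]) (auto simp: sL)
    also have "\<dots> = ennreal B * (\<integral>\<^sup>+z. ennreal (w z) \<partial>L)"
      by (simp add: L'_def emeasure_density cong: nn_integral_cong)
    also have "\<dots> < \<infinity>" using wnn by (simp add: ennreal_mult_less_top)
    finally show ?thesis .
  qed
  have "emeasure p (space p) = (\<integral>\<^sup>+z. \<integral>\<^sup>+y. ennreal \<bar>indicator {0<..} y\<bar> \<partial>heat_kernel (r z) (x z) \<partial>L')"
  proof -
    have "emeasure p (space p) = (\<integral>\<^sup>+z. emeasure (heat_kernel (r z) (x z)) {0<..} \<partial>L')"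
      unfolding p_def space_mixture space_D using sets.top[of D_space] by (intro emeasure_mixture[OF k]) simp
    also have "\<dots> = (\<integral>\<^sup>+z. \<integral>\<^sup>+y. ennreal \<bar>indicator {0<..} y\<bar> \<partial>heat_kernel (r z) (x z) \<partial>L')"
      using sets.top[of D_space] by (simp add: sets_heat_kernel ennreal_indicator)
    finally show ?thesis .
  qed
  also have "\<dots> < \<infinity>" using sets.top[of D_space] by (intro e2 indicator_bdd_borel) simp
  finally have pf: "p \<in> fin_meas D_space" by (auto simp: fin_meas_def p_def intro!: finite_measureI)
  show thesis
  proof (rule that[OF pf])
    fix f assume f: "f \<in> bdd_borel D_space"
    have fm: "f \<in> borel_measurable D_space" using f by (simp add: bdd_borel_def)
    have am: "(\<lambda>z. absP (r z) f (x z)) \<in> borel_measurable L" by (rule absP_measurable[OF f r x rx])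
    have cong: "(\<integral>y. f y \<partial>heat_kernel (r z) (x z)) = absP (r z) f (x z)" if "z \<in> space L'" for z
      using that rx by (intro integral_heat_kernel f) (auto simp: sL)
    have "integrable L' (\<lambda>z. absP (r z) f (x z))"
      using integrable_kernel_real[OF k fm e2[OF f]] by (simp add: cong cong: Bochner_Integration.integrable_cong)
    then show "integrable L (\<lambda>z. w z * absP (r z) f (x z))"
      unfolding L'_def using am w0 by (subst (asm) integrable_density) auto
    have "(\<integral>y. f y \<partial>p) = (\<integral>z. absP (r z) f (x z) \<partial>L')"
      unfolding p_def integral_mixture_real[OF k fm e2[OF f]] by (simp add: cong cong: Bochner_Integration.integral_cong)
    also have "\<dots> = (\<integral>z. w z * absP (r z) f (x z) \<partial>L)"
      unfolding L'_def using am w0 by (subst integral_density) auto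
    finally show "(\<integral>y. f y \<partial>p) = (\<integral>z. w z * absP (r z) f (x z) \<partial>L)" .
  qed
qed

section \<open>Poisson random measures\<close>

locale poisson_measure = prob_space M for M :: "'w measure" +
  fixes \<Lambda> :: "'e measure" and N :: "'w \<Rightarrow> 'e measure"
  assumes prm: "poisson_random_measure M \<Lambda> N"
begin

lemma kernel_N: "kernel_on M \<Lambda> N"
  using prm by (auto simp: poisson_random_measure_def kernel_on_def)

lemma sets_N: "\<omega> \<in> space M \<Longrightarrow> sets (N \<omega>) = sets \<Lambda>"
  using prm by (auto simp: poisson_random_measure_def)

lemma measurable_N: "\<omega> \<in> space M \<Longrightarrow> measurable (N \<omega>) F = measurable \<Lambda> F"
  by (intro measurable_cong_sets sets_N) auto

lemma space_N: "\<omega> \<in> space M \<Longrightarrow> space (N \<omega>) = space \<Lambda>"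
  by (intro sets_eq_imp_space_eq sets_N)

lemma emeasure_N_measurable [measurable]:
  "A \<in> sets \<Lambda> \<Longrightarrow> (\<lambda>\<omega>. emeasure (N \<omega>) A) \<in> borel_measurable M"
  using prm by (auto simp: poisson_random_measure_def)

context
  fixes A assumes A [measurable]: "A \<in> sets \<Lambda>" and fin: "emeasure \<Lambda> A < \<infinity>"
begin

definition level :: "nat \<Rightarrow> 'w set" where "level k = {\<omega> \<in> space M. emeasure (N \<omega>) A = of_nat k}"

lemma level_sets [measurable]: "level k \<in> sets M"
  unfolding level_def by measurable

lemma prob_level: "prob (level k) = exp (- measure \<Lambda> A) * measure \<Lambda> A ^ k / fact k"
  using prm A fin by (auto simp: poisson_random_measure_def level_def)

lemma level_disjoint: "\<omega> \<in> level k \<Longrightarrow> \<omega> \<in> level j \<longleftrightarrow> j = k"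
  by (auto simp: level_def)

text \<open>The Poisson weights sum to 1, which leaves no probability for infinite or fractional
  values of N(A).\<close>

lemma AE_level: "AE \<omega> in M. \<exists>k. \<omega> \<in> level k"
proof -
  have "(\<lambda>k. prob (level k)) sums prob (\<Union>k. level k)"
    by (rule finite_measure_UNION) (auto simp: disjoint_family_on_def level_def)
  moreover have "(\<lambda>k. prob (level k)) sums 1"
  proof -
    have "(\<lambda>k. exp (- measure \<Lambda> A) * (measure \<Lambda> A ^ k /\<^sub>R fact k)) sums (exp (- measure \<Lambda> A) * exp (measure \<Lambda> A))"
      by (intro sums_mult exp_converges)
    then show ?thesis by (simp add: prob_level scaleR_conv_of_real divide_simps mult_ac exp_minus)
  qed
  ultimately have "prob (\<Union>k. level k) = 1" by (rule sums_unique2)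
  then have "AE \<omega> in M. \<omega> \<in> (\<Union>k. level k)" by (subst (asm) prob_eq_1) auto
  then show ?thesis by simp
qed

lemma mean_finite: "(\<integral>\<^sup>+\<omega>. emeasure (N \<omega>) A \<partial>M) = emeasure \<Lambda> A"
proof -
  let ?l = "measure \<Lambda> A"
  have "(\<integral>\<^sup>+\<omega>. emeasure (N \<omega>) A \<partial>M) = (\<integral>\<^sup>+\<omega>. (\<Sum>k. ennreal (real k) * indicator (level k) \<omega>) \<partial>M)"
  proof (rule nn_integral_cong_AE)
    show "AE \<omega> in M. emeasure (N \<omega>) A = (\<Sum>k. ennreal (real k) * indicator (level k) \<omega>)"
      using AE_level
    proof eventually_elim
      case (elim \<omega>)
      then obtain k where k: "\<omega> \<in> level k" by auto
      have "(\<Sum>j. ennreal (real j) * indicator (level j) \<omega>) = (\<Sum>j\<in>{k}. ennreal (real j) * indicator (level j) \<omega>)"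
        by (rule suminf_finite) (use level_disjoint[OF k] in \<open>auto simp: indicator_def\<close>)
      also have "\<dots> = of_nat k" using k by (simp add: ennreal_of_nat_eq_real_of_nat)
      finally show ?case using k by (simp add: level_def)
    qed
  qed
  also have "\<dots> = (\<Sum>k. ennreal (real k * prob (level k)))"
    by (subst nn_integral_suminf) (auto simp: nn_integral_cmult emeasure_eq_measure ennreal_mult)
  also have "\<dots> = ennreal ?l"
  proof (rule suminf_ennreal_eq)
    \<comment> \<open>By k l^k / k! = l l^(k-1) / (k-1)! the series for the mean is l times the
      exponential series with its index shifted by one.\<close>
    have "(\<lambda>k. exp (- ?l) * (?l * (?l ^ k /\<^sub>R fact k))) sums (exp (- ?l) * (?l * exp ?l))"
      by (intro sums_mult exp_converges)
    then have "(\<lambda>k. real (Suc k) * prob (level (Suc k))) sums ?l"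
      by (simp add: prob_level scaleR_conv_of_real divide_simps mult_ac exp_minus del: of_nat_Suc)
    then show "(\<lambda>k. real k * prob (level k)) sums ?l"
      by (subst (asm) sums_Suc_iff) simp
  qed simp
  also have "\<dots> = emeasure \<Lambda> A" using fin by (simp add: emeasure_eq_ennreal_measure less_top)
  finally show ?thesis .
qed

lemma char_count:
  "(CLINT \<omega>|M. iexp (c * enn2real (emeasure (N \<omega>) A))) = exp (complex_of_real (measure \<Lambda> A) * (iexp c - 1))"
proof -
  let ?l = "measure \<Lambda> A"
  define f where "f k \<omega> = indicator (level k) \<omega> *\<^sub>R iexp (c * real k)" for k \<omega>
  have i: "integrable M (f k)" for k
    unfolding f_def using integrable_real_indicator[of "level k" M] by (intro integrable_scaleR_left) (auto simp: less_top[symmetric])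
  have I: "(CLINT \<omega>|M. f k \<omega>) = prob (level k) *\<^sub>R iexp (c * real k)" for k
    unfolding f_def by (subst integral_scaleR_left) (auto intro: integrable_real_indicator simp: less_top[symmetric])
  have S: "f k \<omega> = iexp (c * enn2real (emeasure (N \<omega>) A))" "\<And>j. j \<noteq> k \<Longrightarrow> f j \<omega> = 0" if "\<omega> \<in> level k" for k \<omega>
    using that level_disjoint[OF that] by (auto simp: f_def level_def)
  have e: "AE \<omega> in M. (\<lambda>k. f k \<omega>) sums iexp (c * enn2real (emeasure (N \<omega>) A)) \<and> summable (\<lambda>k. norm (f k \<omega>))"
    using AE_level
  proof eventually_elim
    case (elim \<omega>)
    then obtain k where k: "\<omega> \<in> level k" by auto
    have "(\<lambda>j. f j \<omega>) sums (\<Sum>j\<in>{k}. f j \<omega>)" by (rule sums_finite) (use S[OF k] in auto)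
    moreover have "summable (\<lambda>j. norm (f j \<omega>))" by (rule summable_finite[of "{k}"]) (use S[OF k] in auto)
    ultimately show ?case using S(1)[OF k] by simp
  qed
  have n: "(\<integral>\<omega>. norm (f k \<omega>) \<partial>M) = prob (level k)" for k
  proof -
    have "(\<integral>\<omega>. norm (f k \<omega>) \<partial>M) = (\<integral>\<omega>. indicator (level k) \<omega> \<partial>M)"
      by (intro Bochner_Integration.integral_cong) (auto simp: f_def)
    then show ?thesis by (simp add: level_def)
  qed
  have "summable (\<lambda>k. prob (level k))"
    by (rule sums_summable[OF finite_measure_UNION]) (auto simp: disjoint_family_on_def level_def)
  then have "(\<lambda>k. CLINT \<omega>|M. f k \<omega>) sums (CLINT \<omega>|M. (\<Sum>k. f k \<omega>))"
    using e by (intro sums_integral i) (auto simp: n elim: eventually_mono)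
  also have "(CLINT \<omega>|M. (\<Sum>k. f k \<omega>)) = (CLINT \<omega>|M. iexp (c * enn2real (emeasure (N \<omega>) A)))"
  proof (rule integral_cong_AE)
    show "AE \<omega> in M. (\<Sum>k. f k \<omega>) = iexp (c * enn2real (emeasure (N \<omega>) A))"
      using e by eventually_elim (auto dest: sums_unique)
    have "f k \<in> borel_measurable M" for k using i[of k] by auto
    then show "(\<lambda>\<omega>. \<Sum>k. f k \<omega>) \<in> borel_measurable M" by measurable
  qed measurable
  finally have 1: "(\<lambda>k. prob (level k) *\<^sub>R iexp (c * real k)) sums (CLINT \<omega>|M. iexp (c * enn2real (emeasure (N \<omega>) A)))"
    by (simp add: I)
  have "(\<lambda>k. complex_of_real (exp (- ?l)) * ((complex_of_real ?l * iexp c) ^ k /\<^sub>R fact k)) sums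
      (complex_of_real (exp (- ?l)) * exp (complex_of_real ?l * iexp c))"
    by (intro sums_mult exp_converges)
  moreover have "complex_of_real (exp (- ?l)) * ((complex_of_real ?l * iexp c) ^ k /\<^sub>R fact k) = prob (level k) *\<^sub>R iexp (c * real k)" for k
    by (simp add: prob_level scaleR_conv_of_real power_mult_distrib exp_of_nat_mult[symmetric] field_simps)
  ultimately have "(\<lambda>k. prob (level k) *\<^sub>R iexp (c * real k)) sums (complex_of_real (exp (- ?l)) * exp (complex_of_real ?l * iexp c))"
    by simp
  from sums_unique2[OF 1 this]
  have "(CLINT \<omega>|M. iexp (c * enn2real (emeasure (N \<omega>) A))) = complex_of_real (exp (- ?l)) * exp (complex_of_real ?l * iexp c)" .
  also have "complex_of_real (exp (- ?l)) * exp (complex_of_real ?l * iexp c) = exp (complex_of_real ?l * (iexp c - 1))"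
    unfolding exp_of_real[symmetric] exp_add[symmetric] by (simp add: algebra_simps)
  finally show ?thesis .
qed

end

section \<open>Campbell's formula and the characteristic functional\<close>

lemma mean_N: assumes A: "A \<in> sets \<Lambda>" shows "(\<integral>\<^sup>+\<omega>. emeasure (N \<omega>) A \<partial>M) = emeasure \<Lambda> A"
proof (cases "emeasure \<Lambda> A < \<infinity>")
  case True then show ?thesis by (rule mean_finite[OF A])
next
  case False
  then have "emeasure \<Lambda> A = \<infinity>" by (simp add: less_top[symmetric])
  then have "AE \<omega> in M. emeasure (N \<omega>) A = \<infinity>" using prm A by (auto simp: poisson_random_measure_def)
  then have "(\<integral>\<^sup>+\<omega>. emeasure (N \<omega>) A \<partial>M) = (\<integral>\<^sup>+\<omega>. \<infinity> \<partial>M)" by (rule nn_integral_cong_AE)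
  then show ?thesis using \<open>emeasure \<Lambda> A = \<infinity>\<close> by (simp add: emeasure_space_1)
qed

text \<open>Averaging N over M gives \<Lambda> itself, so this is the formula for integrals against
  a mixture.\<close>

lemma nn_integral_mean:
  assumes f: "f \<in> borel_measurable \<Lambda>"
  shows "(\<integral>\<^sup>+\<omega>. \<integral>\<^sup>+z. f z \<partial>N \<omega> \<partial>M) = (\<integral>\<^sup>+z. f z \<partial>\<Lambda>)"
proof -
  have "mixture M N \<Lambda> = \<Lambda>"
    by (rule measure_eqI) (auto simp: emeasure_mixture[OF kernel_N] mean_N)
  then show ?thesis using nn_integral_mixture[OF kernel_N f] by simp
qed

lemma AE_integrable_N:
  fixes g :: "'e \<Rightarrow> real"
  assumes g: "integrable \<Lambda> g" shows "AE \<omega> in M. integrable (N \<omega>) g"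
proof -
  have [measurable]: "g \<in> borel_measurable \<Lambda>" using g by auto
  have "(\<integral>\<^sup>+\<omega>. \<integral>\<^sup>+z. ennreal \<bar>g z\<bar> \<partial>N \<omega> \<partial>M) \<noteq> \<infinity>"
    using g by (subst nn_integral_mean) (auto simp: integrable_iff_bounded)
  then have "AE \<omega> in M. (\<integral>\<^sup>+z. ennreal \<bar>g z\<bar> \<partial>N \<omega>) \<noteq> \<infinity>"
    by (intro nn_integral_PInf_AE nn_integral_kernel_measurable[OF kernel_N]) measurable
  then show ?thesis
    using AE_space by eventually_elim (auto simp: integrable_iff_bounded measurable_N top.not_eq_extremum)
qed

lemma char_simple:
  fixes s :: "'e \<Rightarrow> real"
  assumes s: "simple_function \<Lambda> s" and fin: "emeasure \<Lambda> {z \<in> space \<Lambda>. s z \<noteq> 0} \<noteq> \<infinity>"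
  shows "(CLINT \<omega>|M. iexp (\<integral>z. s z \<partial>N \<omega>)) = exp (CLINT z|\<Lambda>. iexp (s z) - 1)"
proof -
  define C where "C = s ` space \<Lambda> - {0}"
  have C: "finite C" using s by (simp add: C_def simple_function_def)
  obtain h where h: "bij_betw h {0..<card C} C" using ex_bij_betw_nat_finite[OF C] by auto
  let ?n = "card C"
  \<comment> \<open>Padded with empty sets, because independence of the counts is given for infinite
    disjoint sequences.\<close>
  define A where "A i = (if i < ?n then s -` {h i} \<inter> space \<Lambda> else {})" for i
  have hC: "h i \<in> C" if "i < ?n" for i using h that by (auto simp: bij_betw_def)
  have A [measurable]: "A i \<in> sets \<Lambda>" for i using simple_functionD(2)[OF s] by (simp add: A_def)
  have "A i \<subseteq> {z \<in> space \<Lambda>. s z \<noteq> 0}" for i using hC[of i] by (auto simp: A_def C_def)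
  moreover have "{z \<in> space \<Lambda>. s z \<noteq> 0} \<in> sets \<Lambda>" using borel_measurable_simple_function[OF s] by measurable
  ultimately have Afin: "emeasure \<Lambda> (A i) < \<infinity>" for i
    using fin emeasure_mono[of "A i"] by (metis infinity_ennreal_def le_less_trans top.not_eq_extremum)
  have disj: "disjoint_family A"
    using h by (auto simp: disjoint_family_on_def A_def bij_betw_def inj_on_def)
  \<comment> \<open>Used with G the identity for the integral of s, and with G(y) = e^{iy} - 1 for
    the exponent; both vanish at 0.\<close>
  have rep: "G (s z) = (\<Sum>i<?n. indicator (A i) z *\<^sub>R G (h i))" if "z \<in> space \<Lambda>" "G 0 = 0"
    for z and G :: "real \<Rightarrow> 'b::real_vector"
  proof (cases "s z = 0")
    case True
    then have "indicator (A i) z *\<^sub>R G (h i) = 0" if "i < ?n" for i using hC[OF that] that by (auto simp: A_def C_def)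
    then have "(\<Sum>i<?n. indicator (A i) z *\<^sub>R G (h i)) = 0" by (intro sum.neutral) blast
    then show ?thesis using True that by simp
  next
    case False
    then have "s z \<in> C" using that by (auto simp: C_def)
    then have "s z \<in> h ` {0..<?n}" using h by (simp add: bij_betw_def)
    then obtain i where i: "i < ?n" "h i = s z" by auto
    have "(\<Sum>j<?n. indicator (A j) z *\<^sub>R G (h j)) = (\<Sum>j\<in>{i}. indicator (A j) z *\<^sub>R G (h j))"
    proof (rule sum.mono_neutral_right)
      show "\<forall>j\<in>{..<?n} - {i}. indicator (A j) z *\<^sub>R G (h j) = 0"
        using i h that by (auto simp: A_def bij_betw_def inj_on_def indicator_def)
    qed (use i in auto)
    then show ?thesis using i that by (simp add: A_def)
  qed
  define X where "X i \<omega> = enn2real (emeasure (N \<omega>) (A i))" for i \<omega>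
  have "AE \<omega> in M. \<forall>i. emeasure (N \<omega>) (A i) < \<infinity>"
  proof (subst AE_all_countable, intro allI)
    fix i show "AE \<omega> in M. emeasure (N \<omega>) (A i) < \<infinity>"
      using AE_level[OF A Afin, of i] by eventually_elim (auto simp: level_def[OF A Afin] of_nat_less_top)
  qed
  then have int: "AE \<omega> in M. (\<integral>z. s z \<partial>N \<omega>) = (\<Sum>i<?n. h i * X i \<omega>)"
    using AE_space
  proof eventually_elim
    case (elim \<omega>)
    have "(\<integral>z. s z \<partial>N \<omega>) = (\<integral>z. (\<Sum>i<?n. indicator (A i) z *\<^sub>R h i) \<partial>N \<omega>)"
      using rep[of _ "\<lambda>x. x"] space_N[OF elim(2)] by (intro Bochner_Integration.integral_cong) auto
    also have "\<dots> = (\<Sum>i<?n. \<integral>z. indicator (A i) z *\<^sub>R h i \<partial>N \<omega>)"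
      using elim A by (intro Bochner_Integration.integral_sum integrable_scaleR_left) (auto simp: sets_N intro!: integrable_real_indicator)
    also have "\<dots> = (\<Sum>i<?n. h i * X i \<omega>)"
    proof (intro sum.cong refl)
      fix i
      have "A i \<inter> space (N \<omega>) = A i" using sets.sets_into_space[OF A, of i] space_N[OF elim(2)] by auto
      then show "(\<integral>z. indicator (A i) z *\<^sub>R h i \<partial>N \<omega>) = h i * X i \<omega>"
        by (simp add: X_def measure_def)
    qed
    finally show ?case .
  qed
  have Xm [measurable]: "X i \<in> borel_measurable M" for i unfolding X_def by measurable
  have sm: "s \<in> borel_measurable \<Lambda>" by (rule borel_measurable_simple_function[OF s])
  have [measurable]: "(\<lambda>\<omega>. \<integral>z. s z \<partial>N \<omega>) \<in> borel_measurable M" by (rule integral_kernel_measurable[OF kernel_N sm])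
  have ind: "indep_vars (\<lambda>_. borel) (\<lambda>i \<omega>. emeasure (N \<omega>) (A i)) UNIV"
  proof -
    have "range A \<subseteq> sets \<Lambda>" using A by auto
    then show ?thesis using prm disj unfolding poisson_random_measure_def by blast
  qed
  have "indep_vars (\<lambda>_. borel) (\<lambda>i \<omega>. iexp (h i * X i \<omega>)) UNIV"
    unfolding X_def by (rule indep_vars_compose2[OF ind, where Y = "\<lambda>i x. iexp (h i * enn2real x)"]) measurable
  then have ind2: "indep_vars (\<lambda>_. borel) (\<lambda>i \<omega>. iexp (h i * X i \<omega>)) {..<?n}"
    by (rule indep_vars_subset) simp
  have "(CLINT \<omega>|M. iexp (\<integral>z. s z \<partial>N \<omega>)) = (CLINT \<omega>|M. (\<Prod>i<?n. iexp (h i * X i \<omega>)))"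
    using int by (intro integral_cong_AE) (auto simp: exp_sum sum_distrib_left elim!: eventually_mono)
  also have "\<dots> = (\<Prod>i<?n. CLINT \<omega>|M. iexp (h i * X i \<omega>))"
    by (rule indep_vars_lebesgue_integral[OF _ ind2]) (auto intro!: integrable_const_bound[where B = 1])
  also have "\<dots> = (\<Prod>i<?n. exp (complex_of_real (measure \<Lambda> (A i)) * (iexp (h i) - 1)))"
    unfolding X_def by (intro prod.cong refl char_count A Afin)
  also have "\<dots> = exp (\<Sum>i<?n. measure \<Lambda> (A i) *\<^sub>R (iexp (h i) - 1))"
    by (simp add: exp_sum scaleR_conv_of_real)
  also have "(\<Sum>i<?n. measure \<Lambda> (A i) *\<^sub>R (iexp (h i) - 1)) = (\<Sum>i<?n. CLINT z|\<Lambda>. indicator (A i) z *\<^sub>R (iexp (h i) - 1))"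
  proof (intro sum.cong refl)
    fix i
    have "A i \<inter> space \<Lambda> = A i" using sets.sets_into_space[OF A, of i] by auto
    then show "measure \<Lambda> (A i) *\<^sub>R (iexp (h i) - 1) = (CLINT z|\<Lambda>. indicator (A i) z *\<^sub>R (iexp (h i) - 1))"
      using Afin[of i] A[of i] by (subst integral_scaleR_left) (auto intro!: integrable_real_indicator)
  qed
  also have "\<dots> = (CLINT z|\<Lambda>. \<Sum>i<?n. indicator (A i) z *\<^sub>R (iexp (h i) - 1))"
    using Afin A by (intro Bochner_Integration.integral_sum[symmetric] integrable_scaleR_left) (auto intro!: integrable_real_indicator)
  also have "\<dots> = (CLINT z|\<Lambda>. iexp (s z) - 1)"
    by (intro Bochner_Integration.integral_cong refl rep[of _ "\<lambda>x. iexp x - 1", symmetric]) auto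
  finally show ?thesis .
qed

lemma norm_iexp_minus_one: "cmod (iexp x - 1) \<le> \<bar>x\<bar>"
  using iexp_approx1[of x 0] by simp

text \<open>Simple functions bounded by 2|g| converge to g. On the probability side the transforms
  have modulus 1 and the inner integrals converge for almost every realisation of N; in the exponent
  |e^{ix} - 1| is at most |x|, so that 2|g| is an integrable bound.\<close>

theorem poisson_char:
  fixes g :: "'e \<Rightarrow> real"
  assumes g: "integrable \<Lambda> g"
  shows "(CLINT \<omega>|M. iexp (\<integral>z. g z \<partial>N \<omega>)) = exp (CLINT z|\<Lambda>. iexp (g z) - 1)"
proof -
  have gm [measurable]: "g \<in> borel_measurable \<Lambda>" using g by auto
  obtain s where s: "\<And>i. simple_function \<Lambda> (s i)" "\<And>i. emeasure \<Lambda> {y\<in>space \<Lambda>. s i y \<noteq> 0} \<noteq> \<infinity>"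
    and lim: "\<And>x. x \<in> space \<Lambda> \<Longrightarrow> (\<lambda>i. s i x) \<longlonglongrightarrow> g x"
    and bd: "\<And>x i. x \<in> space \<Lambda> \<Longrightarrow> norm (s i x) \<le> 2 * norm (g x)"
    by (rule integrable_implies_simple_function_sequence[OF g]) (rule that)
  have sm [measurable]: "s i \<in> borel_measurable \<Lambda>" for i by (rule borel_measurable_simple_function[OF s(1)])
  note km = integral_kernel_measurable[OF kernel_N]
  have [measurable]: "(\<lambda>\<omega>. \<integral>z. g z \<partial>N \<omega>) \<in> borel_measurable M" "(\<lambda>\<omega>. \<integral>z. s i z \<partial>N \<omega>) \<in> borel_measurable M" for i
    by (rule km[OF gm], rule km[OF sm])
  have "(\<lambda>i. CLINT \<omega>|M. iexp (\<integral>z. s i z \<partial>N \<omega>)) \<longlonglongrightarrow> (CLINT \<omega>|M. iexp (\<integral>z. g z \<partial>N \<omega>))"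
  proof (rule integral_dominated_convergence[where w = "\<lambda>_. 1"])
    show "AE \<omega> in M. (\<lambda>i. iexp (\<integral>z. s i z \<partial>N \<omega>)) \<longlonglongrightarrow> iexp (\<integral>z. g z \<partial>N \<omega>)"
      using AE_integrable_N[OF g] AE_space
    proof eventually_elim
      case (elim \<omega>)
      have "(\<lambda>i. \<integral>z. s i z \<partial>N \<omega>) \<longlonglongrightarrow> (\<integral>z. g z \<partial>N \<omega>)"
        by (rule integral_dominated_convergence[where w = "\<lambda>z. 2 * norm (g z)"])
          (use elim lim bd in \<open>auto simp: measurable_N space_N\<close>)
      then show ?case by (intro tendsto_intros)
    qed
  qed auto
  moreover have "(\<lambda>i. CLINT \<omega>|M. iexp (\<integral>z. s i z \<partial>N \<omega>)) \<longlonglongrightarrow> exp (CLINT z|\<Lambda>. iexp (g z) - 1)"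
    unfolding char_simple[OF s]
  proof (intro tendsto_exp integral_dominated_convergence[where w = "\<lambda>z. 2 * norm (g z)"])
    show "AE z in \<Lambda>. (\<lambda>i. iexp (s i z) - 1) \<longlonglongrightarrow> iexp (g z) - 1"
      by (intro AE_I2 tendsto_intros lim)
    show "AE z in \<Lambda>. cmod (iexp (s i z) - 1) \<le> 2 * norm (g z)" for i
      using bd[of _ i] norm_iexp_minus_one by (intro AE_I2) (metis order_trans real_norm_def)
  qed (use g in auto)
  ultimately show ?thesis by (rule LIMSEQ_unique)
qed

end

section \<open>The intensity of the jumps\<close>

lemma space_R0 [simp]: "space R0_space = - {0}" by (simp add: R0_space_def space_restrict_space)

lemma space_SUX: "space SUX_space = {0..} \<times> (- {0}) \<times> {0<..}"
  by (simp add: SUX_space_def space_pair_measure space_restrict_space)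

lemma measurable_R0_id [measurable]: "(\<lambda>u. u) \<in> borel_measurable R0_space"
  unfolding R0_space_def by (rule measurable_restrict_space1) simp

lemma measurable_D_id [measurable]: "(\<lambda>x. x) \<in> borel_measurable D_space"
  unfolding D_space_def by (rule measurable_restrict_space1) simp

lemma measurable_SUX_time [measurable]: "(\<lambda>z. fst z) \<in> borel_measurable SUX_space"
proof -
  have "(\<lambda>s. s) \<in> borel_measurable (restrict_space borel {0::real..})" by (rule measurable_restrict_space1) simp
  from measurable_compose[OF measurable_fst this] show ?thesis by (simp add: SUX_space_def)
qed

lemma measurable_SUX_jump [measurable]: "(\<lambda>z. fst (snd z)) \<in> borel_measurable SUX_space"
  unfolding SUX_space_def by (intro measurable_compose[OF _ measurable_R0_id]) measurable

lemma measurable_SUX_position [measurable]: "(\<lambda>z. snd (snd z)) \<in> borel_measurable SUX_space"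
  unfolding SUX_space_def by (intro measurable_compose[OF _ measurable_D_id]) measurable

definition half_line :: "real measure" where "half_line = restrict_space lborel {0..}"

lemma space_half_line [simp]: "space half_line = {0..}" by (simp add: half_line_def space_restrict_space)

lemma sets_half_line: "sets half_line = sets (restrict_space borel {0..})"
  by (simp add: half_line_def sets_restrict_space)

lemma sigma_finite_half_line: "sigma_finite_measure half_line"
  unfolding half_line_def by (intro sigma_finite_measure_restrict_space lborel.sigma_finite_measure_axioms) simp

lemma measurable_point [measurable]:
  assumes "s \<in> L \<rightarrow>\<^sub>M half_line" "u \<in> L \<rightarrow>\<^sub>M R0_space" "x \<in> L \<rightarrow>\<^sub>M D_space"
  shows "(\<lambda>w. (s w, u w, x w)) \<in> L \<rightarrow>\<^sub>M SUX_space"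
  using assms unfolding SUX_space_def by (simp add: sets_half_line cong: measurable_cong_sets)

lemma indicator_upto_time: "indicator (upto_time T) z = (indicator {..T} (fst z) :: 'a::zero_neq_one)"
  by (cases z) (auto simp: upto_time_def indicator_def)

locale driving =
  fixes \<eta> :: "real measure" and m :: "real \<Rightarrow> real measure"
  assumes sets_eta [measurable_cong]: "sets \<eta> = sets D_space" and fin_eta: "finite_measure \<eta>"
    and ker: "kernel_on D_space R0_space m"
    and mom: "(SUP x\<in>{0<..}. \<integral>\<^sup>+u. ennreal \<bar>u\<bar> \<partial>m x) < \<infinity>"
begin

abbreviation "\<Lambda> \<equiv> intensity m \<eta>"

sublocale eta: finite_measure \<eta> by (rule fin_eta)

lemma space_eta [simp]: "space \<eta> = {0<..}" using sets_eq_imp_space_eq[OF sets_eta] by simp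

lemma sets_m: "0 < x \<Longrightarrow> sets (m x) = sets R0_space" using ker by (simp add: kernel_on_def)

lemma space_m: "0 < x \<Longrightarrow> space (m x) = - {0}" using sets_eq_imp_space_eq[OF sets_m] by simp

lemma measurable_m: "0 < x \<Longrightarrow> measurable (m x) F = measurable R0_space F"
  by (intro measurable_cong_sets sets_m) auto

text \<open>The added 1 makes the constant strictly positive, so that it can be divided by even if m
  vanishes.\<close>

definition moment_bound :: real where "moment_bound = enn2real (SUP x\<in>{0<..}. \<integral>\<^sup>+u. ennreal \<bar>u\<bar> \<partial>m x) + 1"

lemma moment_bound_pos: "0 < moment_bound" by (simp add: moment_bound_def add_nonneg_pos)

lemma moment_le: "0 < x \<Longrightarrow> (\<integral>\<^sup>+u. ennreal \<bar>u\<bar> \<partial>m x) \<le> ennreal moment_bound"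
proof -
  assume x: "0 < x"
  have "(\<integral>\<^sup>+u. ennreal \<bar>u\<bar> \<partial>m x) \<le> (SUP x\<in>{0<..}. \<integral>\<^sup>+u. ennreal \<bar>u\<bar> \<partial>m x)"
    by (rule SUP_upper) (use x in simp)
  also have "\<dots> = ennreal (enn2real (SUP x\<in>{0<..}. \<integral>\<^sup>+u. ennreal \<bar>u\<bar> \<partial>m x))"
    using mom by simp
  also have "\<dots> \<le> ennreal moment_bound" by (intro ennreal_leI) (simp add: moment_bound_def)
  finally show ?thesis .
qed

text \<open>The kernel \<open>m\<close> may be infinite near \<open>u = 0\<close>; \<open>|u| m(x,du)\<close>, normalised, is a sub-probability kernel.\<close>

definition m' :: "real \<Rightarrow> real measure" where "m' x = density (m x) (\<lambda>u. ennreal (\<bar>u\<bar> / moment_bound))"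

lemma m'_kernel: "m' \<in> D_space \<rightarrow>\<^sub>M subprob_algebra R0_space"
proof (rule measurable_subprob_algebra)
  fix x assume "x \<in> space D_space"
  then have x: "0 < x" by simp
  show "sets (m' x) = sets R0_space" using sets_m[OF x] by (simp add: m'_def)
  have "emeasure (m' x) (space (m' x)) = (\<integral>\<^sup>+u. ennreal (\<bar>u\<bar> / moment_bound) \<partial>m x)"
    unfolding m'_def by (subst emeasure_density) (auto simp: measurable_m[OF x] intro!: nn_integral_cong)
  also have "\<dots> = (\<integral>\<^sup>+u. ennreal (1 / moment_bound) * ennreal \<bar>u\<bar> \<partial>m x)"
    using moment_bound_pos by (intro nn_integral_cong) (simp add: ennreal_mult[symmetric])
  also have "\<dots> = ennreal (1 / moment_bound) * (\<integral>\<^sup>+u. ennreal \<bar>u\<bar> \<partial>m x)"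
    by (intro nn_integral_cmult) (simp add: measurable_m[OF x])
  also have "\<dots> \<le> ennreal (1 / moment_bound) * ennreal moment_bound"
    by (intro mult_left_mono moment_le x) simp
  also have "\<dots> = 1" using moment_bound_pos by (simp add: ennreal_mult[symmetric])
  finally show "subprob_space (m' x)"
    by (intro subprob_spaceI) (auto simp: m'_def space_m[OF x] intro: exI[of _ 1])
next
  fix A assume A [measurable]: "A \<in> sets R0_space"
  show "(\<lambda>x. emeasure (m' x) A) \<in> borel_measurable D_space"
  proof (rule measurable_cong[THEN iffD2])
    show "emeasure (m' x) A = (\<integral>\<^sup>+u. ennreal (\<bar>u\<bar> / moment_bound) * indicator A u \<partial>m x)" if "x \<in> space D_space" for x
      unfolding m'_def using that A by (intro emeasure_density) (auto simp: measurable_m sets_m)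
    show "(\<lambda>x. \<integral>\<^sup>+u. ennreal (\<bar>u\<bar> / moment_bound) * indicator A u \<partial>m x) \<in> borel_measurable D_space"
      by (rule nn_integral_kernel_measurable[OF ker]) measurable
  qed
qed

text \<open>Jumps are nonzero, so m is recovered from \<open>m'\<close> by the weight
  \<open>moment_bound\<close> / |u|. Through this formula joint measurability and the exchange of
  integrals pass from subprobability kernels to m.\<close>

lemma nn_integral_m:
  assumes x: "0 < x" and h: "h \<in> borel_measurable R0_space"
  shows "(\<integral>\<^sup>+u. h u \<partial>m x) = (\<integral>\<^sup>+u. ennreal (moment_bound / \<bar>u\<bar>) * h u \<partial>m' x)"
proof -
  have "(\<integral>\<^sup>+u. ennreal (moment_bound / \<bar>u\<bar>) * h u \<partial>m' x) = (\<integral>\<^sup>+u. ennreal (\<bar>u\<bar> / moment_bound) * (ennreal (moment_bound / \<bar>u\<bar>) * h u) \<partial>m x)"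
    unfolding m'_def using h by (intro nn_integral_density) (auto simp: measurable_m[OF x])
  also have "\<dots> = (\<integral>\<^sup>+u. h u \<partial>m x)"
  proof (intro nn_integral_cong)
    fix u assume "u \<in> space (m x)"
    then have "u \<noteq> 0" using space_m[OF x] by simp
    then have "ennreal (\<bar>u\<bar> / moment_bound) * ennreal (moment_bound / \<bar>u\<bar>) = 1" using moment_bound_pos by (simp add: ennreal_mult[symmetric])
    then show "ennreal (\<bar>u\<bar> / moment_bound) * (ennreal (moment_bound / \<bar>u\<bar>) * h u) = h u" by (simp flip: mult.assoc)
  qed
  finally show ?thesis ..
qed

lemma nn_integral_m_measurable:
  assumes h: "case_prod h \<in> borel_measurable (L \<Otimes>\<^sub>M R0_space)" and x: "x \<in> L \<rightarrow>\<^sub>M D_space"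
  shows "(\<lambda>w. \<integral>\<^sup>+u. h w u \<partial>m (x w)) \<in> borel_measurable L"
proof (rule measurable_cong[THEN iffD2])
  show "(\<integral>\<^sup>+u. h w u \<partial>m (x w)) = (\<integral>\<^sup>+u. ennreal (moment_bound / \<bar>u\<bar>) * h w u \<partial>m' (x w))" if "w \<in> space L" for w
    using measurable_space[OF x that] measurable_Pair2[OF h that] by (intro nn_integral_m) auto
  note h [measurable]
  have "(\<lambda>(w, u). ennreal (moment_bound / \<bar>u\<bar>) * h w u) \<in> borel_measurable (L \<Otimes>\<^sub>M R0_space)" by measurable
  then show "(\<lambda>w. \<integral>\<^sup>+u. ennreal (moment_bound / \<bar>u\<bar>) * h w u \<partial>m' (x w)) \<in> borel_measurable L"
    by (rule nn_integral_measurable_subprob_algebra2) (rule measurable_compose[OF x m'_kernel])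
qed

lemma nn_integral_m_swap:
  assumes x: "0 < x" and h: "case_prod h \<in> borel_measurable (half_line \<Otimes>\<^sub>M R0_space)"
  shows "(\<integral>\<^sup>+u. \<integral>\<^sup>+s. h s u \<partial>half_line \<partial>m x) = (\<integral>\<^sup>+s. \<integral>\<^sup>+u. h s u \<partial>m x \<partial>half_line)"
proof -
  interpret H: sigma_finite_measure half_line by (rule sigma_finite_half_line)
  have xD: "x \<in> space D_space" using x by simp
  interpret mx: subprob_space "m' x" by (rule subprob_space_kernel[OF m'_kernel xD])
  have sm: "sets (m' x) = sets R0_space" by (rule sets_kernel[OF m'_kernel xD])
  interpret P: pair_sigma_finite half_line "m' x" ..
  note h [measurable] sm [measurable_cong]
  have hs: "(\<lambda>s. h s u) \<in> borel_measurable half_line" if "u \<noteq> 0" for u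
    using measurable_Pair1[OF h, of u] that by simp
  have hu: "h s \<in> borel_measurable R0_space" if "0 \<le> s" for s
    using measurable_Pair2[OF h, of s] that by simp
  have "(\<integral>\<^sup>+u. \<integral>\<^sup>+s. h s u \<partial>half_line \<partial>m x) = (\<integral>\<^sup>+u. ennreal (moment_bound / \<bar>u\<bar>) * (\<integral>\<^sup>+s. h s u \<partial>half_line) \<partial>m' x)"
    by (rule nn_integral_m[OF x]) measurable
  also have "\<dots> = (\<integral>\<^sup>+u. \<integral>\<^sup>+s. ennreal (moment_bound / \<bar>u\<bar>) * h s u \<partial>half_line \<partial>m' x)"
    using sets_eq_imp_space_eq[OF sm] by (intro nn_integral_cong nn_integral_cmult[symmetric] hs) auto
  also have "\<dots> = (\<integral>\<^sup>+s. \<integral>\<^sup>+u. ennreal (moment_bound / \<bar>u\<bar>) * h s u \<partial>m' x \<partial>half_line)"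
    by (rule P.Fubini') measurable
  also have "\<dots> = (\<integral>\<^sup>+s. \<integral>\<^sup>+u. h s u \<partial>m x \<partial>half_line)"
    by (intro nn_integral_cong nn_integral_m[OF x, symmetric] hu) auto
  finally show ?thesis .
qed

text \<open>The jumps at time s and site x, placed on the corresponding fibre of the space of points
  (s, u, x); \<Lambda> is the mixture of these over \<eta> and then over time.\<close>

definition slice :: "real \<Rightarrow> real \<Rightarrow> (real \<times> real \<times> real) measure" where
  "slice s x = distr (m x) SUX_space (\<lambda>u. (s, u, x))"

lemma measurable_embed: "0 \<le> s \<Longrightarrow> 0 < x \<Longrightarrow> (\<lambda>u. (s, u, x)) \<in> m x \<rightarrow>\<^sub>M SUX_space"
  by (simp add: measurable_m)

lemma measurable_joint:
  assumes f: "f \<in> borel_measurable SUX_space"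
  shows "(\<lambda>((s, x), u). f (s, u, x)) \<in> borel_measurable ((half_line \<Otimes>\<^sub>M D_space) \<Otimes>\<^sub>M R0_space)"
proof -
  have "(\<lambda>w. (fst (fst w), snd w, snd (fst w))) \<in> (half_line \<Otimes>\<^sub>M D_space) \<Otimes>\<^sub>M R0_space \<rightarrow>\<^sub>M SUX_space"
    by measurable
  from measurable_compose[OF this f] show ?thesis by (simp add: case_prod_beta')
qed

lemma nn_integral_m_joint:
  assumes f: "f \<in> borel_measurable SUX_space"
  shows "(\<lambda>(s, x). \<integral>\<^sup>+u. f (s, u, x) \<partial>m x) \<in> borel_measurable (half_line \<Otimes>\<^sub>M D_space)"
  using nn_integral_m_measurable[of "\<lambda>(s, x) u. f (s, u, x)" "half_line \<Otimes>\<^sub>M D_space" snd] measurable_joint[OF f]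
  by (simp add: case_prod_beta')

lemma nn_integral_slice:
  assumes "0 \<le> s" "0 < x" "f \<in> borel_measurable SUX_space"
  shows "(\<integral>\<^sup>+z. f z \<partial>slice s x) = (\<integral>\<^sup>+u. f (s, u, x) \<partial>m x)"
  unfolding slice_def using assms by (intro nn_integral_distr measurable_embed) auto

lemma emeasure_slice:
  assumes "0 \<le> s" "0 < x" "C \<in> sets SUX_space"
  shows "emeasure (slice s x) C = (\<integral>\<^sup>+u. indicator C (s, u, x) \<partial>m x)"
proof -
  have "emeasure (slice s x) C = (\<integral>\<^sup>+z. indicator C z \<partial>slice s x)" using assms by (simp add: slice_def)
  then show ?thesis using nn_integral_slice[OF assms(1,2), of "indicator C"] assms by simp
qed

lemma kernel_slice: assumes s: "0 \<le> s" shows "kernel_on \<eta> SUX_space (slice s)"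
  unfolding kernel_on_def
proof (intro conjI ballI)
  fix C assume C: "C \<in> sets SUX_space"
  show "(\<lambda>x. emeasure (slice s x) C) \<in> borel_measurable \<eta>"
  proof (rule measurable_cong[THEN iffD2])
    show "emeasure (slice s x) C = (\<integral>\<^sup>+u. indicator C (s, u, x) \<partial>m x)" if "x \<in> space \<eta>" for x
      using that s C by (intro emeasure_slice) auto
    have "(\<lambda>x. \<integral>\<^sup>+u. indicator C (s, u, x) \<partial>m x) \<in> borel_measurable D_space"
      using measurable_Pair2[OF nn_integral_m_joint[OF borel_measurable_indicator[OF C]], of s] s by simp
    then show "(\<lambda>x. \<integral>\<^sup>+u. indicator C (s, u, x) \<partial>m x) \<in> borel_measurable \<eta>"
      using measurable_cong_sets[OF sets_eta refl] by blast
  qed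
qed (simp add: slice_def)

lemma nn_integral_mixture_slice:
  assumes s: "0 \<le> s" and f: "f \<in> borel_measurable SUX_space"
  shows "(\<integral>\<^sup>+z. f z \<partial>mixture \<eta> (slice s) SUX_space) = (\<integral>\<^sup>+x. \<integral>\<^sup>+u. f (s, u, x) \<partial>m x \<partial>\<eta>)"
  unfolding nn_integral_mixture[OF kernel_slice[OF s] f]
  by (intro nn_integral_cong nn_integral_slice s f) simp

lemma kernel_mixture_slice: "kernel_on half_line SUX_space (\<lambda>s. mixture \<eta> (slice s) SUX_space)"
  unfolding kernel_on_def
proof (intro conjI ballI)
  fix C assume C: "C \<in> sets SUX_space"
  show "(\<lambda>s. emeasure (mixture \<eta> (slice s) SUX_space) C) \<in> borel_measurable half_line"
  proof (rule measurable_cong[THEN iffD2])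
    show "emeasure (mixture \<eta> (slice s) SUX_space) C = (\<integral>\<^sup>+x. \<integral>\<^sup>+u. indicator C (s, u, x) \<partial>m x \<partial>\<eta>)" if "s \<in> space half_line" for s
      using nn_integral_mixture_slice[of s "indicator C"] that C by simp
    show "(\<lambda>s. \<integral>\<^sup>+x. \<integral>\<^sup>+u. indicator C (s, u, x) \<partial>m x \<partial>\<eta>) \<in> borel_measurable half_line"
    proof (rule eta.borel_measurable_nn_integral)
      show "(\<lambda>(s, x). \<integral>\<^sup>+u. indicator C (s, u, x) \<partial>m x) \<in> borel_measurable (half_line \<Otimes>\<^sub>M \<eta>)"
        using nn_integral_m_joint[OF borel_measurable_indicator[OF C]]
          measurable_cong_sets[OF sets_pair_measure_cong[OF refl sets_eta] refl] by blast
    qed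
  qed
qed simp

text \<open>\<open>intensity\<close> integrates over time innermost, while the exponent of the
  process has time outermost. Time moves outwards in two exchanges, across m by
  \<open>nn_integral_m_swap\<close> and across \<eta> by \<open>P.Fubini'\<close>.\<close>

lemma intensity_mixture: "\<Lambda> = mixture half_line (\<lambda>s. mixture \<eta> (slice s) SUX_space) SUX_space"
  unfolding intensity_def mixture_def[of half_line]
proof (rule measure_of_eq)
  show "sets SUX_space \<subseteq> Pow (space SUX_space)" by (rule sets.space_closed)
  fix C assume "C \<in> sigma_sets (space SUX_space) (sets SUX_space)"
  then have C: "C \<in> sets SUX_space" by (simp add: sets.sigma_sets_eq)
  have Cm: "indicator C \<in> borel_measurable SUX_space" using C by simp
  interpret H: sigma_finite_measure half_line by (rule sigma_finite_half_line)
  interpret P: pair_sigma_finite half_line \<eta> ..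
  have "(\<integral>\<^sup>+x. (\<integral>\<^sup>+u. (\<integral>\<^sup>+s. indicator C (s, u, x) \<partial>restrict_space lborel {0..}) \<partial>m x) \<partial>\<eta>)
      = (\<integral>\<^sup>+x. (\<integral>\<^sup>+s. (\<integral>\<^sup>+u. indicator C (s, u, x) \<partial>m x) \<partial>half_line) \<partial>\<eta>)"
    unfolding half_line_def[symmetric]
  proof (intro nn_integral_cong nn_integral_m_swap)
    fix x assume "x \<in> space \<eta>"
    then show x: "0 < x" by simp
    have "(\<lambda>w. (fst w, snd w, x)) \<in> half_line \<Otimes>\<^sub>M R0_space \<rightarrow>\<^sub>M SUX_space"
      using x by (intro measurable_point measurable_fst measurable_snd measurable_const) simp
    from measurable_compose[OF this Cm]
    show "(\<lambda>(s, u). indicator C (s, u, x)) \<in> borel_measurable (half_line \<Otimes>\<^sub>M R0_space)"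
      by (simp add: case_prod_beta')
  qed
  also have "\<dots> = (\<integral>\<^sup>+s. (\<integral>\<^sup>+x. (\<integral>\<^sup>+u. indicator C (s, u, x) \<partial>m x) \<partial>\<eta>) \<partial>half_line)"
    by (rule P.Fubini')
      (use nn_integral_m_joint[OF Cm] measurable_cong_sets[OF sets_pair_measure_cong[OF refl sets_eta] refl] in blast)
  also have "\<dots> = (\<integral>\<^sup>+s. emeasure (mixture \<eta> (slice s) SUX_space) C \<partial>half_line)"
  proof (intro nn_integral_cong)
    fix s assume "s \<in> space half_line"
    then show "(\<integral>\<^sup>+x. (\<integral>\<^sup>+u. indicator C (s, u, x) \<partial>m x) \<partial>\<eta>) = emeasure (mixture \<eta> (slice s) SUX_space) C"
      using nn_integral_mixture_slice[of s, OF _ Cm] C by simp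
  qed
  finally show "(\<integral>\<^sup>+x. (\<integral>\<^sup>+u. (\<integral>\<^sup>+s. indicator C (s, u, x) \<partial>restrict_space lborel {0..}) \<partial>m x) \<partial>\<eta>)
    = (\<integral>\<^sup>+s. emeasure (mixture \<eta> (slice s) SUX_space) C \<partial>half_line)" .
qed

lemma sets_intensity [simp, measurable_cong]: "sets \<Lambda> = sets SUX_space"
  by (simp add: intensity_mixture)

lemma space_intensity: "space \<Lambda> = space SUX_space"
  by (rule sets_eq_imp_space_eq) simp

lemma nn_integral_intensity:
  assumes f: "f \<in> borel_measurable SUX_space"
  shows "(\<integral>\<^sup>+z. f z \<partial>\<Lambda>) = (\<integral>\<^sup>+s. \<integral>\<^sup>+x. \<integral>\<^sup>+u. f (s, u, x) \<partial>m x \<partial>\<eta> \<partial>half_line)"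
  unfolding intensity_mixture nn_integral_mixture[OF kernel_mixture_slice f]
  by (intro nn_integral_cong nn_integral_mixture_slice f) simp

text \<open>The inner integrals are separated for each fixed s, which is why the bound
  \<open>fin\<close> is asked for every s and not just almost every s.\<close>

lemma integral_intensity:
  fixes f :: "real \<times> real \<times> real \<Rightarrow> complex"
  assumes f: "f \<in> borel_measurable SUX_space" and i: "integrable \<Lambda> f"
    and fin: "\<And>s. 0 \<le> s \<Longrightarrow> (\<integral>\<^sup>+x. \<integral>\<^sup>+u. ennreal (cmod (f (s, u, x))) \<partial>m x \<partial>\<eta>) < \<infinity>"
  shows "(CLINT z|\<Lambda>. f z) = (CLINT s|half_line. CLINT x|\<eta>. CLINT u|m x. f (s, u, x))"
proof -
  have nf: "(\<lambda>z. ennreal (cmod (f z))) \<in> borel_measurable SUX_space" using f by measurable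
  have "(\<integral>\<^sup>+s. \<integral>\<^sup>+z. ennreal (cmod (f z)) \<partial>mixture \<eta> (slice s) SUX_space \<partial>half_line) = (\<integral>\<^sup>+z. ennreal (cmod (f z)) \<partial>\<Lambda>)"
    unfolding intensity_mixture nn_integral_mixture[OF kernel_mixture_slice nf] ..
  also have "\<dots> < \<infinity>" using i by (simp add: integrable_iff_bounded)
  finally have "(CLINT z|\<Lambda>. f z) = (CLINT s|half_line. CLINT z|mixture \<eta> (slice s) SUX_space. f z)"
    unfolding intensity_mixture by (rule integral_mixture[OF kernel_mixture_slice f])
  also have "\<dots> = (CLINT s|half_line. CLINT x|\<eta>. CLINT u|m x. f (s, u, x))"
  proof (rule Bochner_Integration.integral_cong[OF refl])
    fix s assume "s \<in> space half_line"
    then have s: "0 \<le> s" by simp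
    have "(\<integral>\<^sup>+x. \<integral>\<^sup>+z. ennreal (cmod (f z)) \<partial>slice s x \<partial>\<eta>) = (\<integral>\<^sup>+x. \<integral>\<^sup>+u. ennreal (cmod (f (s, u, x))) \<partial>m x \<partial>\<eta>)"
      by (intro nn_integral_cong nn_integral_slice s nf) simp
    also have "\<dots> < \<infinity>" by (rule fin[OF s])
    finally have "(CLINT z|mixture \<eta> (slice s) SUX_space. f z) = (CLINT x|\<eta>. CLINT z|slice s x. f z)"
      by (rule integral_mixture[OF kernel_slice[OF s] f])
    also have "\<dots> = (CLINT x|\<eta>. CLINT u|m x. f (s, u, x))"
      unfolding slice_def by (intro Bochner_Integration.integral_cong refl integral_distr measurable_embed s f) simp
    finally show "(CLINT z|mixture \<eta> (slice s) SUX_space. f z) = (CLINT x|\<eta>. CLINT u|m x. f (s, u, x))" .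
  qed
  finally show ?thesis .
qed

text \<open>One envelope for all integrands: if u is integrable up to time T for a realisation, so
  is every g of this kind. Hence a single null set serves all f and t. The bound also records that g
  ignores jumps after T.\<close>

definition dominated :: "real \<Rightarrow> real \<Rightarrow> (real \<times> real \<times> real \<Rightarrow> real) \<Rightarrow> bool" where
  "dominated c T g \<longleftrightarrow> 0 \<le> c \<and> g \<in> borel_measurable SUX_space \<and>
    (\<forall>z\<in>space SUX_space. \<bar>g z\<bar> \<le> c * (indicator (upto_time T) z * \<bar>fst (snd z)\<bar>))"

lemma measurable_upto [measurable]: "(indicator (upto_time T) :: _ \<Rightarrow> real) \<in> borel_measurable SUX_space"
proof -
  have "(\<lambda>z. indicator {..T} (fst z) :: real) \<in> borel_measurable SUX_space" by measurable
  then show "(indicator (upto_time T) :: _ \<Rightarrow> real) \<in> borel_measurable SUX_space"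
    by (simp add: indicator_upto_time[abs_def])
qed

lemma jump_integrable: "integrable \<Lambda> (\<lambda>z. indicator (upto_time T) z * \<bar>fst (snd z)\<bar>)"
proof -
  have "(\<integral>\<^sup>+z. ennreal (norm (indicator (upto_time T) z * \<bar>fst (snd z)\<bar>)) \<partial>\<Lambda>)
    = (\<integral>\<^sup>+s. \<integral>\<^sup>+x. \<integral>\<^sup>+u. ennreal (indicator {..T} s * \<bar>u\<bar>) \<partial>m x \<partial>\<eta> \<partial>half_line)"
    by (subst nn_integral_intensity) (auto simp: abs_mult indicator_upto_time)
  also have "\<dots> \<le> (\<integral>\<^sup>+s. \<integral>\<^sup>+x. indicator {..T} s * ennreal moment_bound \<partial>\<eta> \<partial>half_line)"
  proof (intro nn_integral_mono)
    fix s x assume "x \<in> space \<eta>"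
    then have x: "0 < x" by simp
    have "(\<integral>\<^sup>+u. ennreal (indicator {..T} s * \<bar>u\<bar>) \<partial>m x) = indicator {..T} s * (\<integral>\<^sup>+u. ennreal \<bar>u\<bar> \<partial>m x)"
      by (auto simp: indicator_def)
    also have "\<dots> \<le> indicator {..T} s * ennreal moment_bound" by (intro mult_left_mono moment_le x) simp
    finally show "(\<integral>\<^sup>+u. ennreal (indicator {..T} s * \<bar>u\<bar>) \<partial>m x) \<le> indicator {..T} s * ennreal moment_bound" .
  qed
  also have "\<dots> = (\<integral>\<^sup>+s. ennreal moment_bound * emeasure \<eta> (space \<eta>) * indicator {..T} s * indicator {0..} s \<partial>lborel)"
    unfolding half_line_def by (subst nn_integral_restrict_space) (auto simp: mult_ac)
  also have "\<dots> = (\<integral>\<^sup>+s. ennreal moment_bound * emeasure \<eta> (space \<eta>) * indicator {0..T} s \<partial>lborel)"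
    by (intro nn_integral_cong) (auto simp: indicator_def)
  also have "\<dots> = ennreal moment_bound * emeasure \<eta> (space \<eta>) * emeasure lborel {0..T}"
    by (subst nn_integral_cmult) auto
  also have "\<dots> < \<infinity>"
    by (simp add: ennreal_mult_less_top eta.emeasure_eq_measure emeasure_lborel_Icc_eq)
  finally show ?thesis by (simp add: integrable_iff_bounded)
qed

lemma dominated_integrable:
  assumes g: "dominated c T g" and L: "sets L = sets SUX_space"
    and j: "integrable L (\<lambda>z. indicator (upto_time T) z * \<bar>fst (snd z)\<bar>)"
  shows "integrable L g"
proof (rule Bochner_Integration.integrable_bound)
  show "integrable L (\<lambda>z. c * (indicator (upto_time T) z * \<bar>fst (snd z)\<bar>))"
    using j by (rule integrable_mult_right)
  show "g \<in> borel_measurable L" using g L by (simp add: dominated_def cong: measurable_cong_sets)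
  show "AE z in L. norm (g z) \<le> norm (c * (indicator (upto_time T) z * \<bar>fst (snd z)\<bar>))"
    using g sets_eq_imp_space_eq[OF L] by (intro AE_I2) (force simp: dominated_def)
qed

lemma dominated_add:
  assumes "dominated c T g" "dominated c' T h"
  shows "dominated (c + \<bar>a\<bar> * c') T (\<lambda>z. g z + a * h z)"
  unfolding dominated_def
proof (intro conjI ballI)
  show "0 \<le> c + \<bar>a\<bar> * c'" "(\<lambda>z. g z + a * h z) \<in> borel_measurable SUX_space" using assms by (auto simp: dominated_def)
  fix z assume z: "z \<in> space SUX_space"
  have "\<bar>g z + a * h z\<bar> \<le> \<bar>g z\<bar> + \<bar>a\<bar> * \<bar>h z\<bar>" by (simp add: abs_mult[symmetric])
  also have "\<dots> \<le> c * (indicator (upto_time T) z * \<bar>fst (snd z)\<bar>) + \<bar>a\<bar> * (c' * (indicator (upto_time T) z * \<bar>fst (snd z)\<bar>))"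
    using assms z by (intro add_mono mult_left_mono) (auto simp: dominated_def)
  finally show "\<bar>g z + a * h z\<bar> \<le> (c + \<bar>a\<bar> * c') * (indicator (upto_time T) z * \<bar>fst (snd z)\<bar>)"
    by (simp add: algebra_simps)
qed

lemma dominated_mono:
  assumes g: "dominated c S g" and "S \<le> T" shows "dominated c T g"
proof -
  have "c * (indicator (upto_time S) z * \<bar>fst (snd z)\<bar>) \<le> c * (indicator (upto_time T) z * \<bar>fst (snd z)\<bar>)"
    if z: "z \<in> space SUX_space" for z
    using assms by (intro mult_left_mono mult_right_mono) (auto simp: dominated_def indicator_def upto_time_def case_prod_beta)
  then show ?thesis using g by (force simp: dominated_def)
qed

end

section \<open>The signed-measure-valued process\<close>

lemma (in driving) dominatedD:
  assumes "dominated c T g"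
  shows "g \<in> borel_measurable SUX_space" "0 \<le> c"
    "z \<in> space SUX_space \<Longrightarrow> \<bar>g z\<bar> \<le> c * (indicator (upto_time T) z * \<bar>fst (snd z)\<bar>)"
  using assms by (auto simp: dominated_def)

definition Yg :: "real \<Rightarrow> (real \<Rightarrow> real) \<Rightarrow> real \<times> real \<times> real \<Rightarrow> real" where
  "Yg t f z = indicator (upto_time t) z * Y_integrand t f z"

lemma Yg_eq: "Yg t f (s, u, x) = indicator {..t} s * (u * absP (t - s) f x)"
  by (simp add: Yg_def Y_integrand_def indicator_upto_time)

text \<open>Beyond time t the indicator vanishes, but \<open>absP\<close> would be evaluated at a
  negative time. The maximum keeps its time argument where \<open>absP_measurable\<close> and
  \<open>absP_bound\<close> apply.\<close>

lemma Yg_eq': "Yg t f z = indicator {..t} (fst z) * (fst (snd z) * absP (max 0 (t - fst z)) f (snd (snd z)))"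
  by (cases z) (auto simp: Yg_eq indicator_def max_def)

text \<open>The integrand of the part of \<open>Y\<^sub>b(f)\<close> that is due to the jumps at times in \<open>J\<close>.\<close>

definition Wg :: "real set \<Rightarrow> real \<Rightarrow> (real \<Rightarrow> real) \<Rightarrow> real \<times> real \<times> real \<Rightarrow> real" where
  "Wg J b f z = indicator J (fst z) * (fst (snd z) * absP (max 0 (b - fst z)) f (snd (snd z)))"

lemma Yg_Wg: "Yg t f = Wg {..t} t f"
  by (rule ext) (simp add: Yg_eq' Wg_def)

lemma SUX_pos:
  assumes "z \<in> space SUX_space" shows "0 < snd (snd z)" "0 \<le> fst z" "fst (snd z) \<noteq> 0"
  using assms by (auto simp: space_SUX)

lemma absP_SUX_measurable:
  assumes f: "f \<in> bdd_borel D_space"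
  shows "(\<lambda>z. absP (max 0 (t - fst z)) f (snd (snd z))) \<in> borel_measurable SUX_space"
  by (rule absP_measurable[OF f]) (auto dest: SUX_pos)

context driving
begin

lemma Wg_dominated:
  assumes f: "f \<in> bdd_borel D_space" and B: "\<And>x. 0 < x \<Longrightarrow> \<bar>f x\<bar> \<le> B"
    and J [measurable]: "J \<in> sets borel" and JT: "J \<subseteq> {..T}"
  shows "dominated B T (Wg J b f)"
  unfolding dominated_def
proof (intro conjI ballI)
  show B0: "0 \<le> B" using B[of 1] by simp
  note absP_SUX_measurable[OF f, measurable]
  show "Wg J b f \<in> borel_measurable SUX_space"
    unfolding Wg_def[abs_def] by measurable
  fix z assume z: "z \<in> space SUX_space"
  have "\<bar>absP (max 0 (b - fst z)) f (snd (snd z))\<bar> \<le> B"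
    by (rule absP_bound[OF f _ SUX_pos(1)[OF z] B]) auto
  then have le: "\<bar>fst (snd z)\<bar> * \<bar>absP (max 0 (b - fst z)) f (snd (snd z))\<bar> \<le> \<bar>fst (snd z)\<bar> * B"
    by (intro mult_left_mono) auto
  show "\<bar>Wg J b f z\<bar> \<le> B * (indicator (upto_time T) z * \<bar>fst (snd z)\<bar>)"
  proof (cases "fst z \<in> J")
    case True
    then have "fst z \<le> T" using JT by auto
    then show ?thesis using le True by (simp add: Wg_def indicator_upto_time abs_mult mult.commute)
  next
    case False
    then show ?thesis using B0 by (simp add: Wg_def indicator_upto_time)
  qed
qed

lemma Yg_dominated:
  assumes "f \<in> bdd_borel D_space" "\<And>x. 0 < x \<Longrightarrow> \<bar>f x\<bar> \<le> B"
  shows "dominated B t (Yg t f)"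
  unfolding Yg_Wg by (rule Wg_dominated[OF assms]) auto

text \<open>Positive and negative jumps are transported separately and give the two parts. L is left
  general because the decomposition is needed both for a realisation of N and for \<Lambda>.\<close>

lemma Yg_signed:
  assumes L: "sets L = sets SUX_space"
    and j: "integrable L (\<lambda>z. indicator (upto_time t) z * \<bar>fst (snd z)\<bar>)"
  obtains p n where "p \<in> fin_meas D_space" "n \<in> fin_meas D_space"
    "\<And>f. f \<in> bdd_borel D_space \<Longrightarrow> (\<integral>x. f x \<partial>p) - (\<integral>x. f x \<partial>n) = (\<integral>z. Yg t f z \<partial>L)"
proof -
  note Lm = measurable_cong_sets[OF L refl]
  have sL: "space L = space SUX_space" by (rule sets_eq_imp_space_eq[OF L])
  have mm: "(\<lambda>z. max 0 (t - fst z)) \<in> borel_measurable L" "(\<lambda>z. snd (snd z)) \<in> borel_measurable L"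
    unfolding Lm by measurable
  have pos: "z \<in> space L \<Longrightarrow> 0 \<le> max 0 (t - fst z)" "z \<in> space L \<Longrightarrow> 0 < snd (snd z)" for z
    using SUX_pos by (auto simp: sL)
  define w where "w e z = indicator (upto_time t) z * max 0 (e * fst (snd z))" for e :: real and z :: "real \<times> real \<times> real"
  have wm: "w e \<in> borel_measurable L" for e unfolding Lm w_def by measurable
  have wi: "integrable L (w e)" if "e = 1 \<or> e = -1" for e
    by (rule Bochner_Integration.integrable_bound[OF j wm], intro AE_I2)
      (use that in \<open>auto simp: w_def indicator_def\<close>)
  have w0: "0 \<le> w e z" for e z by (simp add: w_def)
  obtain p where p: "p \<in> fin_meas D_space"
    "\<And>f. f \<in> bdd_borel D_space \<Longrightarrow> integrable L (\<lambda>z. w 1 z * absP (max 0 (t - fst z)) f (snd (snd z)))"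
    "\<And>f. f \<in> bdd_borel D_space \<Longrightarrow> (\<integral>y. f y \<partial>p) = (\<integral>z. w 1 z * absP (max 0 (t - fst z)) f (snd (snd z)) \<partial>L)"
    by (rule transport_measure[OF mm pos wm[of 1] w0 wi]) auto
  obtain n where n: "n \<in> fin_meas D_space"
    "\<And>f. f \<in> bdd_borel D_space \<Longrightarrow> integrable L (\<lambda>z. w (-1) z * absP (max 0 (t - fst z)) f (snd (snd z)))"
    "\<And>f. f \<in> bdd_borel D_space \<Longrightarrow> (\<integral>y. f y \<partial>n) = (\<integral>z. w (-1) z * absP (max 0 (t - fst z)) f (snd (snd z)) \<partial>L)"
    by (rule transport_measure[OF mm pos wm[of "-1"] w0 wi]) auto
  show thesis
  proof (rule that[OF p(1) n(1)])
    fix f assume f: "f \<in> bdd_borel D_space"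
    have "(\<integral>x. f x \<partial>p) - (\<integral>x. f x \<partial>n) = (\<integral>z. w 1 z * absP (max 0 (t - fst z)) f (snd (snd z)) - w (-1) z * absP (max 0 (t - fst z)) f (snd (snd z)) \<partial>L)"
      unfolding p(3)[OF f] n(3)[OF f] by (rule Bochner_Integration.integral_diff[OF p(2)[OF f] n(2)[OF f], symmetric])
    also have "\<dots> = (\<integral>z. Yg t f z \<partial>L)"
      by (intro Bochner_Integration.integral_cong refl) (auto simp: Yg_eq' w_def indicator_upto_time max_def)
    finally show "(\<integral>x. f x \<partial>p) - (\<integral>x. f x \<partial>n) = (\<integral>z. Yg t f z \<partial>L)" .
  qed
qed

text \<open>A jump at or before t0 is seen at every \<open>t n\<close>, and its contribution
  converges by continuity of P_r f(x) down to r = 0. A jump after t0 has not yet happened once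
  \<open>t n\<close> is close to t0.\<close>

lemma Yg_tendsto:
  assumes f: "f \<in> bdd_borel D_space" and c: "continuous_on {0<..} f"
    and t: "\<And>n. t0 \<le> t n" "t \<longlonglongrightarrow> t0" and z: "z \<in> space SUX_space"
  shows "(\<lambda>n. Yg (t n) f z) \<longlonglongrightarrow> Yg t0 f z"
proof (cases "fst z \<le> t0")
  case True
  have "(\<lambda>n. absP (t n - fst z) f (snd (snd z))) \<longlonglongrightarrow> absP (t0 - fst z) f (snd (snd z))"
    using SUX_pos[OF z] True t(1) by (intro absP_tendsto[OF f c]) (auto intro!: tendsto_intros t(2) intro: order_trans)
  moreover have "fst z \<le> t n" for n using t(1)[of n] True by simp
  ultimately show ?thesis
    using True by (cases z) (auto simp: Yg_eq intro!: tendsto_intros)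
next
  case False
  then have "\<forall>\<^sub>F n in sequentially. t n < fst z" using t(2) by (intro order_tendstoD) auto
  then have "\<forall>\<^sub>F n in sequentially. Yg (t n) f z = Yg t0 f z"
    by eventually_elim (use False in \<open>auto simp: Yg_eq' indicator_def\<close>)
  then show ?thesis by (rule tendsto_eventually)
qed

section \<open>The characteristic exponent\<close>

definition psi :: "real \<Rightarrow> (real \<Rightarrow> real) \<Rightarrow> complex" where
  "psi t f = (LINT s:{0..t}|lborel. (LINT x|\<eta>. phi m x (absP s f x)))"

lemma norm_levy: "cmod (iexp y - 1 - \<i> * complex_of_real y) \<le> 2 * \<bar>y\<bar>"
proof -
  have "cmod (iexp y - 1 - \<i> * complex_of_real y) \<le> cmod (iexp y - 1) + cmod (\<i> * complex_of_real y)" by (rule norm_triangle_ineq4)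
  also have "\<dots> \<le> \<bar>y\<bar> + \<bar>y\<bar>" using iexp_approx1[of y 0] by (intro add_mono) (auto simp: norm_mult)
  finally show ?thesis by simp
qed

lemma levy_integrable:
  assumes g: "dominated c T g"
  shows "integrable \<Lambda> (\<lambda>z. iexp (g z) - 1 - \<i> * complex_of_real (g z))"
proof (rule Bochner_Integration.integrable_bound[where f = "\<lambda>z. 2 * g z"])
  show "integrable \<Lambda> (\<lambda>z. 2 * g z)"
    by (intro integrable_mult_right dominated_integrable[OF g _ jump_integrable]) simp
  note dominatedD(1)[OF g, measurable]
  show "(\<lambda>z. iexp (g z) - 1 - \<i> * complex_of_real (g z)) \<in> borel_measurable \<Lambda>" by measurable
  show "AE z in \<Lambda>. cmod (iexp (g z) - 1 - \<i> * complex_of_real (g z)) \<le> norm (2 * g z)"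
    by (intro AE_I2) (simp add: norm_levy abs_mult)
qed

text \<open>The function e^{iy} - 1 - iy vanishes at y = 0, so the window J survives only as a
  factor in the time integral. The windows used are \<open>{..t}\<close>, for Y_t itself, and
  \<open>{s<..s+t}\<close>, for the jumps after s.\<close>

lemma levy_Wg:
  assumes f: "f \<in> bdd_borel D_space" and J [measurable]: "J \<in> sets borel" and JT: "J \<subseteq> {..t}"
  shows "(CLINT z|\<Lambda>. iexp (Wg J t f z) - 1 - \<i> * complex_of_real (Wg J t f z))
    = (CLINT s|lborel. indicator (J \<inter> {0..}) s *\<^sub>R (LINT x|\<eta>. phi m x (absP (t - s) f x)))"
proof -
  obtain B where B: "\<And>x. 0 < x \<Longrightarrow> \<bar>f x\<bar> \<le> B" using bdd_borel_D_bound[OF f] by auto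
  note dom = Wg_dominated[OF f B J JT, of t]
  let ?h = "\<lambda>z. iexp (Wg J t f z) - 1 - \<i> * complex_of_real (Wg J t f z)"
  have hm: "?h \<in> borel_measurable SUX_space" using dominatedD(1)[OF dom] by measurable
  define \<Phi> where "\<Phi> r = (LINT x|\<eta>. phi m x (absP r f x))" for r
  have "(CLINT z|\<Lambda>. ?h z) = (CLINT s|half_line. CLINT x|\<eta>. CLINT u|m x. ?h (s, u, x))"
  proof (rule integral_intensity[OF hm levy_integrable[OF dom]])
    fix s :: real assume s: "0 \<le> s"
    have "(\<integral>\<^sup>+x. \<integral>\<^sup>+u. ennreal (cmod (?h (s, u, x))) \<partial>m x \<partial>\<eta>) \<le> (\<integral>\<^sup>+x. ennreal (2 * B) * ennreal moment_bound \<partial>\<eta>)"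
    proof (intro nn_integral_mono)
      fix x assume "x \<in> space \<eta>"
      then have x: "0 < x" by simp
      have B0: "0 \<le> B" using B[of 1] by simp
      have "(\<integral>\<^sup>+u. ennreal (cmod (?h (s, u, x))) \<partial>m x) \<le> (\<integral>\<^sup>+u. ennreal (2 * B) * ennreal \<bar>u\<bar> \<partial>m x)"
      proof (intro nn_integral_mono)
        fix u assume "u \<in> space (m x)"
        then have "(s, u, x) \<in> space SUX_space" using s x by (simp add: space_SUX space_m)
        then have "\<bar>Wg J t f (s, u, x)\<bar> \<le> B * (indicator (upto_time t) (s, u, x) * \<bar>u\<bar>)"
          using dominatedD(3)[OF dom] by force
        also have "\<dots> \<le> B * \<bar>u\<bar>" using B0 by (intro mult_left_mono) (auto simp: indicator_def)
        finally have "cmod (?h (s, u, x)) \<le> 2 * B * \<bar>u\<bar>" using norm_levy[of "Wg J t f (s, u, x)"] by simp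
        then show "ennreal (cmod (?h (s, u, x))) \<le> ennreal (2 * B) * ennreal \<bar>u\<bar>"
          using B0 by (simp add: ennreal_mult[symmetric] ennreal_leI)
      qed
      also have "\<dots> = ennreal (2 * B) * (\<integral>\<^sup>+u. ennreal \<bar>u\<bar> \<partial>m x)"
        by (intro nn_integral_cmult) (simp add: measurable_m[OF x])
      also have "\<dots> \<le> ennreal (2 * B) * ennreal moment_bound" by (intro mult_left_mono moment_le x) simp
      finally show "(\<integral>\<^sup>+u. ennreal (cmod (?h (s, u, x))) \<partial>m x) \<le> ennreal (2 * B) * ennreal moment_bound" .
    qed
    also have "\<dots> < \<infinity>" by (simp add: ennreal_mult_less_top eta.emeasure_eq_measure)
    finally show "(\<integral>\<^sup>+x. \<integral>\<^sup>+u. ennreal (cmod (?h (s, u, x))) \<partial>m x \<partial>\<eta>) < \<infinity>" .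
  qed
  also have "\<dots> = (CLINT s|half_line. indicator J s *\<^sub>R \<Phi> (t - s))"
  proof (rule Bochner_Integration.integral_cong[OF refl])
    fix s assume "s \<in> space half_line"
    show "(CLINT x|\<eta>. CLINT u|m x. ?h (s, u, x)) = indicator J s *\<^sub>R \<Phi> (t - s)"
    proof (cases "s \<in> J")
      case True
      then have "s \<le> t" using JT by auto
      then show ?thesis using True by (simp add: Wg_def \<Phi>_def phi_def max_def mult.commute)
    qed (simp add: Wg_def)
  qed
  also have "\<dots> = (CLINT s|lborel. indicator (J \<inter> {0..}) s *\<^sub>R \<Phi> (t - s))"
    unfolding half_line_def
    by (subst integral_restrict_space) (auto intro!: Bochner_Integration.integral_cong simp: indicator_def)
  finally show ?thesis by (simp add: \<Phi>_def)
qed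

lemma levy_Yg:
  assumes f: "f \<in> bdd_borel D_space" and t: "0 \<le> t"
  shows "(CLINT z|\<Lambda>. iexp (Yg t f z) - 1 - \<i> * complex_of_real (Yg t f z)) = psi t f"
proof -
  have "psi t f = (CLINT s|lborel. indicator {0..t} (t + (-1) * s) *\<^sub>R (LINT x|\<eta>. phi m x (absP (t + (-1) * s) f x)))"
    unfolding psi_def set_lebesgue_integral_def by (subst lborel_integral_real_affine[of "-1" _ t]) auto
  also have "\<dots> = (CLINT s|lborel. indicator ({..t} \<inter> {0..}) s *\<^sub>R (LINT x|\<eta>. phi m x (absP (t - s) f x)))"
    by (intro Bochner_Integration.integral_cong refl) (auto simp: indicator_def)
  finally show ?thesis unfolding Yg_Wg by (subst levy_Wg[OF f]) auto
qed

lemma levy_window: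
  assumes f: "f \<in> bdd_borel D_space" and s: "0 \<le> s" and t: "0 \<le> t"
  shows "(CLINT z|\<Lambda>. iexp (Wg {s<..s+t} (s+t) f z) - 1 - \<i> * complex_of_real (Wg {s<..s+t} (s+t) f z)) = psi t f"
proof -
  have "psi t f = (CLINT r|lborel. indicator {0..t} (s + t + (-1) * r) *\<^sub>R (LINT x|\<eta>. phi m x (absP (s + t + (-1) * r) f x)))"
    unfolding psi_def set_lebesgue_integral_def by (subst lborel_integral_real_affine[of "-1" _ "s + t"]) auto
  \<comment> \<open>Reversing time about s + t carries [0, t] to [s, s + t]; the window omits the
    point s, a null set.\<close>
  also have "\<dots> = (CLINT r|lborel. indicator ({s<..s+t} \<inter> {0..}) r *\<^sub>R (LINT x|\<eta>. phi m x (absP (s + t - r) f x)))"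
    by (rule integral_discrete_difference[of "{s}"]) (use s t in \<open>auto simp: indicator_def\<close>)
  finally show ?thesis by (subst levy_Wg[OF f]) auto
qed

end

section \<open>Compensated integrals and the paths of Y\<close>

locale driven_process = signed_state d fs + driving \<eta> m + poisson_measure M "intensity m \<eta>" N
  for d fs \<eta> m and M :: "'w measure" and N
begin

abbreviation "Y \<equiv> Y_proc (intensity m \<eta>) N"

definition good :: "'w set" where
  "good = {\<omega> \<in> space M. \<forall>T. set_integrable (N \<omega>) (upto_time T) (\<lambda>(s, u, x). u)}"

text \<open>The value 0 off \<open>good\<close> repeats the convention of \<open>Y_proc\<close>.
  Linearity and the link \<open>sint_Y\<close> then hold for every realisation, so that splitting
  Y_t and measurability with respect to filtrations involve no exceptional sets.\<close>

definition Ntilde :: "(real \<times> real \<times> real \<Rightarrow> real) \<Rightarrow> 'w \<Rightarrow> real" where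
  "Ntilde g \<omega> = (if \<omega> \<in> good then (\<integral>z. g z \<partial>N \<omega>) - (\<integral>z. g z \<partial>\<Lambda>) else 0)"

lemma sets_N_SUX: "\<omega> \<in> space M \<Longrightarrow> sets (N \<omega>) = sets SUX_space" using sets_N by simp

lemma upto_jump_iff:
  assumes L: "sets L = sets SUX_space"
  shows "set_integrable L (upto_time T) (\<lambda>(s, u, x). u) \<longleftrightarrow> integrable L (\<lambda>z. indicator (upto_time T) z * \<bar>fst (snd z)\<bar>)"
proof -
  have "(\<lambda>z. indicator (upto_time T) z * fst (snd z)) \<in> borel_measurable SUX_space" by measurable
  then have "(\<lambda>z. indicator (upto_time T) z * fst (snd z)) \<in> borel_measurable L"
    using measurable_cong_sets[OF L refl] by blast
  from integrable_abs_iff[OF this] show ?thesis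
    by (simp add: set_integrable_def case_prod_beta' abs_mult)
qed

lemma good_jump: "\<omega> \<in> good \<Longrightarrow> integrable (N \<omega>) (\<lambda>z. indicator (upto_time T) z * \<bar>fst (snd z)\<bar>)"
  by (auto simp: good_def upto_jump_iff[OF sets_N_SUX])

lemma jump_integrable_mono:
  assumes L: "sets L = sets SUX_space" and "T0 \<le> T"
    and "integrable L (\<lambda>z. indicator (upto_time T) z * \<bar>fst (snd z)\<bar>)"
  shows "integrable L (\<lambda>z. indicator (upto_time T0) z * \<bar>fst (snd z)\<bar>)"
proof (rule Bochner_Integration.integrable_bound[OF assms(3)])
  have "(\<lambda>z. indicator (upto_time T0) z * \<bar>fst (snd z)\<bar>) \<in> borel_measurable SUX_space" by measurable
  then show "(\<lambda>z. indicator (upto_time T0) z * \<bar>fst (snd z)\<bar>) \<in> borel_measurable L"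
    using measurable_cong_sets[OF L refl] by blast
  show "AE z in L. norm (indicator (upto_time T0) z * \<bar>fst (snd z)\<bar>) \<le> norm (indicator (upto_time T) z * \<bar>fst (snd z)\<bar>)"
    using assms(2) by (intro AE_I2) (auto simp: upto_time_def indicator_def)
qed

lemma good_iff_nat:
  assumes w: "\<omega> \<in> space M"
  shows "\<omega> \<in> good \<longleftrightarrow> (\<forall>n::nat. integrable (N \<omega>) (\<lambda>z. indicator (upto_time (real n)) z * \<bar>fst (snd z)\<bar>))"
proof -
  have "integrable (N \<omega>) (\<lambda>z. indicator (upto_time T) z * \<bar>fst (snd z)\<bar>)"
    if "\<forall>n::nat. integrable (N \<omega>) (\<lambda>z. indicator (upto_time (real n)) z * \<bar>fst (snd z)\<bar>)" for T
    using jump_integrable_mono[OF sets_N_SUX[OF w] real_nat_ceiling_ge[of T]] that by blast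
  then show ?thesis using w by (auto simp: good_def upto_jump_iff[OF sets_N_SUX])
qed

lemma good_sets [measurable]: "good \<in> sets M"
proof -
  define J where "J n = (\<lambda>z. ennreal (indicator (upto_time (real n)) z * \<bar>fst (snd z)\<bar>))" for n
  have J: "J n \<in> borel_measurable \<Lambda>" for n
  proof -
    have "J n \<in> borel_measurable SUX_space" unfolding J_def by measurable
    then show ?thesis using measurable_cong_sets[OF sets_intensity refl] by blast
  qed
  have JN: "integrable (N \<omega>) (\<lambda>z. indicator (upto_time (real n)) z * \<bar>fst (snd z)\<bar>) \<longleftrightarrow> (\<integral>\<^sup>+z. J n z \<partial>N \<omega>) < \<infinity>"
    if w: "\<omega> \<in> space M" for n \<omega>
  proof -
    have "(\<lambda>z. indicator (upto_time (real n)) z * \<bar>fst (snd z)\<bar>) \<in> borel_measurable SUX_space" by measurable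
    then have "(\<lambda>z. indicator (upto_time (real n)) z * \<bar>fst (snd z)\<bar>) \<in> borel_measurable (N \<omega>)"
      using measurable_cong_sets[OF sets_N_SUX[OF w] refl] by blast
    then show ?thesis by (simp add: integrable_iff_bounded J_def abs_mult)
  qed
  have [measurable]: "(\<lambda>\<omega>. \<integral>\<^sup>+z. J n z \<partial>N \<omega>) \<in> borel_measurable M" for n
    by (rule nn_integral_kernel_measurable[OF kernel_N J])
  have "good = {\<omega> \<in> space M. \<forall>n. (\<integral>\<^sup>+z. J n z \<partial>N \<omega>) < \<infinity>}"
    using good_iff_nat JN by (auto simp: good_def)
  also have "\<dots> \<in> sets M" by measurable
  finally show ?thesis .
qed

lemma AE_good: "AE \<omega> in M. \<omega> \<in> good"
proof -
  have "AE \<omega> in M. \<forall>n::nat. integrable (N \<omega>) (\<lambda>z. indicator (upto_time (real n)) z * \<bar>fst (snd z)\<bar>)"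
    unfolding AE_all_countable by (intro allI AE_integrable_N jump_integrable)
  then show ?thesis using AE_space by eventually_elim (simp add: good_iff_nat)
qed

lemma dominated_N: "dominated c T g \<Longrightarrow> \<omega> \<in> good \<Longrightarrow> integrable (N \<omega>) g"
  by (rule dominated_integrable[OF _ sets_N_SUX good_jump]) (auto simp: good_def)

lemma dominated_L: "dominated c T g \<Longrightarrow> integrable \<Lambda> g"
  by (rule dominated_integrable[OF _ sets_intensity jump_integrable])

lemma Ntilde_measurable:
  assumes g: "dominated c T g" shows "Ntilde g \<in> borel_measurable M"
proof -
  have "g \<in> borel_measurable \<Lambda>" using dominatedD(1)[OF g] measurable_cong_sets[OF sets_intensity refl] by blast
  from integral_kernel_measurable[OF kernel_N this]
  have [measurable]: "(\<lambda>\<omega>. \<integral>z. g z \<partial>N \<omega>) \<in> borel_measurable M" .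
  show ?thesis unfolding Ntilde_def[abs_def] by measurable
qed

lemma Ntilde_add:
  assumes "dominated c T g" "dominated c' T' h"
  shows "Ntilde (\<lambda>z. g z + a * h z) \<omega> = Ntilde g \<omega> + a * Ntilde h \<omega>"
  using dominated_N[OF assms(1)] dominated_N[OF assms(2)] dominated_L[OF assms(1)] dominated_L[OF assms(2)]
  by (simp add: Ntilde_def algebra_simps)

lemma Ntilde_cong:
  assumes "\<And>z. z \<in> space SUX_space \<Longrightarrow> g z = h z" shows "Ntilde g \<omega> = Ntilde h \<omega>"
proof (cases "\<omega> \<in> good")
  case True
  then have "space (N \<omega>) = space SUX_space" by (intro sets_eq_imp_space_eq sets_N_SUX) (simp add: good_def)
  then have "(\<integral>z. g z \<partial>N \<omega>) = (\<integral>z. h z \<partial>N \<omega>)" "(\<integral>z. g z \<partial>\<Lambda>) = (\<integral>z. h z \<partial>\<Lambda>)"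
    using assms by (auto intro!: Bochner_Integration.integral_cong simp: space_intensity)
  then show ?thesis by (simp add: Ntilde_def)
qed (simp add: Ntilde_def)

lemma Ntilde_char:
  assumes g: "dominated c T g"
  shows "(CLINT \<omega>|M. iexp (Ntilde g \<omega>)) = exp (CLINT z|\<Lambda>. iexp (g z) - 1 - \<i> * complex_of_real (g z))"
proof -
  note L = dominated_L[OF g]
  have gm: "g \<in> borel_measurable \<Lambda>" using dominatedD(1)[OF g] measurable_cong_sets[OF sets_intensity refl] by blast
  have [measurable]: "(\<lambda>\<omega>. \<integral>z. g z \<partial>N \<omega>) \<in> borel_measurable M" by (rule integral_kernel_measurable[OF kernel_N gm])
  note Ntilde_measurable[OF g, measurable]
  let ?b = "\<integral>z. g z \<partial>\<Lambda>"
  have i1: "integrable \<Lambda> (\<lambda>z. iexp (g z) - 1)"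
    by (rule Bochner_Integration.integrable_bound[OF L]) (use gm norm_iexp_minus_one in auto)
  have "(CLINT \<omega>|M. iexp (Ntilde g \<omega>)) = (CLINT \<omega>|M. iexp (\<integral>z. g z \<partial>N \<omega>) * exp (- (\<i> * complex_of_real ?b)))"
  proof (rule integral_cong_AE)
    show "AE \<omega> in M. iexp (Ntilde g \<omega>) = iexp (\<integral>z. g z \<partial>N \<omega>) * exp (- (\<i> * complex_of_real ?b))"
      using AE_good by eventually_elim (simp add: Ntilde_def right_diff_distrib exp_diff exp_minus divide_inverse)
  qed measurable
  also have "\<dots> = exp (CLINT z|\<Lambda>. iexp (g z) - 1) * exp (- (\<i> * complex_of_real ?b))"
    by (simp add: poisson_char[OF L])
  also have "\<dots> = exp ((CLINT z|\<Lambda>. iexp (g z) - 1) - (CLINT z|\<Lambda>. \<i> * complex_of_real (g z)))"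
    by (simp add: exp_diff exp_minus divide_inverse)
  also have "(CLINT z|\<Lambda>. iexp (g z) - 1) - (CLINT z|\<Lambda>. \<i> * complex_of_real (g z)) = (CLINT z|\<Lambda>. iexp (g z) - 1 - \<i> * complex_of_real (g z))"
    using L by (intro Bochner_Integration.integral_diff[symmetric] i1) auto
  finally show ?thesis .
qed

lemma Ntilde_tendsto:
  assumes g: "\<And>n::nat. dominated c T (g n)" "\<And>z. z \<in> space SUX_space \<Longrightarrow> (\<lambda>n. g n z) \<longlonglongrightarrow> h z"
    and h: "h \<in> borel_measurable SUX_space"
  shows "(\<lambda>n. Ntilde (g n) \<omega>) \<longlonglongrightarrow> Ntilde h \<omega>"
proof (cases "\<omega> \<in> good")
  case True
  have *: "(\<lambda>n. \<integral>z. g n z \<partial>L) \<longlonglongrightarrow> (\<integral>z. h z \<partial>L)"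
    if L: "sets L = sets SUX_space" and j: "integrable L (\<lambda>z. indicator (upto_time T) z * \<bar>fst (snd z)\<bar>)" for L
  proof (rule integral_dominated_convergence)
    show "integrable L (\<lambda>z. c * (indicator (upto_time T) z * \<bar>fst (snd z)\<bar>))"
      using j by (rule integrable_mult_right)
    show "AE z in L. norm (g n z) \<le> c * (indicator (upto_time T) z * \<bar>fst (snd z)\<bar>)" for n
      using dominatedD(3)[OF g(1)] sets_eq_imp_space_eq[OF L] by (intro AE_I2) simp
    show "AE z in L. (\<lambda>n. g n z) \<longlonglongrightarrow> h z"
      using g(2) sets_eq_imp_space_eq[OF L] by (intro AE_I2) simp
    show "h \<in> borel_measurable L" using h measurable_cong_sets[OF L refl] by blast
    show "g n \<in> borel_measurable L" for n using dominatedD(1)[OF g(1)] measurable_cong_sets[OF L refl] by blast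
  qed
  have "sets (N \<omega>) = sets SUX_space" using True by (intro sets_N_SUX) (simp add: good_def)
  with True show ?thesis
    by (simp add: Ntilde_def tendsto_diff * good_jump jump_integrable)
qed (simp add: Ntilde_def)

lemma Y_int_eq: "Y_int \<Lambda> N t f \<omega> = (\<integral>z. Yg t f z \<partial>N \<omega>) - (\<integral>z. Yg t f z \<partial>\<Lambda>)"
  by (simp add: Y_int_def set_lebesgue_integral_def Yg_def)

lemma
  assumes w: "\<omega> \<in> space M"
  shows Y_fin_signed: "Y t \<omega> \<in> fin_signed D_space"
    and sint_Y: "f \<in> bdd_borel D_space \<Longrightarrow> sint D_space (Y t \<omega>) f = Ntilde (Yg t f) \<omega>"
proof -
  have "Y t \<omega> \<in> fin_signed D_space \<and> (f \<in> bdd_borel D_space \<longrightarrow> sint D_space (Y t \<omega>) f = Ntilde (Yg t f) \<omega>)"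
  proof (cases "\<omega> \<in> good")
    case True
    obtain p n where pn: "p \<in> fin_meas D_space" "n \<in> fin_meas D_space"
      "\<And>f. f \<in> bdd_borel D_space \<Longrightarrow> (\<integral>x. f x \<partial>p) - (\<integral>x. f x \<partial>n) = (\<integral>z. Yg t f z \<partial>N \<omega>)"
      using Yg_signed[OF sets_N_SUX[OF w] good_jump[OF True]] by blast
    obtain p' n' where pn': "p' \<in> fin_meas D_space" "n' \<in> fin_meas D_space"
      "\<And>f. f \<in> bdd_borel D_space \<Longrightarrow> (\<integral>x. f x \<partial>p') - (\<integral>x. f x \<partial>n') = (\<integral>z. Yg t f z \<partial>\<Lambda>)"
      using Yg_signed[OF sets_intensity jump_integrable] by blast
    \<comment> \<open>The compensator is subtracted, so its two parts change sides.\<close>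
    let ?P = "measure_add p n'" and ?Q = "measure_add n p'"
    have PQ: "?P \<in> fin_meas D_space" "?Q \<in> fin_meas D_space" using pn pn' by (auto intro: fin_meas_measure_add)
    have int: "(\<integral>x. f x \<partial>?P) - (\<integral>x. f x \<partial>?Q) = Y_int \<Lambda> N t f \<omega>" if "f \<in> bdd_borel D_space" for f
      using pn pn' that by (simp add: integral_measure_add Y_int_eq algebra_simps flip: pn(3) pn'(3))
    have "Y t \<omega> = sdiff ?P ?Q"
    proof
      fix A
      show "Y t \<omega> A = sdiff ?P ?Q A"
      proof (cases "A \<in> sets D_space")
        case A: True
        have "A \<inter> space q = A" if "q \<in> fin_meas D_space" for q
          using sets.sets_into_space[OF A] sets_eq_imp_space_eq[of q D_space] that by (auto simp: fin_meas_def)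
        then show ?thesis using int[OF indicator_bdd_borel[OF A]] True A PQ
          by (simp add: Y_proc_def good_def sdiff_def)
      next
        case False
        then show ?thesis using PQ by (simp add: Y_proc_def sdiff_def fin_meas_def measure_notin_sets)
      qed
    qed
    then show ?thesis using PQ int True
      by (auto simp: fin_signed_def sint_eq Ntilde_def Y_int_eq)
  next
    case False
    then have z: "Y t \<omega> = (\<lambda>_. 0)" using w by (intro ext) (auto simp: Y_proc_def good_def)
    have "(\<lambda>_. 0) = sdiff (null_measure D_space) (null_measure D_space)" by (simp add: sdiff_def)
    then have "sint D_space (\<lambda>_. 0) f = 0" if "f \<in> bdd_borel D_space"
      using sint_eq[OF null_fin_meas null_fin_meas that] by simp
    then show ?thesis using False by (simp add: z fin_signed_zero Ntilde_def)
  qed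
  then show "Y t \<omega> \<in> fin_signed D_space" "f \<in> bdd_borel D_space \<Longrightarrow> sint D_space (Y t \<omega>) f = Ntilde (Yg t f) \<omega>" by auto
qed

lemma Yg_dom: assumes "f \<in> bdd_borel D_space" obtains B where "dominated B t (Yg t f)"
  using bdd_borel_D_bound[OF assms] Yg_dominated[OF assms] by blast

lemma Y_measurable: "Y t \<in> M \<rightarrow>\<^sub>M S"
proof (rule measurable_signed_space[OF fs_bdd Y_fin_signed])
  fix k
  obtain B where "dominated B t (Yg t (fs k))" using Yg_dom[OF fs_bdd] .
  then have "Ntilde (Yg t (fs k)) \<in> borel_measurable M" by (rule Ntilde_measurable)
  then show "(\<lambda>\<omega>. sint D_space (Y t \<omega>) (fs k)) \<in> borel_measurable M"
    by (rule measurable_cong[THEN iffD2, rotated]) (simp add: sint_Y fs_bdd)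
qed

lemma Y_right_continuous:
  assumes w: "\<omega> \<in> space M" and f: "f \<in> bdd_borel D_space" "continuous_on {0<..} f"
    and t: "\<And>n. t0 \<le> t n" "t \<longlonglongrightarrow> t0"
  shows "(\<lambda>n. sint D_space (Y (t n) \<omega>) f) \<longlonglongrightarrow> sint D_space (Y t0 \<omega>) f"
proof -
  obtain B where B: "\<And>x. 0 < x \<Longrightarrow> \<bar>f x\<bar> \<le> B" using bdd_borel_D_bound[OF f(1)] by auto
  \<comment> \<open>A convergent sequence of times is bounded, so one envelope up to T dominates all
    the integrands.\<close>
  obtain T where T: "\<And>n. t n \<le> T" using convergent_imp_Bseq[of t] t(2)
    by (metis Bseq_def abs_le_D1 convergent_def real_norm_def)
  show ?thesis
    unfolding sint_Y[OF w f(1)]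
    by (rule Ntilde_tendsto[OF dominated_mono[OF Yg_dominated[OF f(1) B] T] Yg_tendsto[OF f t] dominatedD(1)[OF Yg_dominated[OF f(1) B]]])
qed

lemma Y_rho_right_continuous:
  assumes w: "\<omega> \<in> space M"
  shows "((\<lambda>s. rho_dist D_space fs (Y s \<omega>) (Y t \<omega>)) \<longlongrightarrow> 0) (at_right t)"
proof -
  have eq: "rho_dist D_space fs (Y s \<omega>) (Y t \<omega>) = rho_sum D_space fs (Y t \<omega>) (\<lambda>k. sint D_space (Y s \<omega>) (fs k))" for s
    by (subst rho_dist_eq[OF fs_bdd Y_fin_signed[OF w] Y_fin_signed[OF w]]) (simp add: rho_sum_def abs_minus_commute)
  show ?thesis
    unfolding eq
  proof (rule tendsto_rho_sum)
    fix k
    show "((\<lambda>s. sint D_space (Y s \<omega>) (fs k)) \<longlongrightarrow> sint D_space (Y t \<omega>) (fs k)) (at_right t)"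
      unfolding tendsto_at_iff_sequentially
    proof (intro allI impI)
      fix X :: "nat \<Rightarrow> real" assume X: "\<forall>i. X i \<in> {t<..} - {t}" "X \<longlonglongrightarrow> t"
      then have "t \<le> X i" for i by (auto intro: less_imp_le)
      then show "((\<lambda>s. sint D_space (Y s \<omega>) (fs k)) \<circ> X) \<longlonglongrightarrow> sint D_space (Y t \<omega>) (fs k)"
        unfolding comp_def by (intro Y_right_continuous[OF w fs_bdd fs_continuous] X(2))
    qed
  qed
qed

lemma Y_char:
  assumes f: "f \<in> bdd_borel D_space" and t: "0 \<le> t"
  shows "(CLINT \<omega>|M. iexp (sint D_space (Y t \<omega>) f)) = exp (psi t f)"
proof -
  obtain B where B: "dominated B t (Yg t f)" using Yg_dom[OF f] .
  have "(CLINT \<omega>|M. iexp (sint D_space (Y t \<omega>) f)) = (CLINT \<omega>|M. iexp (Ntilde (Yg t f) \<omega>))"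
    by (intro Bochner_Integration.integral_cong refl) (simp add: sint_Y f)
  also have "\<dots> = exp (psi t f)" by (simp only: Ntilde_char[OF B] levy_Yg[OF f t])
  finally show ?thesis .
qed

lemma Y_functional:
  assumes w: "\<omega> \<in> good"
  shows "Y t \<omega> \<in> fin_signed D_space \<and> (\<forall>f\<in>bdd_borel D_space.
           set_integrable (N \<omega>) (upto_time t) (Y_integrand t f) \<and>
           set_integrable \<Lambda> (upto_time t) (Y_integrand t f) \<and>
           sint D_space (Y t \<omega>) f = Y_int \<Lambda> N t f \<omega>)"
proof (intro conjI ballI)
  have wM: "\<omega> \<in> space M" using w by (simp add: good_def)
  show "Y t \<omega> \<in> fin_signed D_space" by (rule Y_fin_signed[OF wM])
  fix f assume f: "f \<in> bdd_borel D_space"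
  obtain B where B: "dominated B t (Yg t f)" using Yg_dom[OF f] .
  show "set_integrable (N \<omega>) (upto_time t) (Y_integrand t f)" "set_integrable \<Lambda> (upto_time t) (Y_integrand t f)"
    using dominated_N[OF B w] dominated_L[OF B] by (simp_all add: set_integrable_def Yg_def[abs_def])
  show "sint D_space (Y t \<omega>) f = Y_int \<Lambda> N t f \<omega>"
    using w by (simp add: sint_Y[OF wM f] Ntilde_def Y_int_eq)
qed

end

section \<open>The transition semigroup\<close>

text \<open>This is \<mu>P_t. The value 0 on non-measurable sets matches the encoding by
  \<open>measure\<close>, so that it can equal an \<open>sdiff\<close> as a function on all
  sets.\<close>

definition heat :: "real \<Rightarrow> (real set \<Rightarrow> real) \<Rightarrow> real set \<Rightarrow> real" where
  "heat t \<mu> = (\<lambda>A. if A \<in> sets D_space then sint D_space \<mu> (absP t (indicator A)) else 0)"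

lemma
  assumes \<mu>: "\<mu> \<in> fin_signed D_space" and t: "0 \<le> t"
  shows heat_fin_signed: "heat t \<mu> \<in> fin_signed D_space"
    and sint_heat: "f \<in> bdd_borel D_space \<Longrightarrow> sint D_space (heat t \<mu>) f = sint D_space \<mu> (absP t f)"
proof -
  have tr: "\<exists>p'\<in>fin_meas D_space. \<forall>f\<in>bdd_borel D_space. (\<integral>y. f y \<partial>p') = (\<integral>x. absP t f x \<partial>p)"
    if p: "p \<in> fin_meas D_space" for p
  proof -
    interpret finite_measure p using p by (simp add: fin_meas_def)
    have s: "sets p = sets D_space" using p by (simp add: fin_meas_def)
    have sp: "space p = {0<..}" using sets_eq_imp_space_eq[OF s] by simp
    have xm: "(\<lambda>x. x) \<in> borel_measurable p"
      using measurable_D_id measurable_cong_sets[OF s refl] by blast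
    obtain p' where "p' \<in> fin_meas D_space"
      "\<And>f. f \<in> bdd_borel D_space \<Longrightarrow> (\<integral>y. f y \<partial>p') = (\<integral>z. 1 * absP t f z \<partial>p)"
      by (rule transport_measure[of "\<lambda>_. t" p "\<lambda>x. x" "\<lambda>_. 1"]) (use t xm sp in auto)
    then show ?thesis by auto
  qed
  obtain p n where pn: "p \<in> fin_meas D_space" "n \<in> fin_meas D_space" and mu: "\<mu> = sdiff p n"
    using \<mu> by (auto simp: fin_signed_def)
  obtain p' where p': "p' \<in> fin_meas D_space" "\<And>f. f \<in> bdd_borel D_space \<Longrightarrow> (\<integral>y. f y \<partial>p') = (\<integral>x. absP t f x \<partial>p)"
    using tr[OF pn(1)] by auto
  obtain n' where n': "n' \<in> fin_meas D_space" "\<And>f. f \<in> bdd_borel D_space \<Longrightarrow> (\<integral>y. f y \<partial>n') = (\<integral>x. absP t f x \<partial>n)"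
    using tr[OF pn(2)] by auto
  have int: "(\<integral>y. f y \<partial>p') - (\<integral>y. f y \<partial>n') = sint D_space \<mu> (absP t f)" if "f \<in> bdd_borel D_space" for f
    unfolding mu using p' n' pn that t by (simp add: sint_eq absP_bdd)
  have "heat t \<mu> = sdiff p' n'"
  proof
    fix A
    show "heat t \<mu> A = sdiff p' n' A"
    proof (cases "A \<in> sets D_space")
      case A: True
      have "A \<inter> space q = A" if "q \<in> fin_meas D_space" for q
        using sets.sets_into_space[OF A] sets_eq_imp_space_eq[of q D_space] that by (auto simp: fin_meas_def)
      then show ?thesis using int[OF indicator_bdd_borel[OF A]] A p' n'
        by (simp add: heat_def sdiff_def)
    next
      case False
      then show ?thesis using p' n' by (simp add: heat_def sdiff_def fin_meas_def measure_notin_sets)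
    qed
  qed
  then show "heat t \<mu> \<in> fin_signed D_space" "f \<in> bdd_borel D_space \<Longrightarrow> sint D_space (heat t \<mu>) f = sint D_space \<mu> (absP t f)"
    using p' n' int by (auto simp: fin_signed_def sint_eq)
qed

lemma integrable_iexp_finite:
  assumes "finite_measure L" "X \<in> borel_measurable L" shows "integrable L (\<lambda>\<omega>. iexp (X \<omega>))"
proof -
  interpret finite_measure L by fact
  show ?thesis by (rule integrable_const_bound[where B = 1]) (use assms(2) in auto)
qed

text \<open>Where g or h is 0, the function e^{iy} - 1 - iy of the sum splits, since it vanishes at
  0. Exponentiated, this is the factorisation of the characteristic functional over disjoint sets of
  jumps.\<close>

lemma (in driving) levy_add:
  assumes g: "dominated c T g" and h: "dominated c' T' h"
    and disj: "\<And>z. z \<in> space SUX_space \<Longrightarrow> g z = 0 \<or> h z = 0"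
  shows "(CLINT z|\<Lambda>. iexp (g z + h z) - 1 - \<i> * complex_of_real (g z + h z))
    = (CLINT z|\<Lambda>. iexp (g z) - 1 - \<i> * complex_of_real (g z)) + (CLINT z|\<Lambda>. iexp (h z) - 1 - \<i> * complex_of_real (h z))"
proof -
  have "(CLINT z|\<Lambda>. iexp (g z + h z) - 1 - \<i> * complex_of_real (g z + h z))
    = (CLINT z|\<Lambda>. (iexp (g z) - 1 - \<i> * complex_of_real (g z)) + (iexp (h z) - 1 - \<i> * complex_of_real (h z)))"
  proof (rule Bochner_Integration.integral_cong[OF refl])
    fix z assume "z \<in> space \<Lambda>"
    then have "g z = 0 \<or> h z = 0" using disj by (simp add: space_intensity)
    then show "iexp (g z + h z) - 1 - \<i> * complex_of_real (g z + h z)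
      = (iexp (g z) - 1 - \<i> * complex_of_real (g z)) + (iexp (h z) - 1 - \<i> * complex_of_real (h z))" by auto
  qed
  also have "\<dots> = (CLINT z|\<Lambda>. iexp (g z) - 1 - \<i> * complex_of_real (g z)) + (CLINT z|\<Lambda>. iexp (h z) - 1 - \<i> * complex_of_real (h z))"
    by (intro Bochner_Integration.integral_add levy_integrable[OF g] levy_integrable[OF h])
  finally show ?thesis .
qed

lemma Yg_split:
  assumes f: "f \<in> bdd_borel D_space" and s: "0 \<le> s" and t: "0 \<le> t" and z: "z \<in> space SUX_space"
  shows "Yg (s + t) f z = Yg s (absP t f) z + Wg {s<..s+t} (s+t) f z"
proof (cases "fst z \<le> s")
  case True
  then have "absP (max 0 (s - fst z)) (absP t f) (snd (snd z)) = absP (max 0 (s + t - fst z)) f (snd (snd z))"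
    using t by (subst absP_semigroup[OF f _ t SUX_pos(1)[OF z]]) (auto simp: max_def algebra_simps)
  then show ?thesis using True t by (simp add: Yg_eq' Wg_def)
qed (use t in \<open>auto simp: Yg_eq' Wg_def indicator_def\<close>)

context driven_process
begin

lemma window_dom: assumes "f \<in> bdd_borel D_space" obtains B where "dominated B (s + t) (Wg {s<..s+t} (s+t) f)"
proof -
  obtain B where "\<And>x. 0 < x \<Longrightarrow> \<bar>f x\<bar> \<le> B" using bdd_borel_D_bound[OF assms] by auto
  then show ?thesis by (intro that[of B] Wg_dominated[OF assms]) auto
qed

text \<open>The exponent of Y at time s + t is evaluated along \<open>Yg_split\<close>, whose two
  parts charge disjoint times. This is the identity of a skew convolution semigroup; with uniqueness
  of laws it yields the Chapman-Kolmogorov equation.\<close>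

lemma psi_add:
  assumes f: "f \<in> bdd_borel D_space" and s: "0 \<le> s" and t: "0 \<le> t"
  shows "psi (s + t) f = psi s (absP t f) + psi t f"
proof -
  have Pf: "absP t f \<in> bdd_borel D_space" by (rule absP_bdd[OF f t])
  obtain B where B: "dominated B s (Yg s (absP t f))" using Yg_dom[OF Pf] .
  obtain B' where B': "dominated B' (s + t) (Wg {s<..s+t} (s+t) f)" using window_dom[OF f] .
  have "psi (s + t) f = (CLINT z|\<Lambda>. iexp (Yg (s + t) f z) - 1 - \<i> * complex_of_real (Yg (s + t) f z))"
    using s t by (simp add: levy_Yg[OF f])
  also have "\<dots> = (CLINT z|\<Lambda>. iexp (Yg s (absP t f) z + Wg {s<..s+t} (s+t) f z) - 1
      - \<i> * complex_of_real (Yg s (absP t f) z + Wg {s<..s+t} (s+t) f z))"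
    by (intro Bochner_Integration.integral_cong refl) (simp only: Yg_split[OF f s t] space_intensity)
  also have "\<dots> = psi s (absP t f) + psi t f"
  proof -
    have disj: "Yg s (absP t f) z = 0 \<or> Wg {s<..s+t} (s+t) f z = 0" for z
      by (auto simp: Yg_eq' Wg_def indicator_def)
    show ?thesis
      unfolding levy_add[OF B B' disj] levy_Yg[OF Pf s] levy_window[OF f s t] ..
  qed
  finally show ?thesis .
qed

lemma iexp_sint_measurable:
  assumes "f \<in> bdd_borel D_space" shows "(\<lambda>\<nu>. iexp (sint D_space \<nu> f)) \<in> borel_measurable S"
  by (rule measurable_compose[OF sint_measurable[OF assms], of iexp]) simp

definition Rlaw :: "real \<Rightarrow> (real set \<Rightarrow> real) \<Rightarrow> (real set \<Rightarrow> real) measure" where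
  "Rlaw t \<mu> = distr M S (\<lambda>\<omega> A. heat t \<mu> A + Y t \<omega> A)"

lemma heat_Y_measurable:
  assumes t: "0 \<le> t"
  shows "(\<lambda>(\<mu>, \<omega>) A. heat t \<mu> A + Y t \<omega> A) \<in> S \<Otimes>\<^sub>M M \<rightarrow>\<^sub>M S"
proof (rule measurable_signed_space[OF fs_bdd])
  fix z assume "z \<in> space (S \<Otimes>\<^sub>M M)"
  then have z: "fst z \<in> fin_signed D_space" "snd z \<in> space M"
    by (auto simp: space_pair_measure space_signed_space)
  show "(case z of (\<mu>, \<omega>) \<Rightarrow> \<lambda>A. heat t \<mu> A + Y t \<omega> A) \<in> fin_signed D_space"
    using fin_signed_add[OF heat_fin_signed[OF z(1) t] Y_fin_signed[OF z(2)]] by (simp add: case_prod_beta)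
next
  fix k
  have [measurable]: "(\<lambda>\<mu>. sint D_space \<mu> (absP t (fs k))) \<in> borel_measurable S"
    by (rule sint_measurable[OF absP_bdd[OF fs_bdd t]])
  have [measurable]: "(\<lambda>\<omega>. sint D_space (Y t \<omega>) (fs k)) \<in> borel_measurable M"
    by (rule measurable_compose[OF Y_measurable sint_measurable[OF fs_bdd]])
  have "(\<lambda>z. sint D_space (fst z) (absP t (fs k)) + sint D_space (Y t (snd z)) (fs k)) \<in> borel_measurable (S \<Otimes>\<^sub>M M)"
    by measurable
  then show "(\<lambda>z. sint D_space (case z of (\<mu>, \<omega>) \<Rightarrow> \<lambda>A. heat t \<mu> A + Y t \<omega> A) (fs k)) \<in> borel_measurable (S \<Otimes>\<^sub>M M)"
    by (rule measurable_cong[THEN iffD1, rotated])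
      (auto simp: space_pair_measure space_signed_space sint_add_measure heat_fin_signed Y_fin_signed t fs_bdd sint_heat)
qed

lemma Rlaw_measurable:
  assumes t: "0 \<le> t" shows "Rlaw t \<in> S \<rightarrow>\<^sub>M prob_algebra S"
proof -
  have "M \<in> space (prob_algebra M)" by (simp add: space_prob_algebra prob_space_axioms)
  then show ?thesis
    unfolding Rlaw_def by (intro measurable_distr_prob_space2[OF measurable_const heat_Y_measurable[OF t]])
qed

lemma sets_Rlaw: "sets (Rlaw t \<mu>) = sets S" by (simp add: Rlaw_def)

lemma Rlaw_char:
  assumes t: "0 \<le> t" and \<mu>: "\<mu> \<in> fin_signed D_space" and f: "f \<in> bdd_borel D_space"
  shows "(CLINT \<nu>|Rlaw t \<mu>. iexp (sint D_space \<nu> f)) = iexp (sint D_space \<mu> (absP t f)) * exp (psi t f)"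
proof -
  have m: "(\<lambda>\<omega> A. heat t \<mu> A + Y t \<omega> A) \<in> M \<rightarrow>\<^sub>M S"
    using measurable_Pair2[OF heat_Y_measurable[OF t], of \<mu>] \<mu> by (simp add: space_signed_space)
  note sint_measurable[OF f, measurable]
  have "(CLINT \<nu>|Rlaw t \<mu>. iexp (sint D_space \<nu> f)) = (CLINT \<omega>|M. iexp (sint D_space (\<lambda>A. heat t \<mu> A + Y t \<omega> A) f))"
    unfolding Rlaw_def by (rule integral_distr[OF m]) measurable
  also have "\<dots> = (CLINT \<omega>|M. iexp (sint D_space \<mu> (absP t f)) * iexp (sint D_space (Y t \<omega>) f))"
    by (intro Bochner_Integration.integral_cong refl)
      (simp add: sint_add_measure heat_fin_signed \<mu> t Y_fin_signed f sint_heat distrib_left exp_add)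
  also have "\<dots> = iexp (sint D_space \<mu> (absP t f)) * exp (psi t f)"
    by (simp add: Y_char[OF f t])
  finally show ?thesis .
qed

lemma prob_Rlaw: "0 \<le> t \<Longrightarrow> \<mu> \<in> fin_signed D_space \<Longrightarrow> prob_space (Rlaw t \<mu>)"
  using measurable_space[OF Rlaw_measurable] by (auto simp: space_signed_space space_prob_algebra)

lemma has_R_functional_iff:
  "has_R_functional fs m \<eta> t \<mu> Q \<longleftrightarrow> sets Q = sets S \<and> prob_space Q \<and>
    (\<forall>f\<in>bdd_borel D_space. (CLINT \<nu>|Q. iexp (sint D_space \<nu> f)) = iexp (sint D_space \<mu> (absP t f)) * exp (psi t f))"
  by (simp add: has_R_functional_def psi_def exp_add)

lemma has_R_functional_Rlaw:
  "0 \<le> t \<Longrightarrow> \<mu> \<in> fin_signed D_space \<Longrightarrow> has_R_functional fs m \<eta> t \<mu> (Rlaw t \<mu>)"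
  by (simp add: has_R_functional_iff sets_Rlaw prob_Rlaw Rlaw_char)

lemma has_R_functional_unique:
  assumes "has_R_functional fs m \<eta> t \<mu> P" "has_R_functional fs m \<eta> t \<mu> Q"
  shows "P = Q"
proof (rule char_functional_unique[of "bdd_borel D_space"])
  show "P \<in> fin_meas S" "Q \<in> fin_meas S"
    using assms by (auto simp: has_R_functional_iff fin_meas_def prob_space.finite_measure)
qed (use assms in \<open>auto simp: has_R_functional_iff fs_bdd bdd_borel_add\<close>)

lemma has_R_functional_ex1:
  "0 \<le> t \<Longrightarrow> \<mu> \<in> fin_signed D_space \<Longrightarrow> \<exists>!Q. has_R_functional fs m \<eta> t \<mu> Q"
  using has_R_functional_Rlaw has_R_functional_unique by blast

lemma R_semigroup_eqI:
  "0 \<le> t \<Longrightarrow> \<mu> \<in> fin_signed D_space \<Longrightarrow> has_R_functional fs m \<eta> t \<mu> Q \<Longrightarrow> R_semigroup fs m \<eta> t \<mu> = Q"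
  unfolding R_semigroup_def by (rule the1_equality[OF has_R_functional_ex1])

lemma R_semigroup_Rlaw:
  "0 \<le> t \<Longrightarrow> \<mu> \<in> fin_signed D_space \<Longrightarrow> R_semigroup fs m \<eta> t \<mu> = Rlaw t \<mu>"
  by (rule R_semigroup_eqI[OF _ _ has_R_functional_Rlaw])

text \<open>Rewriting the composition as a mixture opens it to the interchange theorem for complex
  integrands.\<close>

lemma bind_eq_mixture:
  assumes P: "sets P = sets S" "prob_space P" and K: "K \<in> S \<rightarrow>\<^sub>M prob_algebra S"
  shows "kernel_on P S K" "P \<bind> K = mixture P K S"
proof -
  have Ks: "K \<in> S \<rightarrow>\<^sub>M subprob_algebra S" by (rule measurable_prob_algebraD[OF K])
  have sp: "space P = space S" by (rule sets_eq_imp_space_eq[OF P(1)])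
  show k: "kernel_on P S K"
    unfolding kernel_on_def
  proof (intro conjI ballI)
    show "sets (K x) = sets S" if "x \<in> space P" for x using sets_kernel[OF Ks] that sp by simp
    fix C assume "C \<in> sets S"
    then have "(\<lambda>x. emeasure (K x) C) \<in> borel_measurable S"
      by (intro measurable_compose[OF Ks measurable_emeasure_subprob_algebra])
    then show "(\<lambda>x. emeasure (K x) C) \<in> borel_measurable P" using measurable_cong_sets[OF P(1) refl] by blast
  qed
  have KP: "K \<in> P \<rightarrow>\<^sub>M subprob_algebra S" using Ks measurable_cong_sets[OF P(1) refl] by blast
  have ne: "space P \<noteq> {}" using P(2) by (rule prob_space.not_empty)
  show "P \<bind> K = mixture P K S"
  proof (rule measure_eqI)
    have "sets (P \<bind> K) = sets S" by (rule sets_bind[OF _ ne]) (use k in \<open>auto simp: kernel_on_def\<close>)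
    then show sets: "sets (P \<bind> K) = sets (mixture P K S)" by simp
    show "emeasure (P \<bind> K) A = emeasure (mixture P K S) A" if "A \<in> sets (P \<bind> K)" for A
      using that sets emeasure_bind[OF ne KP] emeasure_mixture[OF k] by simp
  qed
qed

lemma integral_iexp_bind:
  assumes P: "sets P = sets S" "prob_space P" and K: "K \<in> S \<rightarrow>\<^sub>M prob_algebra S" and f: "f \<in> bdd_borel D_space"
  shows "(CLINT \<nu>|P \<bind> K. iexp (sint D_space \<nu> f)) = (CLINT \<mu>|P. CLINT \<nu>|K \<mu>. iexp (sint D_space \<nu> f))"
  unfolding bind_eq_mixture(2)[OF assms(1-3)]
proof (rule integral_mixture[OF bind_eq_mixture(1)[OF assms(1-3)]])
  interpret P: prob_space P by fact
  note sint_measurable[OF f, measurable]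
  show "(\<lambda>\<nu>. iexp (sint D_space \<nu> f)) \<in> borel_measurable S" by measurable
  have "(\<integral>\<^sup>+z. \<integral>\<^sup>+y. ennreal (cmod (iexp (sint D_space y f))) \<partial>K z \<partial>P) = (\<integral>\<^sup>+z. 1 \<partial>P)"
  proof (intro nn_integral_cong)
    fix z assume "z \<in> space P"
    then have "prob_space (K z)" using measurable_space[OF K, of z] sets_eq_imp_space_eq[OF P(1)] by (simp add: space_prob_algebra)
    then show "(\<integral>\<^sup>+y. ennreal (cmod (iexp (sint D_space y f))) \<partial>K z) = 1"
      by (simp add: prob_space.emeasure_space_1)
  qed
  also have "\<dots> < \<infinity>" by (simp add: P.emeasure_space_1)
  finally show "(\<integral>\<^sup>+z. \<integral>\<^sup>+y. ennreal (cmod (iexp (sint D_space y f))) \<partial>K z \<partial>P) < \<infinity>" .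
qed

lemma R_semigroup_measurable: "0 \<le> t \<Longrightarrow> R_semigroup fs m \<eta> t \<in> S \<rightarrow>\<^sub>M prob_algebra S"
  using Rlaw_measurable
  by (rule measurable_cong[THEN iffD2, rotated]) (auto simp: space_signed_space R_semigroup_Rlaw)

lemma R_zero:
  assumes \<mu>: "\<mu> \<in> fin_signed D_space" shows "R_semigroup fs m \<eta> 0 \<mu> = return S \<mu>"
proof (rule R_semigroup_eqI[OF _ \<mu>])
  have mS: "\<mu> \<in> space S" using \<mu> by (simp add: space_signed_space)
  have P0: "absP 0 f = f" for f by (rule ext) (simp add: absP_def)
  \<comment> \<open>Time is integrated over the single point 0, a null set.\<close>
  have "psi 0 f = 0" for f
    unfolding psi_def set_lebesgue_integral_def
    by (rule integral_eq_zero_AE, rule eventually_mono[OF AE_lborel_singleton[of 0]]) (auto simp: indicator_def)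
  moreover have "(CLINT \<nu>|return S \<mu>. iexp (sint D_space \<nu> f)) = iexp (sint D_space \<mu> f)" if "f \<in> bdd_borel D_space" for f
    by (intro integral_return mS iexp_sint_measurable that)
  ultimately show "has_R_functional fs m \<eta> 0 \<mu> (return S \<mu>)"
    by (simp add: has_R_functional_iff prob_space_return[OF mS] P0)
qed simp

lemma R_semigroup_property:
  assumes s: "0 \<le> s" and t: "0 \<le> t" and \<mu>: "\<mu> \<in> fin_signed D_space"
  shows "R_semigroup fs m \<eta> (s + t) \<mu> = R_semigroup fs m \<eta> s \<mu> \<bind> R_semigroup fs m \<eta> t"
proof (rule R_semigroup_eqI[OF _ \<mu>])
  let ?P = "R_semigroup fs m \<eta> s \<mu>" and ?K = "R_semigroup fs m \<eta> t"
  have P: "sets ?P = sets S" "prob_space ?P" using R_semigroup_Rlaw[OF s \<mu>] sets_Rlaw prob_Rlaw[OF s \<mu>] by auto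
  note K = R_semigroup_measurable[OF t]
  have PK: "?P \<in> space (prob_algebra S)" using P by (simp add: space_prob_algebra)
  have "?P \<bind> ?K \<in> space (prob_algebra S)"
    using measurable_space[OF measurable_bind_prob_space[OF measurable_const[OF PK, of S] K], of \<mu>] \<mu>
    by (simp add: space_signed_space)
  then have B: "sets (?P \<bind> ?K) = sets S" "prob_space (?P \<bind> ?K)" by (auto simp: space_prob_algebra)
  have "(CLINT \<nu>|?P \<bind> ?K. iexp (sint D_space \<nu> f)) = iexp (sint D_space \<mu> (absP (s + t) f)) * exp (psi (s + t) f)"
    if f: "f \<in> bdd_borel D_space" for f
  proof -
    have Pf: "absP t f \<in> bdd_borel D_space" by (rule absP_bdd[OF f t])
    have "(CLINT \<nu>|?P \<bind> ?K. iexp (sint D_space \<nu> f)) = (CLINT \<nu>'|?P. CLINT \<nu>|?K \<nu>'. iexp (sint D_space \<nu> f))"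
      by (rule integral_iexp_bind[OF P K f])
    also have "\<dots> = (CLINT \<nu>'|?P. iexp (sint D_space \<nu>' (absP t f)) * exp (psi t f))"
      using sets_eq_imp_space_eq[OF P(1)]
      by (intro Bochner_Integration.integral_cong refl) (simp add: space_signed_space R_semigroup_Rlaw t Rlaw_char f)
    also have "\<dots> = iexp (sint D_space \<mu> (absP s (absP t f))) * exp (psi s (absP t f)) * exp (psi t f)"
      by (simp add: R_semigroup_Rlaw s \<mu> Rlaw_char Pf)
    \<comment> \<open>\<open>absP_semigroup\<close> holds for points of D only, so the two test
      functions are compared inside the integrals.\<close>
    also have "sint D_space \<mu> (absP s (absP t f)) = sint D_space \<mu> (absP (s + t) f)"
    proof -
      obtain p n where pn: "p \<in> fin_meas D_space" "n \<in> fin_meas D_space" and mu: "\<mu> = sdiff p n"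
        using \<mu> by (auto simp: fin_signed_def)
      have "(\<integral>x. absP s (absP t f) x \<partial>q) = (\<integral>x. absP (s + t) f x \<partial>q)" if "q \<in> fin_meas D_space" for q
        using that sets_eq_imp_space_eq[of q D_space]
        by (intro Bochner_Integration.integral_cong refl absP_semigroup[OF f s t]) (auto simp: fin_meas_def)
      then show ?thesis unfolding mu using pn s t by (simp add: sint_eq absP_bdd Pf f)
    qed
    finally show ?thesis using psi_add[OF f s t] by (simp add: exp_add)
  qed
  then show "has_R_functional fs m \<eta> (s + t) \<mu> (?P \<bind> ?K)" using B by (simp add: has_R_functional_iff)
qed (use s t in simp)

theorem R_transition_semigroup: "transition_semigroup S (R_semigroup fs m \<eta>)"
  unfolding transition_semigroup_def
  by (auto simp: R_semigroup_measurable R_zero space_signed_space R_semigroup_property)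

subsection \<open>The simple Markov property\<close>

text \<open>Chosen larger than the set of evaluations Y_r(f) with r at most s: linear combinations
  of evaluations at different times are again compensated integrals of dominated integrands, as the
  linearity demanded by the Fourier argument requires.\<close>

definition past :: "real \<Rightarrow> ('w \<Rightarrow> real) set" where
  "past s = {Ntilde g | g c. dominated c s g}"

lemma past_measurable: "X \<in> past s \<Longrightarrow> X \<in> borel_measurable M"
  by (auto simp: past_def intro: Ntilde_measurable)

definition past_events :: "real \<Rightarrow> 'w set set" where
  "past_events s = {X -` B \<inter> space M | X B. X \<in> past s \<and> B \<in> sets borel} \<union> null_sets M"

lemma past_events_subset: "past_events s \<subseteq> Pow (space M)"
  using sets.sets_into_space by (auto simp: past_events_def)

lemma natural_filt_past:
  assumes s: "0 \<le> s"
  shows "sets (natural_filt M S Y (ennreal s)) \<subseteq> sigma_sets (space M) (past_events s)"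
proof -
  let ?L = "sigma (space M) (past_events s)"
  have sL: "space ?L = space M" "sets ?L = sigma_sets (space M) (past_events s)"
    using past_events_subset by auto
  have Ym: "Y r \<in> ?L \<rightarrow>\<^sub>M S" if r: "r \<le> s" for r
  proof (rule measurable_signed_space[OF fs_bdd])
    show "\<omega> \<in> space ?L \<Longrightarrow> Y r \<omega> \<in> fin_signed D_space" for \<omega> by (simp add: sL Y_fin_signed)
    fix k
    obtain B where "dominated B r (Yg r (fs k))" using Yg_dom[OF fs_bdd] .
    then have d: "Ntilde (Yg r (fs k)) \<in> past s" using dominated_mono[OF _ r] by (auto simp: past_def)
    have "Ntilde (Yg r (fs k)) \<in> borel_measurable ?L"
    proof (rule measurableI)
      fix A :: "real set" assume "A \<in> sets borel"
      then have "Ntilde (Yg r (fs k)) -` A \<inter> space M \<in> past_events s" using d by (auto simp: past_events_def)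
      then show "Ntilde (Yg r (fs k)) -` A \<inter> space ?L \<in> sets ?L" by (simp add: sL)
    qed simp
    then show "(\<lambda>\<omega>. sint D_space (Y r \<omega>) (fs k)) \<in> borel_measurable ?L"
      by (rule measurable_cong[THEN iffD2, rotated]) (simp add: sL sint_Y fs_bdd)
  qed
  have gen: "{Y r -` B \<inter> space M | r B. 0 \<le> r \<and> ennreal r \<le> ennreal s \<and> B \<in> sets S} \<union> null_sets M
      \<subseteq> sigma_sets (space M) (past_events s)"
  proof (intro Un_least subsetI)
    fix A assume "A \<in> {Y r -` B \<inter> space M | r B. 0 \<le> r \<and> ennreal r \<le> ennreal s \<and> B \<in> sets S}"
    then obtain r B where "A = Y r -` B \<inter> space M" "r \<le> s" "B \<in> sets S" using s by (auto simp: ennreal_le_iff)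
    then show "A \<in> sigma_sets (space M) (past_events s)"
      using measurable_sets[OF Ym, of r B] by (simp add: sL)
  next
    fix A assume "A \<in> null_sets M"
    then show "A \<in> sigma_sets (space M) (past_events s)" by (intro sigma_sets.Basic) (simp add: past_events_def)
  qed
  have P: "{Y r -` B \<inter> space M | r B. 0 \<le> r \<and> ennreal r \<le> ennreal s \<and> B \<in> sets S} \<union> null_sets M \<subseteq> Pow (space M)"
    using sets.sets_into_space by auto
  show ?thesis
    unfolding natural_filt_def sets_measure_of[OF P]
    by (rule sigma_sets_mono[OF gen])
qed

text \<open>Let W be the part of Y_(s+t)(f) due to jumps in (s, s + t], and let Z be e^{iY_s(P_t f)}
  times the difference of e^{iW} and its mean. For X in \<open>past s\<close>, X + Y_s(P_t f) and W
  use disjoint jumps, so E[e^{iX} Z] = 0; \<open>fourier_zero\<close> upgrades this to E[1_A Z] = 0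
  for past events A, null sets included.\<close>

lemma simple_markov:
  assumes s: "0 \<le> s" and t: "0 \<le> t" and f: "f \<in> bdd_borel D_space"
    and A: "A \<in> sets (natural_filt M S Y (ennreal s))"
  shows "(CLINT \<omega>|M. indicator A \<omega> * iexp (sint D_space (Y (s + t) \<omega>) f))
    = (CLINT \<omega>|M. indicator A \<omega> * (iexp (sint D_space (Y s \<omega>) (absP t f)) * exp (psi t f)))"
proof -
  have Pf: "absP t f \<in> bdd_borel D_space" by (rule absP_bdd[OF f t])
  let ?g = "Yg s (absP t f)" and ?w = "Wg {s<..s+t} (s+t) f"
  obtain B where B: "dominated B s ?g" using Yg_dom[OF Pf] .
  obtain B' where B': "dominated B' (s + t) ?w" using window_dom[OF f] .
  note Ntilde_measurable[OF B, measurable] Ntilde_measurable[OF B', measurable]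
  have split: "sint D_space (Y (s + t) \<omega>) f = Ntilde ?g \<omega> + Ntilde ?w \<omega>" if "\<omega> \<in> space M" for \<omega>
    using Ntilde_add[OF B B', of 1 \<omega>] Ntilde_cong[of "Yg (s + t) f" "\<lambda>z. ?g z + 1 * ?w z" \<omega>]
    by (simp add: sint_Y[OF that f] Yg_split[OF f s t])
  define Z where "Z \<omega> = iexp (Ntilde ?g \<omega>) * (iexp (Ntilde ?w \<omega>) - exp (psi t f))" for \<omega>
  have i1: "integrable M (\<lambda>\<omega>. iexp (Ntilde ?g \<omega>) * iexp (Ntilde ?w \<omega>))"
    "integrable M (\<lambda>\<omega>. iexp (Ntilde ?g \<omega>) * exp (psi t f))"
    by (intro integrable_iexp_times integrable_iexp_finite finite_measure_axioms; measurable)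
      (intro integrable_iexp_times; simp)
  then have Zi: "integrable M Z" unfolding Z_def by (simp add: right_diff_distrib)
  have "(CLINT \<omega>|M. indicator A \<omega> * Z \<omega>) = 0"
  proof (rule fourier_zero[of "past s"])
    show "past s \<noteq> {}" using B by (auto simp: past_def)
    show "\<exists>W\<in>past s. \<forall>\<omega>\<in>space M. W \<omega> = X \<omega> + a * X' \<omega>" if "X \<in> past s" "X' \<in> past s" for X X' a
    proof -
      from that obtain g c h c' where gh: "dominated c s g" "dominated c' s h" "X = Ntilde g" "X' = Ntilde h"
        by (auto simp: past_def)
      show ?thesis
        by (rule bexI[of _ "Ntilde (\<lambda>z. g z + a * h z)"])
          (use gh in \<open>auto simp: past_def Ntilde_add intro: dominated_add\<close>)
    qed
    show "(CLINT \<omega>|M. iexp (X \<omega>) * Z \<omega>) = 0" if "X \<in> past s" for X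
    proof -
      from that obtain h c where h: "dominated c s h" "X = Ntilde h" by (auto simp: past_def)
      let ?k = "\<lambda>z. h z + 1 * ?g z"
      have k: "dominated (c + \<bar>1\<bar> * B) s ?k" by (rule dominated_add[OF h(1) B])
      have kw: "dominated (c + \<bar>1\<bar> * B + \<bar>1\<bar> * B') (s + t) (\<lambda>z. ?k z + 1 * ?w z)"
        by (rule dominated_add[OF dominated_mono[OF k] B']) (use t in simp)
      note Ntilde_measurable[OF k, measurable]
      have disj: "?k z = 0 \<or> ?w z = 0" if z: "z \<in> space SUX_space" for z
      proof (cases "fst z \<le> s")
        case True then show ?thesis by (simp add: Wg_def)
      next
        case False
        \<comment> \<open>The envelope of \<open>?k\<close> is 0 after time s, and the window of
          \<open>?w\<close> begins only after s.\<close>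
        then have "\<bar>?k z\<bar> \<le> 0" using dominatedD(3)[OF k z] by (simp add: indicator_upto_time)
        then show ?thesis by simp
      qed
      have "(CLINT \<omega>|M. iexp (X \<omega>) * Z \<omega>)
        = (CLINT \<omega>|M. iexp (Ntilde (\<lambda>z. ?k z + 1 * ?w z) \<omega>) - iexp (Ntilde ?k \<omega>) * exp (psi t f))"
        by (intro Bochner_Integration.integral_cong refl)
          (unfold Ntilde_add[OF k B'] Ntilde_add[OF h(1) B] h(2) Z_def,
            simp add: distrib_left exp_add right_diff_distrib mult.assoc)
      also have "\<dots> = (CLINT \<omega>|M. iexp (Ntilde (\<lambda>z. ?k z + 1 * ?w z) \<omega>)) - (CLINT \<omega>|M. iexp (Ntilde ?k \<omega>) * exp (psi t f))"
        by (intro Bochner_Integration.integral_diff integrable_mult_left integrable_iexp_finite finite_measure_axioms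
            Ntilde_measurable[OF k] Ntilde_measurable[OF kw])
      also have "(CLINT \<omega>|M. iexp (Ntilde (\<lambda>z. ?k z + 1 * ?w z) \<omega>)) =
          exp ((CLINT z|\<Lambda>. iexp (?k z) - 1 - \<i> * complex_of_real (?k z)) + psi t f)"
        unfolding Ntilde_char[OF kw] using levy_add[OF k B' disj] levy_window[OF f s t] by simp
      also have "(CLINT \<omega>|M. iexp (Ntilde ?k \<omega>) * exp (psi t f)) = exp (CLINT z|\<Lambda>. iexp (?k z) - 1 - \<i> * complex_of_real (?k z)) * exp (psi t f)"
        using Ntilde_char[OF k] by simp
      finally show ?thesis by (simp add: exp_add)
    qed
    show "A \<in> sigma_sets (space M) ({X -` B \<inter> space M | X B. X \<in> past s \<and> B \<in> sets borel} \<union> null_sets M)"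
      using A natural_filt_past[OF s] by (auto simp: past_events_def)
  qed (use past_measurable Zi in auto)
  moreover have "A \<in> sets M"
  proof -
    have "past_events s \<subseteq> sets M" using past_measurable by (auto simp: past_events_def intro: measurable_sets)
    then show ?thesis using A natural_filt_past[OF s] sets.sigma_sets_subset by blast
  qed
  then have iA: "integrable M (\<lambda>\<omega>. indicator A \<omega> * F \<omega>)" if "integrable M F" for F :: "'w \<Rightarrow> complex"
    by (intro Bochner_Integration.integrable_bound[OF that]) (use that in \<open>auto simp: norm_mult indicator_def\<close>)
  have "(CLINT \<omega>|M. indicator A \<omega> * Z \<omega>) = (CLINT \<omega>|M. indicator A \<omega> * (iexp (Ntilde ?g \<omega>) * iexp (Ntilde ?w \<omega>)) - indicator A \<omega> * (iexp (Ntilde ?g \<omega>) * exp (psi t f)))"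
    by (simp add: Z_def right_diff_distrib)
  also have "\<dots> = (CLINT \<omega>|M. indicator A \<omega> * (iexp (Ntilde ?g \<omega>) * iexp (Ntilde ?w \<omega>))) - (CLINT \<omega>|M. indicator A \<omega> * (iexp (Ntilde ?g \<omega>) * exp (psi t f)))"
    by (intro Bochner_Integration.integral_diff iA i1)
  finally have "(CLINT \<omega>|M. indicator A \<omega> * (iexp (Ntilde ?g \<omega>) * iexp (Ntilde ?w \<omega>))) = (CLINT \<omega>|M. indicator A \<omega> * (iexp (Ntilde ?g \<omega>) * exp (psi t f)))"
    using \<open>(CLINT \<omega>|M. indicator A \<omega> * Z \<omega>) = 0\<close> by simp
  moreover have "(CLINT \<omega>|M. indicator A \<omega> * iexp (sint D_space (Y (s + t) \<omega>) f)) = (CLINT \<omega>|M. indicator A \<omega> * (iexp (Ntilde ?g \<omega>) * iexp (Ntilde ?w \<omega>)))"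
    by (intro Bochner_Integration.integral_cong refl) (simp add: split distrib_left exp_add)
  moreover have "(CLINT \<omega>|M. indicator A \<omega> * (iexp (sint D_space (Y s \<omega>) (absP t f)) * exp (psi t f))) = (CLINT \<omega>|M. indicator A \<omega> * (iexp (Ntilde ?g \<omega>) * exp (psi t f)))"
    by (intro Bochner_Integration.integral_cong refl) (simp add: sint_Y Pf)
  ultimately show ?thesis by simp
qed

end

section \<open>The strong Markov property\<close>

text \<open>The successor puts the chosen grid point strictly to the right of x. For x = \<tau> the
  event that a given grid point is chosen is then decided by events \<tau> < q, which lie in the
  filtration before its right-continuous enlargement.\<close>

definition grid_index :: "nat \<Rightarrow> real \<Rightarrow> nat" where
  "grid_index n x = Suc (nat \<lfloor>real (Suc n) * x\<rfloor>)"

definition grid :: "nat \<Rightarrow> nat \<Rightarrow> real" where "grid n j = real j / real (Suc n)"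

lemma grid_nonneg: "0 \<le> grid n j" by (simp add: grid_def)

lemma grid_index_eq_iff:
  assumes "0 \<le> x"
  shows "grid_index n x = Suc j \<longleftrightarrow> grid n j \<le> x \<and> x < grid n (Suc j)"
proof -
  have "nat \<lfloor>real (Suc n) * x\<rfloor> = j \<longleftrightarrow> \<lfloor>real (Suc n) * x\<rfloor> = int j"
    using assms by (auto simp: nat_eq_iff)
  also have "\<dots> \<longleftrightarrow> real j \<le> real (Suc n) * x \<and> real (Suc n) * x < real j + 1"
    by (simp add: floor_eq_iff)
  also have "\<dots> \<longleftrightarrow> grid n j \<le> x \<and> x < grid n (Suc j)"
    by (simp add: grid_def field_simps)
  finally show ?thesis by (simp add: grid_index_def)
qed

lemma grid_bounds:
  assumes "0 \<le> x"
  shows "x \<le> grid n (grid_index n x)" "grid n (grid_index n x) \<le> x + 1 / real (Suc n)"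
proof -
  obtain j where j: "grid_index n x = Suc j" by (simp add: grid_index_def)
  then have "grid n j \<le> x" "x < grid n (Suc j)" using grid_index_eq_iff[OF assms] by auto
  then show "x \<le> grid n (grid_index n x)" "grid n (grid_index n x) \<le> x + 1 / real (Suc n)"
    unfolding j by (auto simp: grid_def add_divide_distrib)
qed

lemma grid_tendsto:
  assumes "0 \<le> x" shows "(\<lambda>n. grid n (grid_index n x)) \<longlonglongrightarrow> x"
proof (rule tendsto_sandwich[OF _ _ tendsto_const])
  show "(\<lambda>n. x + 1 / real (Suc n)) \<longlonglongrightarrow> x"
    using tendsto_add[OF tendsto_const[of x] LIMSEQ_inverse_real_of_nat] by (simp add: inverse_eq_divide)
qed (use grid_bounds[OF assms] in auto)

text \<open>On the piece where k = j the random index is a constant. The pieces contribute at most K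
  times their measures, which are summable, so identities at each fixed index add up to one at the
  random index.\<close>

lemma (in finite_measure) integral_partition:
  fixes Z Z' :: "nat \<Rightarrow> 'a \<Rightarrow> complex" and k :: "'a \<Rightarrow> nat"
  assumes U: "U \<in> sets M" and k [measurable]: "k \<in> M \<rightarrow>\<^sub>M count_space UNIV"
    and Z: "\<And>j. Z j \<in> borel_measurable M" "\<And>j \<omega>. cmod (Z j \<omega>) \<le> K"
    and Z': "\<And>j. Z' j \<in> borel_measurable M" "\<And>j \<omega>. cmod (Z' j \<omega>) \<le> K"
    and eq: "\<And>j. (CLINT \<omega>|M. indicator {\<omega> \<in> U. k \<omega> = j} \<omega> * Z j \<omega>) = (CLINT \<omega>|M. indicator {\<omega> \<in> U. k \<omega> = j} \<omega> * Z' j \<omega>)"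
  shows "(CLINT \<omega>|M. indicator U \<omega> * Z (k \<omega>) \<omega>) = (CLINT \<omega>|M. indicator U \<omega> * Z' (k \<omega>) \<omega>)"
proof -
  define A where "A j = {\<omega> \<in> U. k \<omega> = j}" for j
  have A [measurable]: "A j \<in> sets M" for j
  proof -
    have "A j = U \<inter> {\<omega> \<in> space M. k \<omega> = j}" using sets.sets_into_space[OF U] by (auto simp: A_def)
    also have "\<dots> \<in> sets M" by (intro sets.Int U) measurable
    finally show ?thesis .
  qed
  have *: "(\<lambda>j. CLINT \<omega>|M. indicator (A j) \<omega> * W j \<omega>) sums (CLINT \<omega>|M. indicator U \<omega> * W (k \<omega>) \<omega>)"
    if W [measurable]: "\<And>j. W j \<in> borel_measurable M" and K: "\<And>j \<omega>. cmod (W j \<omega>) \<le> K" for W :: "nat \<Rightarrow> 'a \<Rightarrow> complex"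
  proof -
    have s: "(\<lambda>j. indicator (A j) \<omega> * W j \<omega>) sums (indicator U \<omega> * W (k \<omega>) \<omega>)" for \<omega>
      using sums_single[of "k \<omega>" "\<lambda>j. indicator U \<omega> * W j \<omega>"]
      by (rule sums_cong[THEN iffD1, rotated]) (auto simp: A_def indicator_def)
    have sn: "summable (\<lambda>j. norm (indicator (A j) \<omega> * W j \<omega>))" for \<omega>
      by (rule summable_finite[of "{k \<omega>}"]) (auto simp: A_def indicator_def)
    have i: "integrable M (\<lambda>\<omega>. indicator (A j) \<omega> * W j \<omega>)" for j
    proof (rule integrable_const_bound[of _ K])
      have "0 \<le> K" using K norm_ge_zero order_trans by blast
      then show "AE \<omega> in M. cmod (indicator (A j) \<omega> * W j \<omega>) \<le> K" using K by (auto simp: norm_mult indicator_def)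
    qed measurable
    have "(\<lambda>j. CLINT \<omega>|M. indicator (A j) \<omega> * W j \<omega>) sums (CLINT \<omega>|M. (\<Sum>j. indicator (A j) \<omega> * W j \<omega>))"
    proof (rule sums_integral[OF i])
      have "summable (\<lambda>j. K * measure M (A j))"
      proof (intro summable_mult sums_summable[OF finite_measure_UNION])
        show "disjoint_family A" by (auto simp: disjoint_family_on_def A_def)
      qed (use A in auto)
      then show "summable (\<lambda>j. \<integral>\<omega>. norm (indicator (A j) \<omega> * W j \<omega>) \<partial>M)"
      proof (rule summable_comparison_test'[of _ 0])
        fix j
        have "norm (\<integral>\<omega>. norm (indicator (A j) \<omega> * W j \<omega>) \<partial>M) = (\<integral>\<omega>. norm (indicator (A j) \<omega> * W j \<omega>) \<partial>M)"
          by (simp add: Bochner_Integration.integral_nonneg)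
        also have "\<dots> \<le> (\<integral>\<omega>. K * indicator (A j) \<omega> \<partial>M)"
        proof (rule integral_mono)
          show "integrable M (\<lambda>\<omega>. K * indicator (A j) \<omega>)"
            by (intro integrable_mult_right integrable_real_indicator A) (simp add: less_top[symmetric])
          show "integrable M (\<lambda>\<omega>. norm (indicator (A j) \<omega> * W j \<omega>))" by (rule integrable_norm[OF i])
        qed (use K in \<open>auto simp: norm_mult indicator_def\<close>)
        also have "\<dots> = K * measure M (A j)" using sets.sets_into_space[OF A, of j] by (simp add: Int_absorb2)
        finally show "norm (\<integral>\<omega>. norm (indicator (A j) \<omega> * W j \<omega>) \<partial>M) \<le> K * measure M (A j)" .
      qed
    qed (use sn in auto)
    moreover have "(\<Sum>j. indicator (A j) \<omega> * W j \<omega>) = indicator U \<omega> * W (k \<omega>) \<omega>" for \<omega>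
      using s[of \<omega>] by (rule sums_unique[symmetric])
    ultimately show ?thesis by simp
  qed
  have "(\<lambda>j. CLINT \<omega>|M. indicator (A j) \<omega> * Z j \<omega>) = (\<lambda>j. CLINT \<omega>|M. indicator (A j) \<omega> * Z' j \<omega>)"
    unfolding A_def by (rule ext) (rule eq)
  with *[OF Z] have "(\<lambda>j. CLINT \<omega>|M. indicator (A j) \<omega> * Z' j \<omega>) sums (CLINT \<omega>|M. indicator U \<omega> * Z (k \<omega>) \<omega>)" by (rule subst[rotated])
  from sums_unique2[OF this *[OF Z']] show ?thesis .
qed

text \<open>An intersection of sigma-algebras on one space is a sigma-algebra, so
  \<open>sigma\<close> in \<open>augmented_filt\<close> adds no sets.\<close>

lemma sets_Inter_sigma:
  assumes "I \<noteq> {}" and sp: "\<And>i. i \<in> I \<Longrightarrow> space (G i) = \<Omega>"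
  shows "sets (sigma \<Omega> (\<Inter>i\<in>I. sets (G i))) = (\<Inter>i\<in>I. sets (G i))"
proof (rule sigma_algebra.sets_measure_of_eq)
  show "sigma_algebra \<Omega> (\<Inter>i\<in>I. sets (G i))"
    unfolding sigma_algebra_iff2
  proof (intro conjI ballI allI impI)
    obtain i where i: "i \<in> I" using assms(1) by auto
    have "(\<Inter>i\<in>I. sets (G i)) \<subseteq> sets (G i)" by (rule INT_lower[OF i])
    also have "\<dots> \<subseteq> Pow \<Omega>" using sets.space_closed[of "G i"] sp[OF i] by simp
    finally show "(\<Inter>i\<in>I. sets (G i)) \<subseteq> Pow \<Omega>" .
    show "\<Omega> - s \<in> (\<Inter>i\<in>I. sets (G i))" if "s \<in> (\<Inter>i\<in>I. sets (G i))" for s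
    proof (rule INT_I)
      fix i assume i: "i \<in> I"
      with that have "s \<in> sets (G i)" by simp
      from sets.compl_sets[OF this] show "\<Omega> - s \<in> sets (G i)" by (simp add: sp[OF i])
    qed
  qed auto
qed

context driven_process
begin

section \<open>The natural and the augmented filtration\<close>

abbreviation "Gf \<equiv> natural_filt M S Y"
abbreviation "Ff \<equiv> augmented_filt M S Y"

lemma natural_gen_subset:
  "{Y r -` B \<inter> space M | r B. 0 \<le> r \<and> ennreal r \<le> t \<and> B \<in> sets S} \<union> null_sets M \<subseteq> sets M"
  using Y_measurable by (auto intro: measurable_sets)

lemma natural_gen_Pow:
  "{Y r -` B \<inter> space M | r B. 0 \<le> r \<and> ennreal r \<le> t \<and> B \<in> sets S} \<union> null_sets M \<subseteq> Pow (space M)"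
  using order_trans[OF natural_gen_subset sets.space_closed] .

lemma space_Gf [simp]: "space (Gf t) = space M"
  unfolding natural_filt_def by (rule space_measure_of[OF natural_gen_Pow])

lemma sets_Gf: "sets (Gf t) = sigma_sets (space M) ({Y r -` B \<inter> space M | r B. 0 \<le> r \<and> ennreal r \<le> t \<and> B \<in> sets S} \<union> null_sets M)"
  unfolding natural_filt_def by (rule sets_measure_of[OF natural_gen_Pow])

lemma Gf_subset: "sets (Gf t) \<subseteq> sets M"
  unfolding sets_Gf by (rule sets.sigma_sets_subset[OF natural_gen_subset])

lemma Gf_mono: "s \<le> t \<Longrightarrow> sets (Gf s) \<subseteq> sets (Gf t)"
  unfolding sets_Gf by (rule sigma_sets_mono') (auto intro: order_trans)

lemma Y_Gf: "0 \<le> r \<Longrightarrow> ennreal r \<le> t \<Longrightarrow> Y r \<in> Gf t \<rightarrow>\<^sub>M S"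
proof (rule measurableI)
  show "Y r \<omega> \<in> space S" if "\<omega> \<in> space (Gf t)" for \<omega> using that by (simp add: space_signed_space Y_fin_signed)
  show "Y r -` B \<inter> space (Gf t) \<in> sets (Gf t)" if "0 \<le> r" "ennreal r \<le> t" "B \<in> sets S" for B
    unfolding sets_Gf space_Gf using that by (intro sigma_sets.Basic) auto
qed

lemma space_Ff: "space (Ff t) = space M"
  unfolding augmented_filt_def
proof (rule space_measure_of)
  have "(\<Inter>s\<in>{s. t < s \<or> s = \<infinity>}. sets (Gf s)) \<subseteq> sets (Gf \<infinity>)" by (rule INT_lower) simp
  also have "\<dots> \<subseteq> sets M" by (rule Gf_subset)
  also have "\<dots> \<subseteq> Pow (space M)" by (rule sets.space_closed)
  finally show "(\<Inter>s\<in>{s. t < s \<or> s = \<infinity>}. sets (Gf s)) \<subseteq> Pow (space M)" .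
qed

lemma sets_Ff_iff: "A \<in> sets (Ff t) \<longleftrightarrow> (\<forall>s. t < s \<or> s = \<infinity> \<longrightarrow> A \<in> sets (Gf s))"
proof -
  have "sets (Ff t) = (\<Inter>s\<in>{s. t < s \<or> s = \<infinity>}. sets (Gf s))"
    unfolding augmented_filt_def by (rule sets_Inter_sigma) (use space_Gf in auto)
  then show ?thesis by simp
qed

lemma Ff_subset_Gf: "t < s \<or> s = \<infinity> \<Longrightarrow> sets (Ff t) \<subseteq> sets (Gf s)"
  by (auto simp: sets_Ff_iff)

sublocale filt: filtration "space M" Ff
  by unfold_locales (auto simp: space_Ff sets_Ff_iff)

section \<open>Conditioning at a stopping time\<close>

context
  fixes \<tau> :: "'w \<Rightarrow> ennreal" assumes \<tau>: "stopping_time Ff \<tau>"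
begin

abbreviation "F\<tau> \<equiv> filt.pre_sigma \<tau>"

lemma sets_F\<tau>: "A \<in> sets F\<tau> \<longleftrightarrow> (\<forall>t. {\<omega> \<in> A. \<tau> \<omega> \<le> t} \<in> sets (Ff t))"
  by (simp add: filt.sets_pre_sigma[OF \<tau>])

lemma F\<tau>_subset: "sets F\<tau> \<subseteq> sets M"
proof
  fix A assume "A \<in> sets F\<tau>"
  \<comment> \<open>The bound t = top restricts nothing and recovers A itself.\<close>
  then have "{\<omega> \<in> A. \<tau> \<omega> \<le> top} \<in> sets (Ff top)" by (simp only: sets_F\<tau>)
  then have "A \<in> sets (Gf \<infinity>)" by (simp add: sets_Ff_iff)
  then show "A \<in> sets M" using Gf_subset by blast
qed

lemma F\<tau>_le: "A \<in> sets F\<tau> \<Longrightarrow> t < s \<or> s = \<infinity> \<Longrightarrow> {\<omega> \<in> A. \<tau> \<omega> \<le> t} \<in> sets (Gf s)"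
  by (auto simp: sets_F\<tau> sets_Ff_iff)

text \<open>For q < r the part of A where \<tau> is at most q lies in \<open>Ff q\<close>, which is
  contained in \<open>Gf r\<close>; countably many q increasing to r exhaust \<tau> < r.\<close>

lemma F\<tau>_less:
  assumes A: "A \<in> sets F\<tau>" and r: "0 \<le> r"
  shows "{\<omega> \<in> A. \<tau> \<omega> < ennreal r} \<in> sets (Gf (ennreal r))"
proof (cases "r = 0")
  case False
  then have r: "0 < r" using r by simp
  \<comment> \<open>The thresholds r - r/(n+1) start at 0 and stay nonnegative, so
    \<open>ennreal\<close> does not truncate them.\<close>
  have "{\<omega> \<in> A. \<tau> \<omega> < ennreal r} = (\<Union>n::nat. {\<omega> \<in> A. \<tau> \<omega> \<le> ennreal (r - r / real (Suc n))})"
  proof (intro equalityI subsetI)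
    fix \<omega> assume "\<omega> \<in> {\<omega> \<in> A. \<tau> \<omega> < ennreal r}"
    then have \<omega>: "\<omega> \<in> A" "\<tau> \<omega> < ennreal r" by auto
    then obtain y where y: "\<tau> \<omega> = ennreal y" "0 \<le> y" by (cases "\<tau> \<omega>") auto
    then have "y < r" using \<omega> r by (simp add: ennreal_less_iff)
    then obtain n where n: "r / (r - y) < real n" using reals_Archimedean2 by blast
    then have "r < real n * (r - y)" using \<open>y < r\<close> by (simp add: divide_less_eq)
    then have "r \<le> real (Suc n) * (r - y)" using \<open>y < r\<close> by (simp add: algebra_simps)
    then have "r / real (Suc n) \<le> r - y" by (simp add: divide_le_eq mult.commute)
    then have "\<tau> \<omega> \<le> ennreal (r - r / real (Suc n))" unfolding y(1) by (intro ennreal_leI) simp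
    then show "\<omega> \<in> (\<Union>n::nat. {\<omega> \<in> A. \<tau> \<omega> \<le> ennreal (r - r / real (Suc n))})" using \<omega> by auto
  next
    fix \<omega> assume "\<omega> \<in> (\<Union>n::nat. {\<omega> \<in> A. \<tau> \<omega> \<le> ennreal (r - r / real (Suc n))})"
    then obtain n where n: "\<omega> \<in> A" "\<tau> \<omega> \<le> ennreal (r - r / real (Suc n))" by auto
    have "ennreal (r - r / real (Suc n)) < ennreal r" using r by (intro ennreal_lessI) auto
    then show "\<omega> \<in> {\<omega> \<in> A. \<tau> \<omega> < ennreal r}" using n by auto
  qed
  also have "\<dots> \<in> sets (Gf (ennreal r))"
  proof (intro sets.countable_UN'' countableI_type F\<tau>_le[OF A] disjI1)
    show "ennreal (r - r / real (Suc n)) < ennreal r" for n using r by (intro ennreal_lessI) auto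
  qed
  finally show ?thesis .
qed simp

text \<open>Where \<tau> is infinite this is the default 0; the Markov identities below are
  therefore taken on events where \<tau> is finite.\<close>

definition T :: "'w \<Rightarrow> real" where "T \<omega> = enn2real (\<tau> \<omega>)"

lemma T_nonneg: "0 \<le> T \<omega>" by (simp add: T_def)

lemma tau_T: "\<tau> \<omega> < \<infinity> \<Longrightarrow> \<tau> \<omega> = ennreal (T \<omega>)" by (simp add: T_def)

lemma tau_measurable_M [measurable]: "\<tau> \<in> borel_measurable M"
proof (rule measurable_stopping_time[OF \<tau>])
  show "sets (Ff t) \<subseteq> sets M" for t
    by (rule order_trans[OF Ff_subset_Gf[of t \<infinity>] Gf_subset]) simp
qed (rule space_Ff)

lemma T_measurable [measurable]: "T \<in> borel_measurable M"
  unfolding T_def by measurable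

definition kn :: "nat \<Rightarrow> 'w \<Rightarrow> nat" where "kn n \<omega> = grid_index n (T \<omega>)"

lemma kn_measurable [measurable]: "kn n \<in> M \<rightarrow>\<^sub>M count_space UNIV"
  unfolding kn_def grid_index_def by measurable

text \<open>A grid point is chosen when \<tau> lies in the half-open cell to its left, which is a
  difference of two events \<tau> < q. The index 0 never occurs, since \<open>grid_index\<close> is
  a successor.\<close>

lemma kn_event:
  assumes A: "A \<in> sets F\<tau>"
  shows "{\<omega> \<in> A. \<tau> \<omega> < \<infinity> \<and> kn n \<omega> = j} \<in> sets (Gf (ennreal (grid n j)))"
proof (cases j)
  case 0
  then show ?thesis by (simp add: kn_def grid_index_def)
next
  case (Suc i)
  have "{\<omega> \<in> A. \<tau> \<omega> < \<infinity> \<and> kn n \<omega> = j} = {\<omega> \<in> A. \<tau> \<omega> < ennreal (grid n j)} - {\<omega> \<in> A. \<tau> \<omega> < ennreal (grid n i)}"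
  proof (rule set_eqI)
    fix \<omega>
    show "\<omega> \<in> {\<omega> \<in> A. \<tau> \<omega> < \<infinity> \<and> kn n \<omega> = j} \<longleftrightarrow> \<omega> \<in> {\<omega> \<in> A. \<tau> \<omega> < ennreal (grid n j)} - {\<omega> \<in> A. \<tau> \<omega> < ennreal (grid n i)}"
    proof (cases "\<tau> \<omega> < \<infinity>")
      case True
      show ?thesis
        using T_nonneg[of \<omega>] grid_nonneg
        by (auto simp: tau_T[OF True] kn_def Suc grid_index_eq_iff ennreal_less_iff)
    next
      case False
      then have "\<tau> \<omega> = top" by (simp add: less_top[symmetric])
      then show ?thesis by simp
    qed
  qed
  also have "\<dots> \<in> sets (Gf (ennreal (grid n j)))"
  proof (rule sets.Diff[OF F\<tau>_less[OF A grid_nonneg]])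
    have "grid n i \<le> grid n j" unfolding Suc grid_def by (intro divide_right_mono) auto
    then show "{\<omega> \<in> A. \<tau> \<omega> < ennreal (grid n i)} \<in> sets (Gf (ennreal (grid n j)))"
      using F\<tau>_less[OF A grid_nonneg, of n i] Gf_mono[OF ennreal_leI] by blast
  qed
  finally show ?thesis .
qed

lemma sint_Y_kn_measurable:
  assumes f: "f \<in> bdd_borel D_space"
  shows "(\<lambda>\<omega>. sint D_space (Y (grid n (kn n \<omega>) + t) \<omega>) f) \<in> borel_measurable M"
  by (rule measurable_compose_countable[OF _ kn_measurable, where f = "\<lambda>j \<omega>. sint D_space (Y (grid n j + t) \<omega>) f"])
    (rule measurable_compose[OF Y_measurable sint_measurable[OF f]])

lemma sint_Y_kn_tendsto:
  assumes w: "\<omega> \<in> space M" and f: "f \<in> bdd_borel D_space" "continuous_on {0<..} f"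
  shows "(\<lambda>n. sint D_space (Y (grid n (kn n \<omega>) + t) \<omega>) f) \<longlonglongrightarrow> sint D_space (Y (T \<omega> + t) \<omega>) f"
  unfolding kn_def
  by (rule Y_right_continuous[OF w f])
    (use grid_bounds[OF T_nonneg] in \<open>auto intro!: tendsto_intros grid_tendsto T_nonneg\<close>)

lemma sint_Y_T_measurable:
  assumes f: "f \<in> bdd_borel D_space" "continuous_on {0<..} f"
  shows "(\<lambda>\<omega>. sint D_space (Y (T \<omega> + t) \<omega>) f) \<in> borel_measurable M"
  by (rule borel_measurable_LIMSEQ_real[OF sint_Y_kn_tendsto[OF _ f] sint_Y_kn_measurable[OF f(1)]])

lemma Y_T_measurable: "(\<lambda>\<omega>. Y (T \<omega> + t) \<omega>) \<in> M \<rightarrow>\<^sub>M S"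
  by (rule measurable_signed_space[OF fs_bdd Y_fin_signed sint_Y_T_measurable[OF fs_bdd fs_continuous]])

lemma strong_markov_functional:
  assumes A: "A \<in> sets F\<tau>" and t: "0 \<le> t" and f: "f \<in> bdd_borel D_space" "continuous_on {0<..} f"
  defines "U \<equiv> {\<omega> \<in> A. \<tau> \<omega> < \<infinity>}"
  shows "(CLINT \<omega>|M. indicator U \<omega> * iexp (sint D_space (Y (T \<omega> + t) \<omega>) f))
    = (CLINT \<omega>|M. indicator U \<omega> * (iexp (sint D_space (Y (T \<omega>) \<omega>) (absP t f)) * exp (psi t f)))"
proof -
  have Pf: "absP t f \<in> bdd_borel D_space" "continuous_on {0<..} (absP t f)"
    using absP_bdd[OF f(1) t] absP_continuous_on[OF f t] by auto
  have AM: "A \<in> sets M" using A F\<tau>_subset by blast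
  have "U = A \<inter> {\<omega> \<in> space M. \<tau> \<omega> < \<infinity>}" using sets.sets_into_space[OF AM] by (auto simp: U_def)
  also have "\<dots> \<in> sets M" by (intro sets.Int AM) measurable
  finally have U [measurable]: "U \<in> sets M" .
  note mL = sint_Y_kn_measurable[OF f(1), measurable] and mR = sint_Y_kn_measurable[OF Pf(1), of _ 0, simplified, measurable]
  note mL' = sint_Y_T_measurable[OF f, measurable] and mR' = sint_Y_T_measurable[OF Pf, of 0, simplified, measurable]
  have Ym [measurable]: "(\<lambda>\<omega>. sint D_space (Y r \<omega>) g) \<in> borel_measurable M" if "g \<in> bdd_borel D_space" for r g
    by (rule measurable_compose[OF Y_measurable sint_measurable[OF that]])
  have step: "(CLINT \<omega>|M. indicator U \<omega> * iexp (sint D_space (Y (grid n (kn n \<omega>) + t) \<omega>) f))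
    = (CLINT \<omega>|M. indicator U \<omega> * (iexp (sint D_space (Y (grid n (kn n \<omega>)) \<omega>) (absP t f)) * exp (psi t f)))" for n
  \<comment> \<open>K bounds both integrands: the first has modulus 1, the second the modulus of exp
    (\<open>psi t f\<close>).\<close>
  proof (rule integral_partition[OF U kn_measurable, where K = "max 1 (cmod (exp (psi t f)))" and
        Z = "\<lambda>j \<omega>. iexp (sint D_space (Y (grid n j + t) \<omega>) f)" and
        Z' = "\<lambda>j \<omega>. iexp (sint D_space (Y (grid n j) \<omega>) (absP t f)) * exp (psi t f)"])
    fix j
    have e: "{\<omega> \<in> U. kn n \<omega> = j} = {\<omega> \<in> A. \<tau> \<omega> < \<infinity> \<and> kn n \<omega> = j}" by (auto simp: U_def)
    show "(CLINT \<omega>|M. indicator {\<omega> \<in> U. kn n \<omega> = j} \<omega> * iexp (sint D_space (Y (grid n j + t) \<omega>) f))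
      = (CLINT \<omega>|M. indicator {\<omega> \<in> U. kn n \<omega> = j} \<omega> * (iexp (sint D_space (Y (grid n j) \<omega>) (absP t f)) * exp (psi t f)))"
      unfolding e by (rule simple_markov[OF grid_nonneg t f(1) kn_event[OF A]])
  qed (use f(1) Pf(1) in \<open>auto simp: norm_mult\<close>)
  \<comment> \<open>Used with c = 1 for the left side and with c = exp (\<open>psi t f\<close>) for
    the right side.\<close>
  have lim: "(\<lambda>n. CLINT \<omega>|M. indicator U \<omega> * (iexp (X n \<omega>) * c)) \<longlonglongrightarrow> (CLINT \<omega>|M. indicator U \<omega> * (iexp (X' \<omega>) * c))"
    if [measurable]: "\<And>n. X n \<in> borel_measurable M" "X' \<in> borel_measurable M"
      and "\<And>\<omega>. \<omega> \<in> space M \<Longrightarrow> (\<lambda>n. X n \<omega>) \<longlonglongrightarrow> X' \<omega>" for X :: "nat \<Rightarrow> 'w \<Rightarrow> real" and X' and c :: complex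
  proof (rule integral_dominated_convergence[where w = "\<lambda>_. cmod c"])
    show "AE \<omega> in M. (\<lambda>n. indicator U \<omega> * (iexp (X n \<omega>) * c)) \<longlonglongrightarrow> indicator U \<omega> * (iexp (X' \<omega>) * c)"
      using that by (intro AE_I2 tendsto_intros)
  qed (auto simp: norm_mult indicator_def)
  have l1: "(\<lambda>n. CLINT \<omega>|M. indicator U \<omega> * (iexp (sint D_space (Y (grid n (kn n \<omega>) + t) \<omega>) f) * 1))
      \<longlonglongrightarrow> (CLINT \<omega>|M. indicator U \<omega> * (iexp (sint D_space (Y (T \<omega> + t) \<omega>) f) * 1))"
    by (rule lim[OF mL mL' sint_Y_kn_tendsto[OF _ f]])
  have l2: "(\<lambda>n. CLINT \<omega>|M. indicator U \<omega> * (iexp (sint D_space (Y (grid n (kn n \<omega>)) \<omega>) (absP t f)) * exp (psi t f)))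
      \<longlonglongrightarrow> (CLINT \<omega>|M. indicator U \<omega> * (iexp (sint D_space (Y (T \<omega>) \<omega>) (absP t f)) * exp (psi t f)))"
    by (rule lim[OF mR mR']) (use sint_Y_kn_tendsto[OF _ Pf, of _ 0] in simp)
  show ?thesis
    using LIMSEQ_unique[OF l1[unfolded mult_1_right step] l2] by simp
qed

text \<open>On \<tau> at most t, with t < s, the value at \<tau> has to be seen in
  \<open>Gf s\<close>, although the approximation uses later times. The grid points converge to a
  time below s, so only finitely many of them exceed s, and these may be discarded; for s infinite
  none does.\<close>

lemma Y_T_F\<tau>:
  "(\<lambda>\<omega>. Y (T \<omega>) \<omega>) \<in> restrict_space F\<tau> {\<omega>. \<tau> \<omega> < \<infinity>} \<rightarrow>\<^sub>M S"
proof (rule measurable_signed_space[OF fs_bdd])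
  show "Y (T \<omega>) \<omega> \<in> fin_signed D_space" if "\<omega> \<in> space (restrict_space F\<tau> {\<omega>. \<tau> \<omega> < \<infinity>})" for \<omega>
    using that by (simp add: space_restrict_space filt.space_pre_sigma Y_fin_signed)
  fix k
  let ?f = "fs k"
  have Om: "space M \<in> sets F\<tau>" using sets.top[of F\<tau>] by (simp add: filt.space_pre_sigma)
  define X where "X \<omega> = (if \<tau> \<omega> < \<infinity> then sint D_space (Y (T \<omega>) \<omega>) ?f else 0)" for \<omega>
  have "X \<in> borel_measurable F\<tau>"
  proof (rule measurableI)
    fix B :: "real set" assume B: "B \<in> sets borel"
    show "X -` B \<inter> space F\<tau> \<in> sets F\<tau>"
      unfolding sets_F\<tau> sets_Ff_iff
    proof (intro allI impI)
      fix t s :: ennreal assume ts: "t < s \<or> s = \<infinity>"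
      \<comment> \<open>Index 0 is free to mark a discarded approximation, because \<open>kn\<close>
        is always a successor. Grid points beyond s are discarded so that \<open>F n i\<close> is
        measurable at time s.\<close>
      define j where "j n \<omega> = (if \<tau> \<omega> \<le> t \<and> \<tau> \<omega> < \<infinity> \<and> ennreal (grid n (kn n \<omega>)) \<le> s then kn n \<omega> else 0)" for n \<omega>
      define F where "F n i \<omega> = (if i \<noteq> 0 \<and> ennreal (grid n i) \<le> s then sint D_space (Y (grid n i) \<omega>) ?f else 0)" for n i \<omega>
      have jm: "j n \<in> Gf s \<rightarrow>\<^sub>M count_space UNIV" for n
      proof -
        have ev: "{\<omega> \<in> space M. j n \<omega> = Suc i} \<in> sets (Gf s)" for i
        proof (cases "ennreal (grid n (Suc i)) \<le> s")
          case True
          have "{\<omega> \<in> space M. j n \<omega> = Suc i} = {\<omega> \<in> space M. \<tau> \<omega> \<le> t} \<inter> {\<omega> \<in> space M. \<tau> \<omega> < \<infinity> \<and> kn n \<omega> = Suc i}"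
            using True by (auto simp: j_def)
          also have "\<dots> \<in> sets (Gf s)"
            using F\<tau>_le[OF Om ts] kn_event[OF Om, of n "Suc i"] Gf_mono[OF True] by blast
          finally show ?thesis .
        next
          case False
          then have "{\<omega> \<in> space M. j n \<omega> = Suc i} = {}" by (auto simp: j_def)
          then show ?thesis by (simp only: sets.empty_sets)
        qed
        have z: "{\<omega> \<in> space M. j n \<omega> = 0} \<in> sets (Gf s)"
        proof -
          have "{\<omega> \<in> space M. j n \<omega> = 0} = space (Gf s) - (\<Union>i. {\<omega> \<in> space M. j n \<omega> = Suc i})"
            by (auto) (metis not0_implies_Suc)
          also have "\<dots> \<in> sets (Gf s)" using ev by (intro sets.compl_sets sets.countable_UN'') auto
          finally show ?thesis .
        qed
        have "j n -` {i} \<inter> space (Gf s) \<in> sets (Gf s)" for i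
        proof -
          have "j n -` {i} \<inter> space (Gf s) = {\<omega> \<in> space M. j n \<omega> = i}" by auto
          then show ?thesis using ev z by (cases i) auto
        qed
        then show ?thesis by (simp add: measurable_count_space_eq2_countable)
      qed
      have Fm: "F n i \<in> borel_measurable (Gf s)" for n i
      proof (cases "i \<noteq> 0 \<and> ennreal (grid n i) \<le> s")
        case True
        then show ?thesis
          using measurable_compose[OF Y_Gf[OF grid_nonneg, of n i s] sint_measurable[OF fs_bdd[of k]]] by (simp add: F_def[abs_def])
      qed (auto simp: F_def[abs_def])
      define X' where "X' \<omega> = (if \<tau> \<omega> \<le> t then X \<omega> else 0)" for \<omega>
      have "X' \<in> borel_measurable (Gf s)"
      proof (rule borel_measurable_LIMSEQ_real)
        show "(\<lambda>\<omega>. F n (j n \<omega>) \<omega>) \<in> borel_measurable (Gf s)" for n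
          by (rule measurable_compose_countable[OF Fm jm])
        fix \<omega> assume "\<omega> \<in> space (Gf s)"
        then have w: "\<omega> \<in> space M" by simp
        show "(\<lambda>n. F n (j n \<omega>) \<omega>) \<longlonglongrightarrow> X' \<omega>"
        proof (cases "\<tau> \<omega> \<le> t \<and> \<tau> \<omega> < \<infinity>")
          case True
          have "\<forall>\<^sub>F n in sequentially. ennreal (grid n (kn n \<omega>)) \<le> s"
          proof (cases "s = \<infinity>")
            case False
            then have "\<tau> \<omega> < s" using True ts by (auto intro: le_less_trans)
            then have "ennreal (T \<omega>) < s" using True tau_T[of \<omega>] by simp
            moreover have "(\<lambda>n. ennreal (grid n (kn n \<omega>))) \<longlonglongrightarrow> ennreal (T \<omega>)"
              unfolding kn_def by (intro tendsto_ennrealI grid_tendsto T_nonneg)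
            ultimately have "\<forall>\<^sub>F n in sequentially. ennreal (grid n (kn n \<omega>)) < s" by (intro order_tendstoD)
            then show ?thesis by eventually_elim simp
          qed simp
          then have ev: "\<forall>\<^sub>F n in sequentially. sint D_space (Y (grid n (kn n \<omega>) + 0) \<omega>) ?f = F n (j n \<omega>) \<omega>"
            by eventually_elim (use True in \<open>auto simp: F_def j_def kn_def grid_index_def\<close>)
          have "X' \<omega> = sint D_space (Y (T \<omega> + 0) \<omega>) ?f" using True by (simp add: X'_def X_def)
          then show ?thesis
            using Lim_transform_eventually[OF sint_Y_kn_tendsto[OF w fs_bdd fs_continuous] ev] by simp
        next
          case False
          then have "X' \<omega> = 0" "\<And>n. F n (j n \<omega>) \<omega> = 0" by (auto simp: X'_def X_def F_def j_def)
          then show ?thesis by simp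
        qed
      qed
      from measurable_sets[OF this B] have "X' -` B \<inter> space M \<in> sets (Gf s)" by simp
      moreover have "{\<omega> \<in> X -` B \<inter> space F\<tau>. \<tau> \<omega> \<le> t} = (X' -` B \<inter> space M) \<inter> {\<omega> \<in> space M. \<tau> \<omega> \<le> t}"
        by (auto simp: X'_def filt.space_pre_sigma)
      ultimately show "{\<omega> \<in> X -` B \<inter> space F\<tau>. \<tau> \<omega> \<le> t} \<in> sets (Gf s)"
        using F\<tau>_le[OF Om ts] by (simp only: sets.Int)
    qed
  qed simp
  then have "X \<in> borel_measurable (restrict_space F\<tau> {\<omega>. \<tau> \<omega> < \<infinity>})" by (rule measurable_restrict_space1)
  then show "(\<lambda>\<omega>. sint D_space (Y (T \<omega>) \<omega>) ?f) \<in> borel_measurable (restrict_space F\<tau> {\<omega>. \<tau> \<omega> < \<infinity>})"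
    by (rule measurable_cong[THEN iffD1, rotated]) (simp add: space_restrict_space X_def)
qed

text \<open>Two finite measures on S(D) are compared: the image of M restricted to U under the
  process at T + t, and the mixture of R_t started from the process at T. Restricting to U instead
  of conditioning avoids dividing by its probability, which may be 0.\<close>

lemma strong_markov_measure:
  assumes A: "A \<in> sets F\<tau>" and t: "0 \<le> t" and B: "B \<in> sets S"
  defines "U \<equiv> {\<omega> \<in> A. \<tau> \<omega> < \<infinity>}"
  shows "measure M {\<omega> \<in> U. Y (T \<omega> + t) \<omega> \<in> B} = (\<integral>\<omega>. indicator U \<omega> * measure (R_semigroup fs m \<eta> t (Y (T \<omega>) \<omega>)) B \<partial>M)"
proof -
  let ?R = "R_semigroup fs m \<eta> t"
  have AM: "A \<in> sets M" using A F\<tau>_subset by blast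
  have "U = A \<inter> {\<omega> \<in> space M. \<tau> \<omega> < \<infinity>}" using sets.sets_into_space[OF AM] by (auto simp: U_def)
  also have "\<dots> \<in> sets M" by (intro sets.Int AM) measurable
  finally have U [measurable]: "U \<in> sets M" .
  define L where "L = density M (indicator U)"
  have sL: "sets L = sets M" "space L = space M" "\<And>F. measurable L F = measurable M F" by (auto simp: L_def)
  have L: "finite_measure L"
  proof (rule finite_measureI)
    have "emeasure L (space L) = (\<integral>\<^sup>+\<omega>. indicator U \<omega> * indicator (space M) \<omega> \<partial>M)"
      unfolding L_def space_density by (rule emeasure_density) auto
    also have "\<dots> \<le> (\<integral>\<^sup>+\<omega>. 1 \<partial>M)" by (intro nn_integral_mono) (auto simp: indicator_def)
    also have "\<dots> < \<infinity>" by (simp add: emeasure_space_1)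
    finally show "emeasure L (space L) \<noteq> \<infinity>" by simp
  qed
  have ilint: "(CLINT \<omega>|L. g \<omega>) = (CLINT \<omega>|M. indicator U \<omega> * g \<omega>)" if "g \<in> borel_measurable M" for g :: "'w \<Rightarrow> complex"
  proof -
    have "L = density M (\<lambda>\<omega>. ennreal (indicator U \<omega>))" unfolding L_def by (intro density_cong) (auto simp: ennreal_indicator)
    then have "(CLINT \<omega>|L. g \<omega>) = (CLINT \<omega>|M. indicator U \<omega> *\<^sub>R g \<omega>)"
      using that by (simp add: integral_density)
    also have "\<dots> = (CLINT \<omega>|M. indicator U \<omega> * g \<omega>)"
      by (intro Bochner_Integration.integral_cong refl) (simp add: indicator_def)
    finally show ?thesis .
  qed
  note YT = Y_T_measurable[of t] and Y0 = Y_T_measurable[of 0, simplified]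
  have Rk: "(\<lambda>\<omega>. ?R (Y (T \<omega>) \<omega>)) \<in> M \<rightarrow>\<^sub>M prob_algebra S"
    by (rule measurable_compose[OF Y0 R_semigroup_measurable[OF t]])
  have Rs: "sets (?R (Y (T \<omega>) \<omega>)) = sets S" "prob_space (?R (Y (T \<omega>) \<omega>))" if "\<omega> \<in> space M" for \<omega>
    using measurable_space[OF Rk that] by (auto simp: space_prob_algebra)
  have Rm: "(\<lambda>\<omega>. emeasure (?R (Y (T \<omega>) \<omega>)) C) \<in> borel_measurable M" if "C \<in> sets S" for C
    using measurable_compose[OF measurable_prob_algebraD[OF Rk] measurable_emeasure_subprob_algebra[OF that]] .
  have ker: "kernel_on L S (\<lambda>\<omega>. ?R (Y (T \<omega>) \<omega>))"
    unfolding kernel_on_def using Rs Rm by (auto simp: sL)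
  define Q1 where "Q1 = distr L S (\<lambda>\<omega>. Y (T \<omega> + t) \<omega>)"
  define Q2 where "Q2 = mixture L (\<lambda>\<omega>. ?R (Y (T \<omega>) \<omega>)) S"
  have Q1f: "Q1 \<in> fin_meas S"
    using finite_measure.finite_measure_distr[OF L, of "\<lambda>\<omega>. Y (T \<omega> + t) \<omega>" S] YT by (simp add: fin_meas_def Q1_def sL)
  have Q2f: "Q2 \<in> fin_meas S"
  proof -
    have "emeasure Q2 (space Q2) = (\<integral>\<^sup>+\<omega>. emeasure (?R (Y (T \<omega>) \<omega>)) (space S) \<partial>L)"
      unfolding Q2_def by (simp add: emeasure_mixture[OF ker])
    also have "\<dots> = (\<integral>\<^sup>+\<omega>. 1 \<partial>L)"
    proof (intro nn_integral_cong)
      fix \<omega> assume "\<omega> \<in> space L"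
      then show "emeasure (?R (Y (T \<omega>) \<omega>)) (space S) = 1"
        using prob_space.emeasure_space_1[OF Rs(2)] sets_eq_imp_space_eq[OF Rs(1)] by (simp add: sL)
    qed
    also have "\<dots> < \<infinity>" using finite_measure.emeasure_finite[OF L, of "space L"] by (simp add: less_top)
    finally show ?thesis by (auto simp: fin_meas_def Q2_def intro!: finite_measureI)
  qed
  have "Q1 = Q2"
  proof (rule char_functional_unique[of "{f \<in> bdd_borel D_space. continuous_on {0<..} f}", OF _ _ _ Q1f Q2f])
    fix f assume "f \<in> {f \<in> bdd_borel D_space. continuous_on {0<..} f}"
    then have f: "f \<in> bdd_borel D_space" "continuous_on {0<..} f" by auto
    have Pf: "absP t f \<in> bdd_borel D_space" by (rule absP_bdd[OF f(1) t])
    note im = iexp_sint_measurable[OF f(1)]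
    have m1: "(\<lambda>\<omega>. iexp (sint D_space (Y (T \<omega> + t) \<omega>) f)) \<in> borel_measurable M"
      by (rule measurable_compose[OF YT im])
    have m2: "(\<lambda>\<omega>. iexp (sint D_space (Y (T \<omega>) \<omega>) (absP t f)) * exp (psi t f)) \<in> borel_measurable M"
      using measurable_compose[OF Y0 iexp_sint_measurable[OF Pf]] by measurable
    have "(CLINT \<nu>|Q1. iexp (sint D_space \<nu> f)) = (CLINT \<omega>|L. iexp (sint D_space (Y (T \<omega> + t) \<omega>) f))"
      unfolding Q1_def by (rule integral_distr[OF _ im]) (simp add: sL YT)
    also have "\<dots> = (CLINT \<omega>|M. indicator U \<omega> * iexp (sint D_space (Y (T \<omega> + t) \<omega>) f))" by (rule ilint[OF m1])
    also have "\<dots> = (CLINT \<omega>|M. indicator U \<omega> * (iexp (sint D_space (Y (T \<omega>) \<omega>) (absP t f)) * exp (psi t f)))"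
      unfolding U_def by (rule strong_markov_functional[OF A t f])
    also have "\<dots> = (CLINT \<omega>|L. iexp (sint D_space (Y (T \<omega>) \<omega>) (absP t f)) * exp (psi t f))" by (rule ilint[OF m2, symmetric])
    also have "\<dots> = (CLINT \<omega>|L. CLINT \<nu>|?R (Y (T \<omega>) \<omega>). iexp (sint D_space \<nu> f))"
      by (intro Bochner_Integration.integral_cong refl) (simp add: sL R_semigroup_Rlaw t Y_fin_signed Rlaw_char f(1))
    also have "\<dots> = (CLINT \<nu>|Q2. iexp (sint D_space \<nu> f))"
      unfolding Q2_def
    proof (rule integral_mixture[OF ker im, symmetric])
      have "(\<integral>\<^sup>+\<omega>. \<integral>\<^sup>+y. ennreal (cmod (iexp (sint D_space y f))) \<partial>?R (Y (T \<omega>) \<omega>) \<partial>L) = (\<integral>\<^sup>+\<omega>. 1 \<partial>L)"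
        by (intro nn_integral_cong) (simp add: sL Rs(2) prob_space.emeasure_space_1)
      also have "\<dots> < \<infinity>" using finite_measure.emeasure_finite[OF L, of "space L"] by (simp add: less_top)
      finally show "(\<integral>\<^sup>+\<omega>. \<integral>\<^sup>+y. ennreal (cmod (iexp (sint D_space y f))) \<partial>?R (Y (T \<omega>) \<omega>) \<partial>L) < \<infinity>" .
    qed
    finally show "(CLINT \<nu>|Q1. iexp (sint D_space \<nu> f)) = (CLINT \<nu>|Q2. iexp (sint D_space \<nu> f))" .
  qed (auto simp: fs_bdd fs_continuous bdd_borel_add intro!: continuous_intros)
  then have eq: "emeasure Q1 B = emeasure Q2 B" by simp
  let ?E = "{\<omega> \<in> U. Y (T \<omega> + t) \<omega> \<in> B}"
  have E: "?E = U \<inter> ((\<lambda>\<omega>. Y (T \<omega> + t) \<omega>) -` B \<inter> space M)" using sets.sets_into_space[OF U] by auto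
  have Es: "(\<lambda>\<omega>. Y (T \<omega> + t) \<omega>) -` B \<inter> space M \<in> sets M" by (rule measurable_sets[OF YT B])
  have "emeasure Q1 B = emeasure L ((\<lambda>\<omega>. Y (T \<omega> + t) \<omega>) -` B \<inter> space M)"
    unfolding Q1_def using YT B by (simp add: emeasure_distr sL)
  also have "\<dots> = emeasure M ?E"
    unfolding L_def E using Es U by (subst emeasure_density) (auto simp: indicator_inter_arith[symmetric])
  finally have 1: "emeasure Q1 B = ennreal (prob ?E)" by (simp add: emeasure_eq_measure)
  have "emeasure Q2 B = (\<integral>\<^sup>+\<omega>. emeasure (?R (Y (T \<omega>) \<omega>)) B \<partial>L)"
    unfolding Q2_def by (rule emeasure_mixture[OF ker B])
  also have "\<dots> = (\<integral>\<^sup>+\<omega>. indicator U \<omega> * emeasure (?R (Y (T \<omega>) \<omega>)) B \<partial>M)"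
    unfolding L_def using Rm[OF B] by (subst nn_integral_density) auto
  also have "\<dots> = (\<integral>\<^sup>+\<omega>. ennreal (indicator U \<omega> * measure (?R (Y (T \<omega>) \<omega>)) B) \<partial>M)"
  proof (intro nn_integral_cong)
    fix \<omega> assume "\<omega> \<in> space M"
    then have "finite_measure (?R (Y (T \<omega>) \<omega>))" using Rs(2) by (simp add: prob_space.finite_measure)
    then show "indicator U \<omega> * emeasure (?R (Y (T \<omega>) \<omega>)) B = ennreal (indicator U \<omega> * measure (?R (Y (T \<omega>) \<omega>)) B)"
      by (auto simp: finite_measure.emeasure_eq_measure indicator_def)
  qed
  also have "\<dots> = ennreal (\<integral>\<omega>. indicator U \<omega> * measure (?R (Y (T \<omega>) \<omega>)) B \<partial>M)"
  proof (rule nn_integral_eq_integral)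
    have [measurable]: "(\<lambda>\<omega>. measure (?R (Y (T \<omega>) \<omega>)) B) \<in> borel_measurable M"
      using Rm[OF B] unfolding measure_def by measurable
    show "integrable M (\<lambda>\<omega>. indicator U \<omega> * measure (?R (Y (T \<omega>) \<omega>)) B)"
      by (rule integrable_const_bound[where B = 1])
        (auto intro!: AE_I2 simp: indicator_def prob_space.prob_le_1[OF Rs(2)])
  qed auto
  finally have "ennreal (prob ?E) = ennreal (\<integral>\<omega>. indicator U \<omega> * measure (?R (Y (T \<omega>) \<omega>)) B \<partial>M)"
    using 1 eq by simp
  then show ?thesis
    by (subst (asm) ennreal_inj) (auto intro!: Bochner_Integration.integral_nonneg)
qed

lemma strong_markov_cond_exp:
  assumes t: "0 \<le> t" and B: "B \<in> sets S"
  shows "AE \<omega> in M. \<tau> \<omega> < \<infinity> \<longrightarrow>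
    real_cond_exp M F\<tau> (indicator {\<omega>' \<in> space M. \<tau> \<omega>' < \<infinity> \<and> Y (T \<omega>' + t) \<omega>' \<in> B}) \<omega>
      = measure (R_semigroup fs m \<eta> t (Y (T \<omega>) \<omega>)) B"
proof -
  let ?R = "R_semigroup fs m \<eta> t"
  let ?E = "{\<omega>' \<in> space M. \<tau> \<omega>' < \<infinity> \<and> Y (T \<omega>' + t) \<omega>' \<in> B}"
  \<comment> \<open>Set to 0 where \<tau> is infinite, just as the indicator of \<open>?E\<close>
    is, so that the two can be compared as conditional expectations on the whole space.\<close>
  let ?g = "\<lambda>\<omega>. if \<tau> \<omega> < \<infinity> then measure (?R (Y (T \<omega>) \<omega>)) B else 0"
  have sub: "subalgebra M F\<tau>" using F\<tau>_subset by (simp add: subalgebra_def filt.space_pre_sigma)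
  interpret sub: finite_measure_subalgebra M F\<tau> by unfold_locales (rule sub)
  have tauF: "\<tau> \<in> borel_measurable F\<tau>" by (rule filt.measurable_stopping_time_pre_sigma[OF \<tau>])
  have fin: "{\<omega>. \<tau> \<omega> < \<infinity>} \<inter> space F\<tau> \<in> sets F\<tau>"
    using measurable_sets[OF tauF, of "{..<\<infinity>}"] by (simp add: vimage_def lessThan_def)
  have "(\<lambda>\<mu>. measure (?R \<mu>) B) \<in> borel_measurable S"
    by (rule measurable_compose[OF R_semigroup_measurable[OF t] measurable_measure_prob_algebra[OF B]])
  from measurable_compose[OF Y_T_F\<tau> this]
  have "(\<lambda>\<omega>. measure (?R (Y (T \<omega>) \<omega>)) B) \<in> borel_measurable (restrict_space F\<tau> {\<omega>. \<tau> \<omega> < \<infinity>})" .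
  then have "(\<lambda>\<omega>. indicator {\<omega>. \<tau> \<omega> < \<infinity>} \<omega> *\<^sub>R measure (?R (Y (T \<omega>) \<omega>)) B) \<in> borel_measurable F\<tau>"
    by (subst (asm) borel_measurable_restrict_space_iff[OF fin])
  then have gF: "?g \<in> borel_measurable F\<tau>"
    by (rule measurable_cong[THEN iffD1, rotated]) (simp add: indicator_def)
  have gM: "?g \<in> borel_measurable M" by (rule measurable_from_subalg[OF sub gF])
  have Rs: "prob_space (?R (Y (T \<omega>) \<omega>))" if "\<omega> \<in> space M" for \<omega>
    using prob_Rlaw[OF t Y_fin_signed[OF that]] by (simp add: R_semigroup_Rlaw t Y_fin_signed[OF that])
  have gi: "integrable M ?g"
    by (rule integrable_const_bound[where B = 1, OF _ gM]) (auto intro!: AE_I2 simp: prob_space.prob_le_1[OF Rs])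
  have "?E = (\<tau> -` {..<\<infinity>} \<inter> space M) \<inter> ((\<lambda>\<omega>. Y (T \<omega> + t) \<omega>) -` B \<inter> space M)" by auto
  also have "\<dots> \<in> sets M" by (intro sets.Int measurable_sets[OF Y_T_measurable B] measurable_sets[OF tau_measurable_M]) simp
  finally have E: "?E \<in> sets M" .
  have "AE \<omega> in M. real_cond_exp M F\<tau> (indicator ?E) \<omega> = ?g \<omega>"
  proof (rule sub.real_cond_exp_charact[OF _ _ gi gF])
    show "integrable M (indicator ?E :: _ \<Rightarrow> real)" using E by (intro integrable_real_indicator) (auto simp: less_top[symmetric])
    fix A assume A: "A \<in> sets F\<tau>"
    then have AM: "A \<in> sets M" using F\<tau>_subset by blast
    have "(\<integral>\<omega>\<in>A. indicator ?E \<omega> \<partial>M) = (\<integral>\<omega>. indicator {\<omega> \<in> {\<omega> \<in> A. \<tau> \<omega> < \<infinity>}. Y (T \<omega> + t) \<omega> \<in> B} \<omega> \<partial>M)"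
      unfolding set_lebesgue_integral_def by (intro Bochner_Integration.integral_cong refl) (auto simp: indicator_def)
    also have "\<dots> = measure M {\<omega> \<in> {\<omega> \<in> A. \<tau> \<omega> < \<infinity>}. Y (T \<omega> + t) \<omega> \<in> B}"
      using sets.sets_into_space[OF AM] by (auto intro!: arg_cong[where f = "measure M"])
    also have "\<dots> = (\<integral>\<omega>. indicator {\<omega> \<in> A. \<tau> \<omega> < \<infinity>} \<omega> * measure (?R (Y (T \<omega>) \<omega>)) B \<partial>M)"
      by (rule strong_markov_measure[OF A t B])
    also have "\<dots> = (\<integral>\<omega>\<in>A. ?g \<omega> \<partial>M)"
      unfolding set_lebesgue_integral_def by (intro Bochner_Integration.integral_cong refl) (auto simp: indicator_def)
    finally show "(\<integral>\<omega>\<in>A. indicator ?E \<omega> \<partial>M) = (\<integral>\<omega>\<in>A. ?g \<omega> \<partial>M)" .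
  qed
  then show ?thesis by eventually_elim simp
qed

end

theorem Y_strong_markov: "strong_markov_process M S Y (R_semigroup fs m \<eta>)"
  unfolding strong_markov_process_def Let_def
proof (intro conjI allI impI ballI)
  show "Y t \<in> M \<rightarrow>\<^sub>M S" for t by (rule Y_measurable)
  fix \<tau> :: "'w \<Rightarrow> ennreal" assume \<tau>: "stopping_time Ff \<tau>"
  show "(\<lambda>\<omega>. Y (enn2real (\<tau> \<omega>) + 0) \<omega>) \<in> restrict_space (filt.pre_sigma \<tau>) {\<omega>. \<tau> \<omega> < \<infinity>} \<rightarrow>\<^sub>M S"
    using Y_T_F\<tau>[OF \<tau>] by (simp add: T_def[OF \<tau>])
  fix t :: real and B assume "0 \<le> t" "B \<in> sets S"
  then show "AE \<omega> in M. \<tau> \<omega> < \<infinity> \<longrightarrow>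
      real_cond_exp M (filt.pre_sigma \<tau>) (indicator {\<omega>' \<in> space M. \<tau> \<omega>' < \<infinity> \<and> Y (enn2real (\<tau> \<omega>') + t) \<omega>' \<in> B}) \<omega>
        = measure (R_semigroup fs m \<eta> t (Y (enn2real (\<tau> \<omega>) + 0) \<omega>)) B"
    using strong_markov_cond_exp[OF \<tau>] by (simp add: T_def[OF \<tau>])
qed

end

theorem theorem5p1:
  fixes d :: "real metric" and fs :: "nat \<Rightarrow> real \<Rightarrow> real"
    and \<eta> :: "real measure" and m :: "real \<Rightarrow> real measure"
    and M :: "'w measure" and N :: "'w \<Rightarrow> (real \<times> real \<times> real) measure"
  assumes "mspace d = {0<..}" and "mtopology_of d = top_of_set {0<..}"
    and "dense_in_buc d fs"
    and "sets \<eta> = sets D_space" and "finite_measure \<eta>"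
    and "kernel_on D_space R0_space m"
    and "(SUP x\<in>{0<..}. \<integral>\<^sup>+u. ennreal \<bar>u\<bar> \<partial>m x) < \<infinity>"
    and "prob_space M" and "poisson_random_measure M (intensity m \<eta>) N"
  shows
    "(AE \<omega> in M. \<forall>t\<ge>0. Y_proc (intensity m \<eta>) N t \<omega> \<in> fin_signed D_space \<and>
        (\<forall>f\<in>bdd_borel D_space.
           set_integrable (N \<omega>) (upto_time t) (Y_integrand t f) \<and>
           set_integrable (intensity m \<eta>) (upto_time t) (Y_integrand t f) \<and>
           sint D_space (Y_proc (intensity m \<eta>) N t \<omega>) f = Y_int (intensity m \<eta>) N t f \<omega>)) \<and>
     (AE \<omega> in M. \<forall>t\<ge>0.
        ((\<lambda>s. rho_dist D_space fs (Y_proc (intensity m \<eta>) N s \<omega>) (Y_proc (intensity m \<eta>) N t \<omega>))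
           \<longlongrightarrow> 0) (at_right t)) \<and>
     (\<forall>t\<ge>0. \<forall>\<mu>\<in>fin_signed D_space. \<exists>!Q. has_R_functional fs m \<eta> t \<mu> Q) \<and>
     transition_semigroup (signed_space D_space fs) (R_semigroup fs m \<eta>) \<and>
     strong_markov_process M (signed_space D_space fs)
       (Y_proc (intensity m \<eta>) N) (R_semigroup fs m \<eta>)"
proof -
  interpret driven_process d fs \<eta> m M N
    using assms
    by (intro driven_process.intro signed_state.intro driving.intro poisson_measure.intro poisson_measure_axioms.intro)
  have "AE \<omega> in M. \<forall>t\<ge>0. Y t \<omega> \<in> fin_signed D_space \<and>
        (\<forall>f\<in>bdd_borel D_space.
           set_integrable (N \<omega>) (upto_time t) (Y_integrand t f) \<and>
           set_integrable (intensity m \<eta>) (upto_time t) (Y_integrand t f) \<and>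
           sint D_space (Y t \<omega>) f = Y_int (intensity m \<eta>) N t f \<omega>)"
    using AE_good by eventually_elim (use Y_functional in blast)
  \<comment> \<open>Right continuity holds on every path; off \<open>good\<close> the path is
    constantly zero.\<close>
  moreover have "AE \<omega> in M. \<forall>t\<ge>0. ((\<lambda>s. rho_dist D_space fs (Y s \<omega>) (Y t \<omega>)) \<longlongrightarrow> 0) (at_right t)"
    using Y_rho_right_continuous by (intro AE_I2) blast
  ultimately show ?thesis
    using has_R_functional_ex1 R_transition_semigroup Y_strong_markov by blast
qed

end
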